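(* Let $1<r<\infty$, $\frac1r+\frac1{r'}=1$, $2r'\le q\le\infty$ and $b>1/r$. Let $N_1,N_2,N_3$ be dyadic numbers with $1\le N_3\ll N_1\sim N_2$, and set $$m_\pm(\xi_1,\xi_2)=\chi_{N_3}(\xi_1\pm\xi_2)\,\chi_{N_1}(\xi_1)\,\chi_{N_2}(\xi_2).$$ Then for all $u,v\in\widehat X^{0,b}_{r,q}$, $$\|B_{m_-}(u,v)\|_{\widehat L^r_{t,x}}+\|\varphi(t)B_{m_+}(u,v)\|_{\widehat L^r_{t,x}}\le C\,N_1^{-1/r}\,N_1^{1/r'-2/q}\,N_3^{1/r'-1/r}\,\|u\|_{\widehat X^{0,b}_{r,q}}\|v\|_{\widehat X^{0,b}_{r,q}},$$ where the constant $C$ is independent of $N_1,N_2,N_3,u,v$.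
   Context: Fourier transforms are denoted by $\widehat{\cdot}$ (in $(x,t)$ with dual variables $(\xi,\tau)$ for functions of $(x,t)$), and $\langle a\rangle=(1+|a|^2)^{1/2}$. Dyadic numbers are elements of $2^{\mathbb{Z}}$. $N_3\ll N_1$ means $N_3\le cN_1$ for a sufficiently small absolute constant $c>0$; $N_1\sim N_2$ means that $N_1/N_2$ is bounded above and below by fixed positive constants. Fix $\varphi\in C_0^\infty(\mathbb{R})$ real-valued, non-negative, even, radially decreasing, with $\operatorname{supp}\varphi\subset[-5/4,5/4]$ and $\varphi\equiv1$ on $[-1,1]$. Put $\chi(\xi)=\varphi(\xi)-\varphi(2\xi)$ and $\chi_N(\xi)=\chi(\xi/N)$. Put $\eta(\xi)=\varphi(\xi)/\sum_{k\in\mathbb{Z}}\varphi(\xi-k)$. The norm of $\widehat L^r_{t,x}$ is $\|u\|_{\widehat L^r_{t,x}}=\|\widehat u(\xi,\tau)\|_{L^{r'}_{\tau,\xi}}$. For $s,b\in\mathbb{R}$, $1\le r,q\le\infty$, the space $\widehat X^{s,b}_{r,q}$ has norm $$\|u\|_{\widehat X^{s,b}_{r,q}}=\Big\|\,\big\|\langle\xi\rangle^s\langle\tau-\xi^3\rangle^b\,\eta(\xi-k)\widehat u(\xi,\tau)\big\|_{L^{r'}_{\tau,\xi}}\Big\|_{\ell^q_k(\mathbb{Z})}.$$ For a function $m$ on $\mathbb{R}^2$, $B_m$ is the bilinear multiplier operator acting in the $x$ variable (for each fixed $t$): $$\mathcal F_x(B_m(f,g))(\xi)=\int_{\mathbb{R}}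 m(\xi_1,\xi-\xi_1)\,\widehat f(\xi_1)\,\widehat g(\xi-\xi_1)\,d\xi_1.$$ *)

theory Defs
  imports "HOL-Probability.Essential_Supremum"
begin

section \<open>Lebesgue norms with exponents in $[1,\infty]$\<close>

text \<open>
  Norms take values in \<^typ>\<open>ennreal\<close>. The conjugate exponent is $(1 - p^{-1})^{-1}$, where the
  conventions $1/0 = \infty$ and $1/\infty = 0$ of \<^typ>\<open>ennreal\<close> give $1' = \infty$ and $\infty' = 1$.
\<close>

definition conj_exp :: "ennreal \<Rightarrow> ennreal" where
  "conj_exp p = inverse (1 - inverse p)"

definition epow :: "ennreal \<Rightarrow> real \<Rightarrow> ennreal" where
  "epow x a = (if x = \<infinity> then \<infinity> else ennreal (enn2real x powr a))"

text \<open>With \<^term>\<open>count_space UNIV\<close> as the measure this is the $\ell^p$ norm.\<close>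

definition Lnorm :: "'a measure \<Rightarrow> ennreal \<Rightarrow> ('a \<Rightarrow> ennreal) \<Rightarrow> ennreal" where
  "Lnorm M p f =
     (if p = \<infinity> then esssup M f
      else epow (\<integral>\<^sup>+ x. epow (f x) (enn2real p) \<partial>M) (1 / enn2real p))"

section \<open>Schwartz functions and tempered distributions on the plane\<close>

definition partial_1 :: "(real \<times> real \<Rightarrow> complex) \<Rightarrow> real \<times> real \<Rightarrow> complex" where
  "partial_1 f = (\<lambda>(x, t). vector_derivative (\<lambda>y. f (y, t)) (at x))"

definition partial_2 :: "(real \<times> real \<Rightarrow> complex) \<Rightarrow> real \<times> real \<Rightarrow> complex" where
  "partial_2 f = (\<lambda>(x, t). vector_derivative (\<lambda>s. f (x, s)) (at t))"

definition schwartz_norm :: "nat \<Rightarrow> (real \<times> real \<Rightarrow> complex) \<Rightarrow> ennreal" where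
  "schwartz_norm n f =
     (SUP i\<in>{..n}. SUP j\<in>{..n}. SUP z.
        ennreal ((1 + norm z) ^ n * norm ((partial_1 ^^ i) ((partial_2 ^^ j) f) z)))"

text \<open>
  Total differentiability of all $\partial_1^i \partial_2^j f$ gives symmetry of the mixed partial
  derivatives and hence smoothness.
\<close>

definition schwartz :: "(real \<times> real \<Rightarrow> complex) \<Rightarrow> bool" where
  "schwartz f \<longleftrightarrow>
     (\<forall>i j z. ((partial_1 ^^ i) ((partial_2 ^^ j) f)) differentiable (at z)) \<and>
     (\<forall>n. schwartz_norm n f < \<infinity>)"

text \<open>
  A distribution is a functional on all functions of which only the values on Schwartz functions
  matter.
\<close>

type_synonym distr = "(real \<times> real \<Rightarrow> complex) \<Rightarrow> complex"

definition tempered :: "distr \<Rightarrow> bool" where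
  "tempered T \<longleftrightarrow>
     (\<forall>f g. schwartz f \<longrightarrow> schwartz g \<longrightarrow> T (\<lambda>z. f z + g z) = T f + T g) \<and>
     (\<forall>c f. schwartz f \<longrightarrow> T (\<lambda>z. c * f z) = c * T f) \<and>
     (\<exists>C n. \<forall>f. schwartz f \<longrightarrow> ennreal (norm (T f)) \<le> ennreal C * schwartz_norm n f)"

definition distr_of :: "(real \<times> real \<Rightarrow> complex) \<Rightarrow> distr" where
  "distr_of G = (\<lambda>\<psi>. LINT z|lborel. G z * \<psi> z)"

definition is_density :: "distr \<Rightarrow> (real \<times> real \<Rightarrow> complex) \<Rightarrow> bool" where
  "is_density T G \<longleftrightarrow>
     G \<in> borel_measurable lborel \<and>
     (\<forall>\<psi>. schwartz \<psi> \<longrightarrow> integrable lborel (\<lambda>z. G z * \<psi> z) \<and> T \<psi> = distr_of G \<psi>)"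

text \<open>
  A density is unique up to null sets, and everything below depends on it only up to null sets.
\<close>

definition density_of :: "distr \<Rightarrow> real \<times> real \<Rightarrow> complex" where
  "density_of T = (SOME G. is_density T G)"

section \<open>Fourier transforms\<close>

text \<open>
  Physical variables are $(x,t)$ with dual variables $(\xi,\tau)$; the partial transform in $x$ leads
  to the variables $(\xi,t)$. The normalisation is $\widehat f(\xi) = \int e^{-ix\xi} f(x)\,dx$.
  Transforms of distributions are defined by duality; the kernels are symmetric.
\<close>

definition fourier :: "(real \<times> real \<Rightarrow> complex) \<Rightarrow> real \<times> real \<Rightarrow> complex" where
  "fourier f = (\<lambda>(\<xi>, \<tau>). LINT z|lborel. cis (- (fst z * \<xi> + snd z * \<tau>)) * f z)"

definition fourier_x :: "(real \<times> real \<Rightarrow> complex) \<Rightarrow> real \<times> real \<Rightarrow> complex" where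
  "fourier_x f = (\<lambda>(\<xi>, t). LINT x|lborel. cis (- (x * \<xi>)) * f (x, t))"

definition fourier_x_inv :: "(real \<times> real \<Rightarrow> complex) \<Rightarrow> real \<times> real \<Rightarrow> complex" where
  "fourier_x_inv f = (\<lambda>(x, t). of_real (1 / (2 * pi)) * (LINT \<xi>|lborel. cis (x * \<xi>) * f (\<xi>, t)))"

definition distr_fourier :: "distr \<Rightarrow> distr" where
  "distr_fourier T = (\<lambda>\<psi>. T (fourier \<psi>))"

definition distr_fourier_x :: "distr \<Rightarrow> distr" where
  "distr_fourier_x T = (\<lambda>\<psi>. T (fourier_x \<psi>))"

definition distr_fourier_x_inv :: "distr \<Rightarrow> distr" where
  "distr_fourier_x_inv T = (\<lambda>\<psi>. T (fourier_x_inv \<psi>))"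

definition mult_time :: "(real \<Rightarrow> real) \<Rightarrow> distr \<Rightarrow> distr" where
  "mult_time g T = (\<lambda>\<psi>. T (\<lambda>(x, t). of_real (g t) * \<psi> (x, t)))"

section \<open>Cutoffs\<close>

definition smooth_real :: "(real \<Rightarrow> real) \<Rightarrow> bool" where
  "smooth_real f \<longleftrightarrow> (\<forall>n x. ((deriv ^^ n) f) differentiable (at x))"

definition cutoff :: "(real \<Rightarrow> real) \<Rightarrow> bool" where
  "cutoff \<phi> \<longleftrightarrow>
     smooth_real \<phi> \<and> (\<forall>x. 0 \<le> \<phi> x) \<and> (\<forall>x. \<phi> (- x) = \<phi> x) \<and>
     (\<forall>x y. 0 \<le> x \<and> x \<le> y \<longrightarrow> \<phi> y \<le> \<phi> x) \<and>
     closure {x. \<phi> x \<noteq> 0} \<subseteq> {- 5 / 4..5 / 4} \<and> (\<forall>x\<in>{- 1..1}. \<phi> x = 1)"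

definition chi :: "(real \<Rightarrow> real) \<Rightarrow> real \<Rightarrow> real \<Rightarrow> real" where
  "chi \<phi> N \<xi> = \<phi> (\<xi> / N) - \<phi> (2 * (\<xi> / N))"

definition eta :: "(real \<Rightarrow> real) \<Rightarrow> real \<Rightarrow> real" where
  "eta \<phi> \<xi> = \<phi> \<xi> / (\<Sum>\<^sub>\<infinity>k\<in>(UNIV :: int set). \<phi> (\<xi> - of_int k))"

definition dyadic :: "real \<Rightarrow> bool" where
  "dyadic N \<longleftrightarrow> (\<exists>j :: int. N = 2 powi j)"

section \<open>Function spaces and the bilinear multiplier\<close>

definition bracket :: "real \<Rightarrow> real" where
  "bracket a = (1 + \<bar>a\<bar>\<^sup>2) powr (1 / 2)"

text \<open>Both norms are infinite if the Fourier transform is not a function.\<close>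

definition Lhat_norm :: "ennreal \<Rightarrow> distr \<Rightarrow> ennreal" where
  "Lhat_norm r u =
     (if \<exists>G. is_density (distr_fourier u) G
      then Lnorm lborel (conj_exp r) (\<lambda>z. ennreal (norm (density_of (distr_fourier u) z)))
      else \<infinity>)"

definition Xhat_norm ::
    "(real \<Rightarrow> real) \<Rightarrow> real \<Rightarrow> real \<Rightarrow> ennreal \<Rightarrow> ennreal \<Rightarrow> distr \<Rightarrow> ennreal" where
  "Xhat_norm \<phi> s b r q u =
     (if \<exists>G. is_density (distr_fourier u) G
      then Lnorm (count_space (UNIV :: int set)) q
             (\<lambda>k. Lnorm lborel (conj_exp r)
               (\<lambda>(\<xi>, \<tau>). ennreal (norm
                  (of_real (bracket \<xi> powr s * bracket (\<tau> - \<xi> ^ 3) powr b * eta \<phi> (\<xi> - of_int k))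
                   * density_of (distr_fourier u) (\<xi>, \<tau>)))))
      else \<infinity>)"

definition Xhat ::
    "(real \<Rightarrow> real) \<Rightarrow> real \<Rightarrow> real \<Rightarrow> ennreal \<Rightarrow> ennreal \<Rightarrow> distr set" where
  "Xhat \<phi> s b r q = {u. tempered u \<and> Xhat_norm \<phi> s b r q u < \<infinity>}"

text \<open>
  Elements of $\widehat X^{s,b}_{r,q}$ are in general not functions of $x$, so $B_m(u,v)$ is a
  distribution, given through the densities $(\xi,t) \mapsto \widehat{u(t)}(\xi)$ and
  $(\xi,t) \mapsto \widehat{v(t)}(\xi)$ of the partial Fourier transforms.
\<close>

definition bilin_mult :: "(real \<Rightarrow> real \<Rightarrow> complex) \<Rightarrow> distr \<Rightarrow> distr \<Rightarrow> distr" where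
  "bilin_mult m u v =
     distr_fourier_x_inv (distr_of (\<lambda>(\<xi>, t).
       LINT \<xi>1|lborel. m \<xi>1 (\<xi> - \<xi>1) * density_of (distr_fourier_x u) (\<xi>1, t)
                                   * density_of (distr_fourier_x v) (\<xi> - \<xi>1, t)))"

end

theory Submission
  imports Defs "HOL-Probability.Probability" "HOL-Real_Asymp.Real_Asymp"
begin

text \<open>
  On the Fourier side both operators are multiplier convolutions
  $h(\xi,\tau) = \int m(\xi_1, \xi - \xi_1)\, \widehat u(\xi_1,\tau_1)\,
  \widehat v(\xi - \xi_1, \tau - \tau_1)$, the time cutoff adding a convolution with an integrable
  function in $\tau$. Hoelder's inequality in $(\xi_1,\tau_1)$ bounds $|h|^{r'}$ by the product of
  $\int |f|^{r'} |g|^{r'}$, where $f, g$ are the transforms weighted by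
  $\langle \tau - \xi^3 \rangle^b$, and of a power of
  $\int \langle \tau_1 - \xi_1^3 \rangle^{-br} \langle \tau - \tau_1 - (\xi - \xi_1)^3 \rangle^{-br}$.
  Integrating in $\xi_1$ before $\tau_1$, the latter is $O((N_1 N_3)^{-1})$: the phase
  $\xi_1^3 + (\xi - \xi_1)^3$ has derivative $3 \xi (2 \xi_1 - \xi)$, of size at least $N_1 N_3$ up
  to a constant on the support of either multiplier. The former is a sum over pairs of unit intervals
  at distance $O(N_3)$ (after a reflection in the case of $m_+$) meeting $|\xi_1| \le 5 N_1 / 4$; since
  $q \ge 2 r'$, it is controlled by the $\ell^q$ norms at the cost of $N_3 N_1^{1 - 2r'/q}$.

  As the Fourier transforms are distributional, one also needs Fourier inversion on Schwartz functions
  and the uniqueness of densities.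
\<close>

section \<open>Schwartz functions\<close>

text \<open>The exponents add up as follows, with \<open>p\<close> for r': the kernel integral gives
  N1 N3 to the power -1/r, the O(N3) admissible offsets between two unit intervals give N3 to the
  power 1/p, and for each offset the passage from exponent 2p to exponent q over O(N1) intervals
  gives N1 to the power 1/p - 2/q. The analytic obstacle is that for large q a finite norm controls
  the transform of u only uniformly on unit strips in \<xi>, so this transform need not be
  integrable. Since b > 1/r, Hoelder's inequality in \<tau> makes it integrable over bounded ranges
  of \<xi>, and the weight 1/(1 + \<xi>^2) makes it integrable over the plane; Schwartz functions
  absorb this weight. As the multiplier has bounded support, the convolution may be formed with
  integrable truncations. The second obstacle is that \<open>bilin_mult\<close> refers to transforms
  in x alone, whereas both norms refer to transforms in x and t. Fourier inversion in one variable
  translates between them, and uniqueness of densities makes the result independent of the densities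
  chosen by \<open>density_of\<close>.\<close>

lemma has_vector_derivative_iff_quotient:
  fixes f :: "real \<Rightarrow> 'a :: real_normed_vector"
  shows "(f has_vector_derivative D) (at x) \<longleftrightarrow>
    ((\<lambda>h. (1 / h) *\<^sub>R (f (x + h) - f x)) \<longlongrightarrow> D) (at 0)"
proof -
  have "(f has_vector_derivative D) (at x) \<longleftrightarrow>
    ((\<lambda>h. norm (f (x + h) - f x - h *\<^sub>R D) / norm h) \<longlongrightarrow> 0) (at 0)"
    unfolding has_vector_derivative_def has_derivative_at
    by (simp add: bounded_linear_scaleR_left)
  also have "\<dots> \<longleftrightarrow> ((\<lambda>h. norm ((1 / h) *\<^sub>R (f (x + h) - f x) - D)) \<longlongrightarrow> 0) (at 0)"
  proof (rule Lim_cong_within)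
    fix h :: real assume "h \<noteq> 0"
    have "(1 / h) *\<^sub>R (f (x + h) - f x) - D = (1 / h) *\<^sub>R (f (x + h) - f x - h *\<^sub>R D)"
      using \<open>h \<noteq> 0\<close> by (simp add: scaleR_diff_right)
    then show "norm (f (x + h) - f x - h *\<^sub>R D) / norm h = norm ((1 / h) *\<^sub>R (f (x + h) - f x) - D)"
      by (simp add: divide_inverse mult.commute)
  qed auto
  finally show ?thesis
    by (simp add: tendsto_norm_zero_iff LIM_zero_iff)
qed

text \<open>Dominated convergence for the difference quotients along an arbitrary sequence: the mean
  value inequality turns the bound \<open>g\<close> on the derivative into the same bound on the
  quotients.\<close>

lemma has_vector_derivative_lebesgue_integral:
  fixes f f' :: "real \<Rightarrow> 'a \<Rightarrow> complex"
  assumes int: "\<And>x. integrable M (f x)"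
    and deriv: "\<And>x w. ((\<lambda>x. f x w) has_vector_derivative f' x w) (at x)"
    and meas: "\<And>x. f' x \<in> borel_measurable M"
    and g: "integrable M g"
    and bound: "\<And>x w. norm (f' x w) \<le> g w"
  shows "((\<lambda>x. LINT w|M. f x w) has_vector_derivative (LINT w|M. f' x w)) (at x)"
proof -
  have int': "integrable M (f' x)" for x
    by (rule Bochner_Integration.integrable_bound[OF g meas]) (intro AE_I2 order_trans[OF bound], simp)
  have quot: "((\<lambda>h. (1 / h) *\<^sub>R ((LINT w|M. f (x + h) w) - (LINT w|M. f x w))) \<longlongrightarrow> (LINT w|M. f' x w)) (at 0)"
    unfolding tendsto_at_iff_sequentially comp_def
  proof (intro allI impI)
    fix h :: "nat \<Rightarrow> real"
    assume h0: "\<forall>i. h i \<in> UNIV - {0}" and hl: "h \<longlonglongrightarrow> 0"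
    have "(\<lambda>i. LINT w|M. (1 / h i) *\<^sub>R (f (x + h i) w - f x w)) \<longlonglongrightarrow> (LINT w|M. f' x w)"
    proof (rule integral_dominated_convergence[where w = g])
      show "f' x \<in> borel_measurable M" by (rule meas)
      show "(\<lambda>w. (1 / h i) *\<^sub>R (f (x + h i) w - f x w)) \<in> borel_measurable M" for i
        using int[of "x + h i"] int[of x] by measurable
      show "integrable M g" by (rule g)
      show "AE w in M. (\<lambda>i. (1 / h i) *\<^sub>R (f (x + h i) w - f x w)) \<longlonglongrightarrow> f' x w"
      proof (rule AE_I2)
        fix w
        have "((\<lambda>k. (1 / k) *\<^sub>R (f (x + k) w - f x w)) \<longlongrightarrow> f' x w) (at 0)"
          using deriv[of w x] unfolding has_vector_derivative_iff_quotient .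
        then show "(\<lambda>i. (1 / h i) *\<^sub>R (f (x + h i) w - f x w)) \<longlonglongrightarrow> f' x w"
          using h0 hl unfolding tendsto_at_iff_sequentially comp_def by auto
      qed
      show "AE w in M. norm ((1 / h i) *\<^sub>R (f (x + h i) w - f x w)) \<le> g w" for i
      proof (rule AE_I2)
        fix w
        have "norm (f (x + h i) w - f x w) \<le> g w * norm (x + h i - x)"
        proof (rule differentiable_bound[where S = UNIV and f' = "\<lambda>y t. t *\<^sub>R f' y w"])
          show "((\<lambda>x. f x w) has_derivative (\<lambda>t. t *\<^sub>R f' y w)) (at y)" for y
            using deriv[of w y] by (simp add: has_vector_derivative_def)
          show "onorm (\<lambda>t. t *\<^sub>R f' y w) \<le> g w" for y
            by (rule onorm_le) (use bound[of y w] in \<open>auto simp: mult.commute intro!: mult_left_mono\<close>)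
        qed auto
        then show "norm ((1 / h i) *\<^sub>R (f (x + h i) w - f x w)) \<le> g w"
          using h0 by (simp add: divide_simps mult.commute)
      qed
    qed
    also have "(\<lambda>i. LINT w|M. (1 / h i) *\<^sub>R (f (x + h i) w - f x w)) =
      (\<lambda>i. (1 / h i) *\<^sub>R ((LINT w|M. f (x + h i) w) - (LINT w|M. f x w)))"
      using int by (auto simp: Bochner_Integration.integral_diff)
    finally show "(\<lambda>i. (1 / h i) *\<^sub>R ((LINT w|M. f (x + h i) w) - (LINT w|M. f x w))) \<longlonglongrightarrow> (LINT w|M. f' x w)" .
  qed
  show ?thesis
    using quot unfolding has_vector_derivative_iff_quotient .
qed

section \<open>Partial derivatives on the plane and their symmetry\<close>

lemma partial_1_eqI:
  assumes "\<And>x t. ((\<lambda>y. f (y, t)) has_vector_derivative g (x, t)) (at x)"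
  shows "partial_1 f = g"
  using assms by (auto simp: partial_1_def fun_eq_iff intro!: vector_derivative_at)

lemma partial_2_eqI:
  assumes "\<And>x t. ((\<lambda>s. f (x, s)) has_vector_derivative g (x, t)) (at t)"
  shows "partial_2 f = g"
  using assms by (auto simp: partial_2_def fun_eq_iff intro!: vector_derivative_at)

lemma has_vector_derivative_partial_1:
  assumes "f differentiable (at (x, t))"
  shows "((\<lambda>y. f (y, t)) has_vector_derivative partial_1 f (x, t)) (at x)"
proof -
  have "(f \<circ> (\<lambda>y. (y, t))) differentiable (at x)"
    by (rule differentiable_chain_at) (use assms in \<open>auto intro: differentiable_Pair\<close>)
  then show ?thesis
    by (simp add: vector_derivative_works partial_1_def comp_def)
qed

lemma has_vector_derivative_partial_2:
  assumes "f differentiable (at (x, t))"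
  shows "((\<lambda>s. f (x, s)) has_vector_derivative partial_2 f (x, t)) (at t)"
proof -
  have "(f \<circ> (\<lambda>s. (x, s))) differentiable (at t)"
    by (rule differentiable_chain_at) (use assms in \<open>auto intro: differentiable_Pair\<close>)
  then show ?thesis
    by (simp add: vector_derivative_works partial_2_def comp_def)
qed

text \<open>Continuity of a single partial derivative is enough for total differentiability. This
  serves transforms and tensor products, whose partial derivatives are explicit.\<close>

lemma differentiable_if_partials:
  fixes f :: "real \<times> real \<Rightarrow> complex"
  assumes f1: "\<And>x t. ((\<lambda>y. f (y, t)) has_vector_derivative f1 (x, t)) (at x)"
    and f2: "\<And>x t. ((\<lambda>s. f (x, s)) has_vector_derivative f2 (x, t)) (at t)"
    and cont: "continuous_on UNIV f2"
  shows "f differentiable (at z)"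
proof -
  obtain x t where z: "z = (x, t)" by (cases z)
  have "((\<lambda>(x, y). f (x, y)) has_derivative
      (\<lambda>(tx, ty). tx *\<^sub>R f1 (x, t) + blinfun_apply (blinfun_scaleR_left (f2 (x, t))) ty))
    (at (x, t) within UNIV \<times> UNIV)"
  proof (rule has_derivative_partialsI)
    show "((\<lambda>x. f (x, t)) has_derivative (\<lambda>tx. tx *\<^sub>R f1 (x, t))) (at x)"
      using f1[of t x] by (simp add: has_vector_derivative_def)
    show "((\<lambda>y. f (x, y)) has_derivative blinfun_apply (blinfun_scaleR_left (f2 (x, y)))) (at y)" for x y
      using f2[of x y] by (simp add: has_vector_derivative_def)
    have "continuous_on UNIV (\<lambda>z. blinfun_scaleR_left (f2 z))"
      by (intro continuous_intros cont)
    then show "continuous (at (x, t) within UNIV \<times> UNIV) (\<lambda>(x, y). blinfun_scaleR_left (f2 (x, y)))"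
      by (simp add: continuous_on_eq_continuous_within case_prod_beta')
  qed auto
  then show ?thesis
    unfolding differentiable_def z by (auto simp: case_prod_beta')
qed

text \<open>Nothing is presupposed about derivatives taken in the order \<partial>1 first, because
  \<open>schwartz\<close> controls only \<partial>1^i \<partial>2^j f. Writing f as an integral of
  \<partial>2 f over the second variable and differentiating under the integral sign expresses
  \<partial>1 f as an integral of \<partial>1 \<partial>2 f, which can then be differentiated in the
  second variable.\<close>

lemma partial_commute:
  fixes f :: "real \<times> real \<Rightarrow> complex"
  assumes f: "\<And>z. f differentiable (at z)"
    and f2: "\<And>z. partial_2 f differentiable (at z)"
    and f12: "\<And>z. partial_1 (partial_2 f) differentiable (at z)"
  shows "partial_2 (partial_1 f) = partial_1 (partial_2 f)"
proof (rule partial_2_eqI)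
  fix x t :: real
  \<comment> \<open>A base point strictly below \<open>t\<close> makes \<open>t\<close> interior to
    the interval from \<open>a\<close> to \<open>t + 1\<close>, so that the derivative of the
    indefinite integral is two-sided.\<close>
  define a where "a = t - 1"
  let ?g = "partial_1 (partial_2 f)"
  have cont2: "continuous_on UNIV (partial_2 f)" and cont12: "continuous_on UNIV ?g"
    using f2 f12 by (auto intro!: differentiable_imp_continuous_on simp: differentiable_on_def)
  have c2: "continuous_on A (\<lambda>r. partial_2 f (y, r))" for y A
    by (rule continuous_on_compose2[OF cont2]) (auto intro!: continuous_intros)
  have c12: "continuous_on A (\<lambda>r. ?g (y, r))" for y A
    by (rule continuous_on_compose2[OF cont12]) (auto intro!: continuous_intros)
  have ftc: "f (y, s) = f (y, a) + integral (cbox a s) (\<lambda>r. partial_2 f (y, r))" if "a \<le> s" for y s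
  proof -
    have "((\<lambda>r. partial_2 f (y, r)) has_integral f (y, s) - f (y, a)) {a..s}"
      by (rule fundamental_theorem_of_calculus[OF that])
        (auto intro: has_vector_derivative_at_within has_vector_derivative_partial_2 f)
    then show ?thesis by (simp add: integral_unique)
  qed
  have p1: "partial_1 f (x, s) = partial_1 f (x, a) + integral {a..s} (\<lambda>r. ?g (x, r))" if "a \<le> s" for s
  proof -
    have "((\<lambda>y. integral (cbox a s) (\<lambda>r. partial_2 f (y, r))) has_vector_derivative
        integral (cbox a s) (\<lambda>r. ?g (x, r))) (at x within UNIV)"
    proof (rule leibniz_rule_vector_derivative)
      show "((\<lambda>y. partial_2 f (y, r)) has_vector_derivative ?g (y, r)) (at y within UNIV)" for y r
        by (rule has_vector_derivative_partial_1[OF f2])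
      show "(\<lambda>r. partial_2 f (y, r)) integrable_on cbox a s" for y
        by (intro integrable_continuous c2)
      show "continuous_on (UNIV \<times> cbox a s) (\<lambda>(y, r). ?g (y, r))"
        by (rule continuous_on_subset[of UNIV]) (use cont12 in \<open>auto simp: case_prod_beta'\<close>)
    qed auto
    then have "((\<lambda>y. f (y, a) + integral (cbox a s) (\<lambda>r. partial_2 f (y, r))) has_vector_derivative
        partial_1 f (x, a) + integral (cbox a s) (\<lambda>r. ?g (x, r))) (at x)"
      by (intro has_vector_derivative_add has_vector_derivative_partial_1 f) simp
    then have "((\<lambda>y. f (y, s)) has_vector_derivative
        partial_1 f (x, a) + integral (cbox a s) (\<lambda>r. ?g (x, r))) (at x)"
      by (simp add: ftc[OF that])
    from vector_derivative_unique_at[OF this has_vector_derivative_partial_1[OF f]]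
    show ?thesis by simp
  qed
  have "((\<lambda>s. integral {a..s} (\<lambda>r. ?g (x, r))) has_vector_derivative ?g (x, t)) (at t within {a..t+1})"
    by (rule integral_has_vector_derivative[OF c12]) (simp add: a_def)
  then have "((\<lambda>s. integral {a..s} (\<lambda>r. ?g (x, r))) has_vector_derivative ?g (x, t)) (at t within {a<..<t+1})"
    by (rule has_vector_derivative_within_subset) auto
  from has_vector_derivative_add[OF has_vector_derivative_const[of "partial_1 f (x, a)"] this]
  have "((\<lambda>s. partial_1 f (x, a) + integral {a..s} (\<lambda>r. ?g (x, r))) has_vector_derivative ?g (x, t)) (at t within {a<..<t+1})"
    by (simp only: add_0)
  then have "((\<lambda>s. partial_1 f (x, s)) has_vector_derivative ?g (x, t)) (at t within {a<..<t+1})"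
    by (rule has_vector_derivative_transform[rotated 2]) (auto intro: p1, simp add: a_def)
  then show "((\<lambda>s. partial_1 f (x, s)) has_vector_derivative ?g (x, t)) (at t)"
    by (subst (asm) at_within_open) (auto simp: a_def)
qed

section \<open>The Schwartz class and its closure properties\<close>

lemma schwartz_differentiable:
  "schwartz f \<Longrightarrow> ((partial_1 ^^ i) ((partial_2 ^^ j) f)) differentiable (at z)"
  unfolding schwartz_def by blast

lemma schwartz_bounded_deriv:
  assumes "schwartz f"
  shows "\<exists>B. \<forall>z. (1 + norm z) ^ n * norm ((partial_1 ^^ i) ((partial_2 ^^ j) f) z) \<le> B"
proof -
  \<comment> \<open>\<open>schwartz_norm\<close> uses one index for the weight and for both orders
    of differentiation.\<close>
  define m where "m = max n (max i j)"
  have fin: "schwartz_norm m f < \<infinity>" using assms by (simp add: schwartz_def)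
  have "(1 + norm z) ^ n * norm ((partial_1 ^^ i) ((partial_2 ^^ j) f) z) \<le> enn2real (schwartz_norm m f)" for z
  proof -
    have "(1 + norm z) ^ n * norm ((partial_1 ^^ i) ((partial_2 ^^ j) f) z) \<le>
        (1 + norm z) ^ m * norm ((partial_1 ^^ i) ((partial_2 ^^ j) f) z)"
      by (intro mult_right_mono power_increasing) (auto simp: m_def)
    also have "ennreal \<dots> \<le> schwartz_norm m f"
      unfolding schwartz_norm_def
      by (rule SUP_upper2[of i], simp add: m_def, rule SUP_upper2[of j], simp add: m_def, rule SUP_upper2[of z]) auto
    then have "(1 + norm z) ^ m * norm ((partial_1 ^^ i) ((partial_2 ^^ j) f) z) \<le> enn2real (schwartz_norm m f)"
      using fin by (subst ennreal_le_iff[symmetric]) auto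
    finally show ?thesis .
  qed
  then show ?thesis by blast
qed

lemma schwartzI:
  assumes d: "\<And>i j z. ((partial_1 ^^ i) ((partial_2 ^^ j) f)) differentiable (at z)"
    and b: "\<And>n i j. \<exists>B. \<forall>z. (1 + norm z) ^ n * norm ((partial_1 ^^ i) ((partial_2 ^^ j) f) z) \<le> B"
  shows "schwartz f"
proof -
  have "schwartz_norm n f < \<infinity>" for n
  proof -
    obtain B where B: "(1 + norm z) ^ n * norm ((partial_1 ^^ i) ((partial_2 ^^ j) f) z) \<le> B i j" for i j z
      using b[of n] by metis
    have B0: "0 \<le> B i j" for i j
      by (rule order_trans[OF _ B[of 0 i j]]) auto
    have "schwartz_norm n f \<le> ennreal (\<Sum>i\<le>n. \<Sum>j\<le>n. B i j)"
      unfolding schwartz_norm_def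
    proof (intro SUP_least ennreal_leI)
      fix i j z assume ij: "i \<in> {..n}" "j \<in> {..n}"
      have "B i j \<le> (\<Sum>j\<le>n. B i j)"
        using ij B0 by (intro member_le_sum) auto
      also have "\<dots> \<le> (\<Sum>i\<le>n. \<Sum>j\<le>n. B i j)"
        using ij B0 by (intro member_le_sum[of _ _ "\<lambda>i. \<Sum>j\<le>n. B i j"]) (auto intro: sum_nonneg)
      finally show "(1 + norm z) ^ n * norm ((partial_1 ^^ i) ((partial_2 ^^ j) f) z) \<le> (\<Sum>i\<le>n. \<Sum>j\<le>n. B i j)"
        using B[of z i j] by linarith
    qed
    then show ?thesis by (simp add: le_less_trans)
  qed
  then show ?thesis using d by (simp add: schwartz_def)
qed

text \<open>The Schwartz class is the largest family of rapidly decreasing differentiable functions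
  closed under both partial derivatives. Exhibiting such a family avoids formulas for iterated
  derivatives of sums, products and transforms.\<close>

lemma schwartz_coinduct:
  assumes "P f"
    and d: "\<And>g z. P g \<Longrightarrow> g differentiable (at z)"
    and p1: "\<And>g. P g \<Longrightarrow> P (partial_1 g)"
    and p2: "\<And>g. P g \<Longrightarrow> P (partial_2 g)"
    and b: "\<And>g n. P g \<Longrightarrow> \<exists>B. \<forall>z. (1 + norm z) ^ n * norm (g z) \<le> B"
  shows "schwartz f"
proof -
  have "P ((partial_2 ^^ j) f)" for j
    by (induction j) (auto simp: assms)
  then have "P ((partial_1 ^^ i) ((partial_2 ^^ j) f))" for i j
    by (induction i) (auto simp: assms)
  then show ?thesis by (intro schwartzI d b) auto
qed

lemma schwartz_diff: "schwartz f \<Longrightarrow> f differentiable (at z)"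
  using schwartz_differentiable[of f 0 0] by (simp only: funpow_0)

lemma schwartz_bounded:
  "schwartz f \<Longrightarrow> \<exists>B. \<forall>z. (1 + norm z) ^ n * norm (f z) \<le> B"
  using schwartz_bounded_deriv[of f n 0 0] by (simp only: funpow_0)

lemma schwartz_partial_2: "schwartz f \<Longrightarrow> schwartz (partial_2 f)"
  using schwartz_differentiable[of f _ "Suc _"] schwartz_bounded_deriv[of f _ _ "Suc _"]
  by (intro schwartzI) (simp_all only: funpow_Suc_right comp_def)

text \<open>In \<open>schwartz\<close> the derivatives \<partial>1 stand outermost, so the
  additional \<partial>1 has to be moved past all \<partial>2; each exchange is an instance of
  \<open>partial_commute\<close>.\<close>

lemma schwartz_partial_1:
  assumes f: "schwartz f"
  shows "schwartz (partial_1 f)"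
proof -
  have *: "(partial_2 ^^ j) (partial_1 f) = partial_1 ((partial_2 ^^ j) f)" for j
  proof (induction j)
    case (Suc j)
    have "partial_2 (partial_1 ((partial_2 ^^ j) f)) = partial_1 (partial_2 ((partial_2 ^^ j) f))"
      using schwartz_differentiable[OF f, of 0 j] schwartz_differentiable[OF f, of 0 "Suc j"]
        schwartz_differentiable[OF f, of 1 "Suc j"]
      by (intro partial_commute) auto
    then show ?case using Suc by simp
  qed simp
  have **: "(partial_1 ^^ i) ((partial_2 ^^ j) (partial_1 f)) = (partial_1 ^^ Suc i) ((partial_2 ^^ j) f)" for i j
    unfolding * funpow_Suc_right by simp
  show ?thesis
    unfolding schwartz_def[of "partial_1 f"]
    using schwartzI[of "partial_1 f"] schwartz_differentiable[OF f] schwartz_bounded_deriv[OF f]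
    unfolding ** schwartz_def[of "partial_1 f"] by blast
qed

lemma schwartz_continuous: "schwartz f \<Longrightarrow> continuous_on A f"
  by (auto intro!: differentiable_imp_continuous_on schwartz_diff differentiable_at_imp_differentiable_on)

lemma schwartz_measurable [measurable_dest]: "schwartz f \<Longrightarrow> f \<in> borel_measurable borel"
  by (intro borel_measurable_continuous_onI schwartz_continuous)

lemma partial_1_add:
  assumes "\<And>z. f differentiable (at z)" "\<And>z. g differentiable (at z)"
  shows "partial_1 (\<lambda>z. f z + g z) = (\<lambda>z. partial_1 f z + partial_1 g z)"
  by (intro partial_1_eqI has_vector_derivative_add has_vector_derivative_partial_1 assms)

lemma partial_2_add:
  assumes "\<And>z. f differentiable (at z)" "\<And>z. g differentiable (at z)"
  shows "partial_2 (\<lambda>z. f z + g z) = (\<lambda>z. partial_2 f z + partial_2 g z)"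
  by (intro partial_2_eqI has_vector_derivative_add has_vector_derivative_partial_2 assms)

lemma weight_bound_add:
  fixes f g :: "'a::real_normed_vector \<Rightarrow> complex"
  assumes "\<exists>B. \<forall>z. (1 + norm z) ^ n * norm (f z) \<le> B" "\<exists>B. \<forall>z. (1 + norm z) ^ n * norm (g z) \<le> B"
  shows "\<exists>B. \<forall>z. (1 + norm z) ^ n * norm (f z + g z) \<le> B"
proof -
  obtain B C where B: "\<And>z. (1 + norm z) ^ n * norm (f z) \<le> B" and C: "\<And>z. (1 + norm z) ^ n * norm (g z) \<le> C"
    using assms by blast
  have "(1 + norm z) ^ n * norm (f z + g z) \<le> B + C" for z
  proof -
    have "(1 + norm z) ^ n * norm (f z + g z) \<le> (1 + norm z) ^ n * (norm (f z) + norm (g z))"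
      by (intro mult_left_mono norm_triangle_ineq) auto
    also have "\<dots> \<le> B + C" using B[of z] C[of z] by (simp add: distrib_left)
    finally show ?thesis .
  qed
  then show ?thesis by blast
qed

lemma schwartz_add:
  assumes "schwartz f" "schwartz g"
  shows "schwartz (\<lambda>z. f z + g z)"
proof (rule schwartz_coinduct[where P = "\<lambda>h. \<exists>f g. schwartz f \<and> schwartz g \<and> h = (\<lambda>z. f z + g z)"])
  show "\<exists>f' g'. schwartz f' \<and> schwartz g' \<and> (\<lambda>z. f z + g z) = (\<lambda>z. f' z + g' z)"
    using assms by blast
next
  fix h n
  assume "\<exists>f g. schwartz f \<and> schwartz g \<and> h = (\<lambda>z. f z + g z)"
  then obtain f g where fg: "schwartz f" "schwartz g" and h: "h = (\<lambda>z. f z + g z)" by blast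
  show "h differentiable (at z)" for z
    unfolding h by (intro differentiable_add schwartz_diff fg)
  show "\<exists>f g. schwartz f \<and> schwartz g \<and> partial_1 h = (\<lambda>z. f z + g z)"
    unfolding h using partial_1_add[of f g] fg schwartz_diff schwartz_partial_1 by blast
  show "\<exists>f g. schwartz f \<and> schwartz g \<and> partial_2 h = (\<lambda>z. f z + g z)"
    unfolding h using partial_2_add[of f g] fg schwartz_diff schwartz_partial_2 by blast
  show "\<exists>B. \<forall>z. (1 + norm z) ^ n * norm (h z) \<le> B"
    unfolding h by (intro weight_bound_add schwartz_bounded fg)
qed

lemma schwartz_cmult:
  assumes "schwartz f"
  shows "schwartz (\<lambda>z. c * f z)"
proof (rule schwartz_coinduct[where P = "\<lambda>h. \<exists>f. schwartz f \<and> h = (\<lambda>z. c * f z)"])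
  show "\<exists>f'. schwartz f' \<and> (\<lambda>z. c * f z) = (\<lambda>z. c * f' z)"
    using assms by blast
next
  fix h n
  assume "\<exists>f. schwartz f \<and> h = (\<lambda>z. c * f z)"
  then obtain f where f: "schwartz f" and h: "h = (\<lambda>z. c * f z)" by blast
  show "h differentiable (at z)" for z
    unfolding h by (intro differentiable_mult schwartz_diff f differentiable_const)
  have "partial_1 h = (\<lambda>z. c * partial_1 f z)"
    unfolding h by (intro partial_1_eqI has_vector_derivative_mult_right has_vector_derivative_partial_1 schwartz_diff f)
  then show "\<exists>f. schwartz f \<and> partial_1 h = (\<lambda>z. c * f z)"
    using f schwartz_partial_1 by blast
  have "partial_2 h = (\<lambda>z. c * partial_2 f z)"
    unfolding h by (intro partial_2_eqI has_vector_derivative_mult_right has_vector_derivative_partial_2 schwartz_diff f)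
  then show "\<exists>f. schwartz f \<and> partial_2 h = (\<lambda>z. c * f z)"
    using f schwartz_partial_2 by blast
  obtain B where B: "\<And>z. (1 + norm z) ^ n * norm (f z) \<le> B"
    using schwartz_bounded[OF f] by blast
  have "(1 + norm z) ^ n * norm (h z) \<le> norm c * B" for z
    using mult_left_mono[OF B[of z], of "norm c"] by (simp add: h norm_mult mult_ac)
  then show "\<exists>B. \<forall>z. (1 + norm z) ^ n * norm (h z) \<le> B" by blast
qed

text \<open>Transfers results about the second variable, in which \<open>ft\<close> below acts, to
  the first one.\<close>

lemma schwartz_swap:
  assumes "schwartz f"
  shows "schwartz (\<lambda>z. f (prod.swap z))"
proof (rule schwartz_coinduct[where P = "\<lambda>h. \<exists>f. schwartz f \<and> h = (\<lambda>z. f (prod.swap z))"])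
  show "\<exists>f'. schwartz f' \<and> (\<lambda>z. f (prod.swap z)) = (\<lambda>z. f' (prod.swap z))"
    using assms by blast
next
  fix h n
  assume "\<exists>f. schwartz f \<and> h = (\<lambda>z. f (prod.swap z))"
  then obtain f where f: "schwartz f" and h: "h = (\<lambda>z. f (prod.swap z))" by blast
  have "(\<lambda>z :: real \<times> real. (snd z, fst z)) differentiable (at z)" for z
    unfolding differentiable_def by (auto intro!: exI derivative_eq_intros)
  then have "(f \<circ> (\<lambda>z. (snd z, fst z))) differentiable (at z)" for z
    by (intro differentiable_chain_at schwartz_diff f)
  then show "h differentiable (at z)" for z
    by (simp add: h comp_def prod.swap_def)
  have "partial_1 h = (\<lambda>z. partial_2 f (prod.swap z))"
    unfolding h by (rule partial_1_eqI) (simp add: has_vector_derivative_partial_2 schwartz_diff f)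
  then show "\<exists>f. schwartz f \<and> partial_1 h = (\<lambda>z. f (prod.swap z))"
    using f schwartz_partial_2 by blast
  have "partial_2 h = (\<lambda>z. partial_1 f (prod.swap z))"
    unfolding h by (rule partial_2_eqI) (simp add: has_vector_derivative_partial_1 schwartz_diff f)
  then show "\<exists>f. schwartz f \<and> partial_2 h = (\<lambda>z. f (prod.swap z))"
    using f schwartz_partial_1 by blast
  obtain B where B: "\<And>z. (1 + norm z) ^ n * norm (f z) \<le> B"
    using schwartz_bounded[OF f] by blast
  have "(1 + norm z) ^ n * norm (h z) \<le> B" for z
    using B[of "prod.swap z"] by (cases z) (simp add: h norm_prod_def add.commute)
  then show "\<exists>B. \<forall>z. (1 + norm z) ^ n * norm (h z) \<le> B" by blast
qed

text \<open>The functions t g alone are not closed under \<partial>2, since \<partial>2 (t g) = g +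
  t \<partial>2 g. Adding an arbitrary Schwartz summand f closes the family; decay costs one more
  power of the weight on g.\<close>

lemma schwartz_mult_snd:
  assumes "schwartz f"
  shows "schwartz (\<lambda>z. of_real (snd z) * f z)"
proof (rule schwartz_coinduct[where P = "\<lambda>h. \<exists>f g. schwartz f \<and> schwartz g \<and> h = (\<lambda>z. f z + of_real (snd z) * g z)"])
  have "schwartz (\<lambda>z. 0 * f z)" by (rule schwartz_cmult[OF assms])
  then show "\<exists>f' g. schwartz f' \<and> schwartz g \<and> (\<lambda>z. of_real (snd z) * f z) = (\<lambda>z. f' z + of_real (snd z) * g z)"
    using assms by (intro exI[of _ "\<lambda>z. 0 * f z"] exI[of _ f]) auto
next
  fix h n
  assume "\<exists>f g. schwartz f \<and> schwartz g \<and> h = (\<lambda>z. f z + of_real (snd z) * g z)"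
  then obtain f g where f: "schwartz f" and g: "schwartz g" and h: "h = (\<lambda>z. f z + of_real (snd z) * g z)" by blast
  have "(\<lambda>z :: real \<times> real. complex_of_real (snd z)) differentiable (at z)" for z
    unfolding differentiable_def by (auto intro!: exI derivative_eq_intros)
  then show "h differentiable (at z)" for z
    unfolding h by (intro differentiable_add differentiable_mult schwartz_diff[OF f] schwartz_diff[OF g])
  have "partial_1 h = (\<lambda>z. partial_1 f z + of_real (snd z) * partial_1 g z)"
    unfolding h by (intro partial_1_eqI has_vector_derivative_add)
      (simp_all add: has_vector_derivative_mult_right has_vector_derivative_partial_1 schwartz_diff f g)
  then show "\<exists>f g. schwartz f \<and> schwartz g \<and> partial_1 h = (\<lambda>z. f z + of_real (snd z) * g z)"
    using f g schwartz_partial_1 by blast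
  have "partial_2 h = (\<lambda>z. (partial_2 f z + g z) + of_real (snd z) * partial_2 g z)"
  proof (rule partial_2_eqI)
    fix x t
    have "((\<lambda>s. f (x, s) + of_real s * g (x, s)) has_vector_derivative
        (partial_2 f (x, t) + (of_real t * partial_2 g (x, t) + of_real 1 * g (x, t)))) (at t)"
      by (intro has_vector_derivative_add has_vector_derivative_mult has_vector_derivative_of_real
          has_vector_derivative_partial_2 schwartz_diff f g has_vector_derivative_id[unfolded id_def] DERIV_ident)
    then show "((\<lambda>s. h (x, s)) has_vector_derivative
      partial_2 f (x, t) + g (x, t) + of_real (snd (x, t)) * partial_2 g (x, t)) (at t)"
      by (simp add: h add_ac)
  qed
  then show "\<exists>f g. schwartz f \<and> schwartz g \<and> partial_2 h = (\<lambda>z. f z + of_real (snd z) * g z)"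
    using f g schwartz_partial_2 schwartz_add by blast
  have "\<exists>B. \<forall>z. (1 + norm z) ^ n * norm (of_real (snd z) * g z) \<le> B"
  proof -
    obtain B where B: "\<And>z. (1 + norm z) ^ Suc n * norm (g z) \<le> B"
      using schwartz_bounded[OF g] by blast
    have "(1 + norm z) ^ n * norm (of_real (snd z) * g z) \<le> B" for z
    proof -
      have "\<bar>snd z\<bar> \<le> 1 + norm z" using norm_snd_le[of "snd z" "fst z"] by simp
      then have "(1 + norm z) ^ n * (\<bar>snd z\<bar> * norm (g z)) \<le> (1 + norm z) ^ n * ((1 + norm z) * norm (g z))"
        by (intro mult_left_mono mult_right_mono) auto
      then show ?thesis using B[of z] by (simp add: norm_mult mult_ac)
    qed
    then show ?thesis by blast
  qed
  then show "\<exists>B. \<forall>z. (1 + norm z) ^ n * norm (h z) \<le> B"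
    unfolding h by (rule weight_bound_add[OF schwartz_bounded[OF f]])
qed

lemma schwartz_mult_fst:
  assumes "schwartz f"
  shows "schwartz (\<lambda>z. of_real (fst z) * f z)"
  using schwartz_swap[OF schwartz_mult_snd[OF schwartz_swap[OF assms]]] by simp

text \<open>
  A family of bounded functions that is closed under multiplication by the coordinates consists of
  rapidly decreasing functions.
\<close>

lemma schwartz_coinduct_mult:
  assumes "P f"
    and d: "\<And>g z. P g \<Longrightarrow> g differentiable (at z)"
    and p1: "\<And>g. P g \<Longrightarrow> P (partial_1 g)"
    and p2: "\<And>g. P g \<Longrightarrow> P (partial_2 g)"
    and m1: "\<And>g. P g \<Longrightarrow> P (\<lambda>z. of_real (fst z) * g z)"
    and m2: "\<And>g. P g \<Longrightarrow> P (\<lambda>z. of_real (snd z) * g z)"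
    and b: "\<And>g. P g \<Longrightarrow> \<exists>B. \<forall>z. norm (g z) \<le> B"
  shows "schwartz f"
proof (rule schwartz_coinduct[of P])
  fix g n assume "P g"
  then have "\<exists>B. \<forall>z. (1 + \<bar>fst z\<bar> + \<bar>snd z\<bar>) ^ n * norm (g z) \<le> B"
  proof (induction n arbitrary: g)
    case (Suc n)
    from Suc.IH[OF Suc.prems] Suc.IH[OF m1[OF Suc.prems]] Suc.IH[OF m2[OF Suc.prems]]
    obtain B C D where
      "\<And>z. (1 + \<bar>fst z\<bar> + \<bar>snd z\<bar>) ^ n * norm (g z) \<le> B"
      "\<And>z. (1 + \<bar>fst z\<bar> + \<bar>snd z\<bar>) ^ n * norm (of_real (fst z) * g z) \<le> C"
      "\<And>z. (1 + \<bar>fst z\<bar> + \<bar>snd z\<bar>) ^ n * norm (of_real (snd z) * g z) \<le> D"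
      by metis
    from add_mono[OF this(1) add_mono[OF this(2,3)]]
    have "(1 + \<bar>fst z\<bar> + \<bar>snd z\<bar>) ^ Suc n * norm (g z) \<le> B + (C + D)" for z
      by (simp add: norm_mult algebra_simps)
    then show ?case by blast
  qed (use b in auto)
  then obtain B where B: "\<And>z. (1 + \<bar>fst z\<bar> + \<bar>snd z\<bar>) ^ n * norm (g z) \<le> B" by blast
  have "(1 + norm z) ^ n * norm (g z) \<le> B" for z
  proof -
    have "norm z \<le> \<bar>fst z\<bar> + \<bar>snd z\<bar>"
      using norm_Pair_le[of "fst z" "snd z"] by simp
    then have "(1 + norm z) ^ n * norm (g z) \<le> (1 + \<bar>fst z\<bar> + \<bar>snd z\<bar>) ^ n * norm (g z)"
      by (intro mult_right_mono power_mono) auto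
    then show ?thesis using B[of z] by linarith
  qed
  then show "\<exists>B. \<forall>z. (1 + norm z) ^ n * norm (g z) \<le> B" by blast
qed (use assms in auto)

section \<open>Integrability of Schwartz functions\<close>

lemma inverse_square_integrable: "integrable lborel (\<lambda>x::real. 1 / (1 + x\<^sup>2))"
  using integrable_inverse_1_plus_square by (simp add: set_integrable_def inverse_eq_divide)

text \<open>Each factor 1 + x^2 and 1 + t^2 is at most (1 + |z|)^2, so the fourth power of the
  weight suffices. The product form is what iterated integrals and
  \<open>partial_multiplication_formula\<close> consume.\<close>

lemma schwartz_decay:
  assumes "schwartz f"
  obtains B where "0 \<le> B" "\<And>x t. norm (f (x, t)) \<le> B * (1 / (1 + x\<^sup>2)) * (1 / (1 + t\<^sup>2))"
proof -
  obtain B where B: "\<And>z. (1 + norm z) ^ 4 * norm (f z) \<le> B"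
    using schwartz_bounded[OF assms] by blast
  have "norm (f (x, t)) \<le> B * (1 / (1 + x\<^sup>2)) * (1 / (1 + t\<^sup>2))" for x t
  proof -
    have *: "1 + y\<^sup>2 \<le> (1 + norm (x, t))\<^sup>2" if "\<bar>y\<bar> \<le> norm (x, t)" for y
    proof -
      have "y\<^sup>2 \<le> (norm (x, t))\<^sup>2" using that by (simp add: abs_le_square_iff[symmetric])
      then show ?thesis by (simp add: power2_sum add_increasing2)
    qed
    have "(1 + x\<^sup>2) * (1 + t\<^sup>2) \<le> (1 + norm (x, t))\<^sup>2 * (1 + norm (x, t))\<^sup>2"
      using norm_fst_le[of x t] norm_snd_le[of t x] by (intro mult_mono *) auto
    also have "\<dots> = (1 + norm (x, t)) ^ 4" by (simp add: power2_eq_square power4_eq_xxxx)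
    finally have "(1 + x\<^sup>2) * (1 + t\<^sup>2) * norm (f (x, t)) \<le> (1 + norm (x, t)) ^ 4 * norm (f (x, t))"
      by (rule mult_right_mono) auto
    also have "\<dots> \<le> B" by (rule B)
    finally have "(1 + x\<^sup>2) * (1 + t\<^sup>2) * norm (f (x, t)) \<le> B" .
    moreover have "0 < (1 + x\<^sup>2) * (1 + t\<^sup>2)" by (intro mult_pos_pos add_pos_nonneg) auto
    ultimately show ?thesis by (simp add: field_simps)
  qed
  moreover have "0 \<le> B" using B[of 0] by (rule order_trans[rotated]) simp
  ultimately show ?thesis using that by blast
qed

lemma schwartz_integrable_snd:
  assumes "schwartz f"
  shows "integrable lborel (\<lambda>t. f (x, t))"
proof -
  obtain B where B: "\<And>x t. norm (f (x, t)) \<le> B * (1 / (1 + x\<^sup>2)) * (1 / (1 + t\<^sup>2))"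
    using schwartz_decay[OF assms] by metis
  note [measurable] = schwartz_measurable[OF assms]
  show ?thesis
    by (rule Bochner_Integration.integrable_bound[OF integrable_mult_right[OF inverse_square_integrable, of "B * (1 / (1 + x\<^sup>2))"]])
      (auto intro!: AE_I2 intro: order_trans[OF B] simp del: times_divide_eq_right)
qed

lemma integrable_pair_mult:
  fixes f g :: "_ \<Rightarrow> 'b::{real_normed_field, banach, second_countable_topology}"
  assumes f: "integrable lborel f" and g: "integrable lborel g"
  shows "integrable (lborel \<Otimes>\<^sub>M lborel) (\<lambda>(x, t). f x * g t)"
proof (rule lborel_pair.Fubini_integrable)
  show "(\<lambda>(x, t). f x * g t) \<in> borel_measurable (lborel \<Otimes>\<^sub>M lborel)"
    using borel_measurable_integrable[OF f] borel_measurable_integrable[OF g] by measurable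
  show "integrable lborel (\<lambda>x. LINT y|lborel. norm (case (x, y) of (x, t) \<Rightarrow> f x * g t))"
    using f by (simp add: norm_mult integrable_norm)
  show "AE x in lborel. integrable lborel (\<lambda>y. case (x, y) of (x, t) \<Rightarrow> f x * g t)"
    using g by simp
qed

lemma schwartz_integrable:
  assumes "schwartz f"
  shows "integrable (lborel \<Otimes>\<^sub>M lborel) f"
proof -
  obtain B where B: "\<And>x t. norm (f (x, t)) \<le> B * (1 / (1 + x\<^sup>2)) * (1 / (1 + t\<^sup>2))"
    using schwartz_decay[OF assms] by metis
  note [measurable] = schwartz_measurable[OF assms]
  have "integrable (lborel \<Otimes>\<^sub>M lborel) (\<lambda>(x, t). (1 / (1 + x\<^sup>2)) * (1 / (1 + t\<^sup>2)) :: real)"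
    by (intro integrable_pair_mult inverse_square_integrable)
  from integrable_mult_right[OF this, of B] show ?thesis
  proof (rule Bochner_Integration.integrable_bound)
    show "f \<in> borel_measurable (lborel \<Otimes>\<^sub>M lborel)" by (simp add: lborel_prod)
    show "AE z in lborel \<Otimes>\<^sub>M lborel. norm (f z) \<le> norm (B * (case z of (x, t) \<Rightarrow> 1 / (1 + x\<^sup>2) * (1 / (1 + t\<^sup>2))))"
    proof (rule AE_I2)
      fix z :: "real \<times> real"
      obtain x t where z: "z = (x, t)" by (cases z)
      show "norm (f z) \<le> norm (B * (case z of (x, t) \<Rightarrow> 1 / (1 + x\<^sup>2) * (1 / (1 + t\<^sup>2))))"
        unfolding z prod.case using B[of x t] by (simp only: real_norm_def mult.assoc[symmetric])
    qed
  qed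
qed

section \<open>The partial Fourier transform\<close>

text \<open>The transform in the second variable only: \<open>s = - 1\<close> is the forward
  transform, and \<open>s = 1\<close> is its inverse up to the factor \<open>2 * pi\<close>. One
  definition with a sign lets regularity be proved once for both.\<close>

definition ft :: "real \<Rightarrow> (real \<times> real \<Rightarrow> complex) \<Rightarrow> real \<times> real \<Rightarrow> complex" where
  "ft s f = (\<lambda>(x, \<tau>). LINT t|lborel. cis (s * t * \<tau>) * f (x, t))"

lemma continuous_on_cis [continuous_intros]:
  "continuous_on A f \<Longrightarrow> continuous_on A (\<lambda>x. cis (f x))"
  unfolding cis_conv_exp by (intro continuous_intros)

lemma borel_measurable_cis [measurable (raw)]:
  "f \<in> borel_measurable M \<Longrightarrow> (\<lambda>x. cis (f x)) \<in> borel_measurable M"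
  by (rule borel_measurable_continuous_on[of cis]) (intro continuous_intros)

lemma integrable_cis_mult:
  fixes f :: "'a \<Rightarrow> complex"
  assumes "integrable M f" "g \<in> borel_measurable M"
  shows "integrable M (\<lambda>t. cis (g t) * f t)"
  by (rule Bochner_Integration.integrable_bound[OF assms(1)]) (use assms in \<open>auto simp: norm_mult\<close>)

lemma integrable_ft:
  assumes "schwartz f"
  shows "integrable lborel (\<lambda>t. cis (s * t * \<tau>) * f (x, t))"
  by (intro integrable_cis_mult schwartz_integrable_snd assms) auto

lemma ft_bounded:
  assumes "schwartz f"
  shows "\<exists>B. \<forall>z. norm (ft s f z) \<le> B"
proof -
  obtain B where B0: "0 \<le> B" and B: "\<And>x t. norm (f (x, t)) \<le> B * (1 / (1 + x\<^sup>2)) * (1 / (1 + t\<^sup>2))"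
    using schwartz_decay[OF assms] by metis
  have "norm (ft s f (x, \<tau>)) \<le> B * (LINT t|lborel. 1 / (1 + t\<^sup>2))" for x \<tau>
  proof -
    have "norm (ft s f (x, \<tau>)) \<le> (LINT t|lborel. norm (cis (s * t * \<tau>) * f (x, t)))"
      unfolding ft_def prod.case by (rule integral_norm_bound)
    also have "\<dots> \<le> (LINT t|lborel. B * (1 / (1 + t\<^sup>2)))"
    proof (rule integral_mono)
      show "integrable lborel (\<lambda>t. norm (cis (s * t * \<tau>) * f (x, t)))"
        by (intro integrable_norm integrable_ft assms)
      show "integrable lborel (\<lambda>t. B * (1 / (1 + t\<^sup>2)))"
        by (intro integrable_mult_right inverse_square_integrable)
      fix t
      have "B * (1 / (1 + x\<^sup>2)) * (1 / (1 + t\<^sup>2)) \<le> B * 1 * (1 / (1 + t\<^sup>2))"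
        using B0 by (intro mult_mono mult_left_mono) (auto simp: divide_simps add_pos_nonneg)
      then show "norm (cis (s * t * \<tau>) * f (x, t)) \<le> B * (1 / (1 + t\<^sup>2))"
        using B[of x t] by (simp add: norm_mult)
    qed
    also have "\<dots> = B * (LINT t|lborel. 1 / (1 + t\<^sup>2))" by (rule integral_mult_right_zero)
    finally show ?thesis .
  qed
  then show ?thesis by (auto intro!: exI)
qed

lemma ft_continuous:
  assumes "schwartz f"
  shows "continuous_on UNIV (ft s f)"
proof (rule continuous_on_sequentiallyI)
  fix u :: "nat \<Rightarrow> real \<times> real" and a :: "real \<times> real"
  assume u: "u \<longlonglongrightarrow> a"
  obtain B where B0: "0 \<le> B" and B: "\<And>x t. norm (f (x, t)) \<le> B * (1 / (1 + x\<^sup>2)) * (1 / (1 + t\<^sup>2))"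
    using schwartz_decay[OF assms] by metis
  note [measurable] = schwartz_measurable[OF assms]
  have "(\<lambda>n. LINT t|lborel. cis (s * t * snd (u n)) * f (fst (u n), t)) \<longlonglongrightarrow>
      (LINT t|lborel. cis (s * t * snd a) * f (fst a, t))"
  proof (rule integral_dominated_convergence[where w = "\<lambda>t. B * (1 / (1 + t\<^sup>2))"])
    show "integrable lborel (\<lambda>t. B * (1 / (1 + t\<^sup>2)))"
      by (intro integrable_mult_right inverse_square_integrable)
    show "AE t in lborel. (\<lambda>n. cis (s * t * snd (u n)) * f (fst (u n), t)) \<longlonglongrightarrow> cis (s * t * snd a) * f (fst a, t)"
    proof (rule AE_I2)
      fix t
      have "continuous_on UNIV (\<lambda>z. cis (s * t * snd z) * f (fst z, t))"
        by (intro continuous_intros continuous_on_compose2[OF schwartz_continuous[OF assms, of UNIV]]) auto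
      then show "(\<lambda>n. cis (s * t * snd (u n)) * f (fst (u n), t)) \<longlonglongrightarrow> cis (s * t * snd a) * f (fst a, t)"
        using u by (rule continuous_on_tendsto_compose) auto
    qed
    show "AE t in lborel. norm (cis (s * t * snd (u n)) * f (fst (u n), t)) \<le> B * (1 / (1 + t\<^sup>2))" for n
    proof (rule AE_I2)
      fix t
      have "B * (1 / (1 + (fst (u n))\<^sup>2)) * (1 / (1 + t\<^sup>2)) \<le> B * 1 * (1 / (1 + t\<^sup>2))"
        using B0 by (intro mult_mono mult_left_mono) (auto simp: divide_simps add_pos_nonneg)
      then show "norm (cis (s * t * snd (u n)) * f (fst (u n), t)) \<le> B * (1 / (1 + t\<^sup>2))"
        using B[of "fst (u n)" t] by (simp add: norm_mult)
    qed
  qed auto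
  then show "(\<lambda>n. ft s f (u n)) \<longlonglongrightarrow> ft s f a"
    by (simp add: ft_def case_prod_beta')
qed

lemma has_vector_derivative_cis:
  "((\<lambda>x. cis (c * x)) has_vector_derivative \<i> * of_real c * cis (c * x)) (at x)"
  by (auto simp: has_vector_derivative_complex_iff intro!: derivative_eq_intros)

lemma ft_partial_1_deriv:
  assumes "schwartz f"
  shows "((\<lambda>y. ft s f (y, \<tau>)) has_vector_derivative ft s (partial_1 f) (x, \<tau>)) (at x)"
proof -
  note f1 = schwartz_partial_1[OF assms]
  obtain B where B0: "0 \<le> B" and B: "\<And>x t. norm (partial_1 f (x, t)) \<le> B * (1 / (1 + x\<^sup>2)) * (1 / (1 + t\<^sup>2))"
    using schwartz_decay[OF f1] by metis
  show ?thesis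
    unfolding ft_def prod.case
  proof (rule has_vector_derivative_lebesgue_integral[where g = "\<lambda>t. B * (1 / (1 + t\<^sup>2))"])
    show "integrable lborel (\<lambda>t. cis (s * t * \<tau>) * f (x, t))" for x by (rule integrable_ft[OF assms])
    show "((\<lambda>x. cis (s * t * \<tau>) * f (x, t)) has_vector_derivative cis (s * t * \<tau>) * partial_1 f (x, t)) (at x)" for x t
      by (intro has_vector_derivative_mult_right has_vector_derivative_partial_1 schwartz_diff assms)
    show "(\<lambda>t. cis (s * t * \<tau>) * partial_1 f (x, t)) \<in> borel_measurable lborel" for x
      using integrable_ft[OF f1] by (rule borel_measurable_integrable)
    show "integrable lborel (\<lambda>t. B * (1 / (1 + t\<^sup>2)))"
      by (intro integrable_mult_right inverse_square_integrable)
    fix x t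
    have "B * (1 / (1 + x\<^sup>2)) * (1 / (1 + t\<^sup>2)) \<le> B * 1 * (1 / (1 + t\<^sup>2))"
      using B0 by (intro mult_mono mult_left_mono) (auto simp: divide_simps add_pos_nonneg)
    then show "norm (cis (s * t * \<tau>) * partial_1 f (x, t)) \<le> B * (1 / (1 + t\<^sup>2))"
      using B[of x t] by (simp add: norm_mult)
  qed
qed

lemma ft_partial_2_deriv:
  assumes "schwartz f"
  shows "((\<lambda>\<sigma>. ft s f (x, \<sigma>)) has_vector_derivative ft s (\<lambda>z. \<i> * of_real s * (of_real (snd z) * f z)) (x, \<tau>)) (at \<tau>)"
proof -
  have f2: "schwartz (\<lambda>z. \<i> * of_real s * (of_real (snd z) * f z))"
    by (intro schwartz_cmult schwartz_mult_snd assms)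
  show ?thesis
    unfolding ft_def prod.case
  proof (rule has_vector_derivative_lebesgue_integral[where g = "\<lambda>t. norm (\<i> * of_real s * (of_real (snd (x, t)) * f (x, t)))"])
    show "integrable lborel (\<lambda>t. cis (s * t * \<sigma>) * f (x, t))" for \<sigma> by (rule integrable_ft[OF assms])
    show "((\<lambda>\<sigma>. cis (s * t * \<sigma>) * f (x, t)) has_vector_derivative
        cis (s * t * \<sigma>) * (\<i> * of_real s * (of_real (snd (x, t)) * f (x, t)))) (at \<sigma>)" for \<sigma> t
      using has_vector_derivative_mult_left[OF has_vector_derivative_cis[of "s * t" \<sigma>], of "f (x, t)"]
      by (simp add: mult_ac)
    show "(\<lambda>t. cis (s * t * \<sigma>) * (\<i> * of_real s * (of_real (snd (x, t)) * f (x, t)))) \<in> borel_measurable lborel" for \<sigma>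
      using integrable_ft[OF f2] by (rule borel_measurable_integrable)
    show "integrable lborel (\<lambda>t. norm (\<i> * of_real s * (of_real (snd (x, t)) * f (x, t))))"
      using schwartz_integrable_snd[OF f2, of x] by (intro integrable_norm)
  qed (simp add: norm_mult)
qed

text \<open>Applied to a product, this is integration by parts on the line with vanishing boundary
  terms.\<close>

lemma integral_derivative_eq_0:
  fixes f f' :: "real \<Rightarrow> complex"
  assumes d: "\<And>t. (f has_vector_derivative f' t) (at t)" and c: "continuous_on UNIV f'"
    and i: "integrable lborel f'" and top: "(f \<longlongrightarrow> 0) at_top" and bot: "(f \<longlongrightarrow> 0) at_bot"
  shows "(LINT t|lborel. f' t) = 0"
proof -
  have "(LBINT x=-\<infinity>..\<infinity>. f' x) = 0 - 0"
  proof (rule interval_integral_FTC_integrable)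
    show "((f \<circ> real_of_ereal) \<longlongrightarrow> 0) (at_right (-\<infinity>))" "((f \<circ> real_of_ereal) \<longlongrightarrow> 0) (at_left \<infinity>)"
      using top bot by (simp_all add: ereal_tendsto_simps1)
    show "isCont f' x" for x using c by (simp add: continuous_on_eq_continuous_at)
    show "set_integrable lborel (einterval (-\<infinity>) \<infinity>) f'" using i by (simp add: set_integrable_def)
  qed (use d in auto)
  then show ?thesis by (simp add: interval_lebesgue_integral_def set_lebesgue_integral_def)
qed

text \<open>The derivative of cis(s t \<tau>) f(x,t) in t has integral zero, so the transform of
  \<partial>2 f is - i s \<tau> times that of f. Multiplication by i s and \<open>s * s = 1\<close>
  isolate the factor \<tau>.\<close>

lemma ft_mult_snd:
  assumes f: "schwartz f" and s: "s * s = 1"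
  shows "(\<lambda>z. of_real (snd z) * ft s f z) = ft s (\<lambda>z. \<i> * of_real s * partial_2 f z)"
proof (intro ext)
  fix z :: "real \<times> real"
  obtain x \<tau> where z: "z = (x, \<tau>)" by (cases z)
  note f2 = schwartz_partial_2[OF f]
  obtain B where B0: "0 \<le> B" and B: "\<And>x t. norm (f (x, t)) \<le> B * (1 / (1 + x\<^sup>2)) * (1 / (1 + t\<^sup>2))"
    using schwartz_decay[OF f] by metis
  let ?G = "\<lambda>t. cis (s * t * \<tau>) * f (x, t)"
  let ?g = "\<lambda>t. cis (s * t * \<tau>) * partial_2 f (x, t) + \<i> * of_real (s * \<tau>) * (cis (s * t * \<tau>) * f (x, t))"
  have "(LINT t|lborel. ?g t) = 0"
  proof (rule integral_derivative_eq_0[where f = ?G])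
    show "(?G has_vector_derivative ?g t) (at t)" for t
      using has_vector_derivative_mult[OF has_vector_derivative_cis[of "s * \<tau>" t] has_vector_derivative_partial_2[OF schwartz_diff[OF f], of x t]]
      by (simp add: mult_ac)
    show "continuous_on UNIV ?g"
      by (intro continuous_intros continuous_on_compose2[OF schwartz_continuous[OF f, of UNIV]]
          continuous_on_compose2[OF schwartz_continuous[OF f2, of UNIV]]) auto
    show "integrable lborel ?g"
      by (intro Bochner_Integration.integrable_add integrable_mult_right integrable_ft f f2)
    have bd: "norm (?G t) \<le> B * (1 / (1 + x\<^sup>2)) * (1 / (1 + t\<^sup>2))" for t
      using B[of x t] by (simp add: norm_mult)
    have lim: "((\<lambda>t. B * (1 / (1 + x\<^sup>2)) * (1 / (1 + t\<^sup>2))) \<longlongrightarrow> 0) at_top"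
      "((\<lambda>t. B * (1 / (1 + x\<^sup>2)) * (1 / (1 + t\<^sup>2))) \<longlongrightarrow> 0) at_bot"
      by real_asymp+
    show "(?G \<longlongrightarrow> 0) at_top"
      by (rule Lim_null_comparison[OF always_eventually[OF allI[OF bd]] lim(1)])
    show "(?G \<longlongrightarrow> 0) at_bot"
      by (rule Lim_null_comparison[OF always_eventually[OF allI[OF bd]] lim(2)])
  qed
  then have "(LINT t|lborel. cis (s * t * \<tau>) * partial_2 f (x, t)) + \<i> * of_real (s * \<tau>) * ft s f (x, \<tau>) = 0"
    by (subst (asm) Bochner_Integration.integral_add[OF integrable_ft[OF f2] integrable_mult_right[OF integrable_ft[OF f]]])
      (simp add: ft_def)
  then have "\<i> * of_real s * (LINT t|lborel. cis (s * t * \<tau>) * partial_2 f (x, t)) = of_real (s * s) * of_real \<tau> * ft s f (x, \<tau>)"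
    by (simp add: eq_neg_iff_add_eq_0[symmetric] mult_ac)
  moreover have "ft s (\<lambda>z. \<i> * of_real s * partial_2 f z) (x, \<tau>) = \<i> * of_real s * (LINT t|lborel. cis (s * t * \<tau>) * partial_2 f (x, t))"
    by (simp add: ft_def integral_mult_right_zero[symmetric] mult_ac del: integral_mult_right_zero)
  ultimately show "of_real (snd z) * ft s f z = ft s (\<lambda>z. \<i> * of_real s * partial_2 f z) z"
    using s by (simp add: z)
qed

lemma ft_mult_fst: "(\<lambda>z. of_real (fst z) * ft s f z) = ft s (\<lambda>z. of_real (fst z) * f z)"
  by (simp add: ft_def fun_eq_iff integral_mult_right_zero[symmetric] mult_ac del: integral_mult_right_zero)

text \<open>Derivatives of \<open>ft s f\<close> and its products with the coordinates are again
  transforms of Schwartz functions, so the family of all \<open>ft s f\<close> satisfies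
  \<open>schwartz_coinduct_mult\<close>; this reduces decay to mere boundedness.\<close>

lemma schwartz_ft:
  assumes f: "schwartz f" and s: "s * s = 1"
  shows "schwartz (ft s f)"
proof (rule schwartz_coinduct_mult[where P = "\<lambda>h. \<exists>f. schwartz f \<and> h = ft s f"])
  show "\<exists>f'. schwartz f' \<and> ft s f = ft s f'" using f by blast
next
  fix h
  assume "\<exists>f. schwartz f \<and> h = ft s f"
  then obtain f where f: "schwartz f" and h: "h = ft s f" by blast
  have f2: "schwartz (\<lambda>z. \<i> * of_real s * (of_real (snd z) * f z))"
    by (intro schwartz_cmult schwartz_mult_snd f)
  show "h differentiable (at z)" for z
    unfolding h
    by (rule differentiable_if_partials[OF ft_partial_1_deriv[OF f] ft_partial_2_deriv[OF f] ft_continuous[OF f2]])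
  have "partial_1 h = ft s (partial_1 f)"
    unfolding h by (intro partial_1_eqI ft_partial_1_deriv f)
  then show "\<exists>f. schwartz f \<and> partial_1 h = ft s f" using schwartz_partial_1[OF f] by blast
  have "partial_2 h = ft s (\<lambda>z. \<i> * of_real s * (of_real (snd z) * f z))"
    unfolding h by (intro partial_2_eqI ft_partial_2_deriv f)
  then show "\<exists>f. schwartz f \<and> partial_2 h = ft s f" using f2 by blast
  show "\<exists>f. schwartz f \<and> (\<lambda>z. of_real (fst z) * h z) = ft s f"
    unfolding h ft_mult_fst using schwartz_mult_fst[OF f] by blast
  show "\<exists>f. schwartz f \<and> (\<lambda>z. of_real (snd z) * h z) = ft s f"
    unfolding h ft_mult_snd[OF f s] using schwartz_cmult[OF schwartz_partial_2[OF f]] by blast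
  show "\<exists>B. \<forall>z. norm (h z) \<le> B"
    unfolding h by (rule ft_bounded[OF f])
qed

section \<open>Fourier inversion\<close>

text \<open>The Gaussian is its own transform up to normalisation, read off here from the
  characteristic function of the standard normal distribution.\<close>

lemma integral_cis_normal_density:
  "(LINT y|lborel. cis (a * y) * of_real (std_normal_density y)) = of_real (exp (- a\<^sup>2 / 2))"
proof -
  have "char std_normal_distribution a = (LINT y|lborel. std_normal_density y *\<^sub>R cis (a * y))"
    unfolding char_def by (subst integral_density) (auto simp: cis_conv_exp)
  then show ?thesis
    by (simp add: char_std_normal_distribution scaleR_conv_of_real mult.commute)
qed

text \<open>The Gaussian factor makes the double integral absolutely convergent; it is removed by $\epsilon \to 0$.\<close>

lemma fourier_inversion_1d:
  fixes g :: "real \<Rightarrow> complex"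
  assumes g: "integrable lborel g" and cont: "continuous_on UNIV g" and bd: "\<And>t. norm (g t) \<le> B"
    and gh: "integrable lborel (\<lambda>\<tau>. LINT s|lborel. cis (- (s * \<tau>)) * g s)"
  shows "(LINT \<tau>|lborel. cis (t * \<tau>) * (LINT s|lborel. cis (- (s * \<tau>)) * g s)) = of_real (2 * pi) * g t"
proof -
  define h where "h = (\<lambda>\<tau>. LINT s|lborel. cis (- (s * \<tau>)) * g s)"
  define N where "N = std_normal_density"
  have N: "integrable lborel N" "\<And>y. 0 \<le> N y" "(LINT y|lborel. N y) = 1"
    unfolding N_def by (auto simp: integrable_normal_density integral_normal_density)
  have Nexp: "N y = exp (- y\<^sup>2 / 2) / sqrt (2 * pi)" for y
    by (simp add: N_def std_normal_density_def)
  have [measurable]: "N \<in> borel_measurable borel" "g \<in> borel_measurable borel" "h \<in> borel_measurable borel"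
    using N(1) g gh by (auto simp: h_def dest: borel_measurable_integrable)
  \<comment> \<open>After Fubini, the inner integral over \<tau> is the transform of a Gaussian at
    (t - s) / e, again a Gaussian. The substitution s = t + e y turns the outer integral into an
    average of g near t against the normal density.\<close>
  have key: "(LINT \<tau>|lborel. cis (t * \<tau>) * h \<tau> * of_real (exp (- (e * \<tau>)\<^sup>2 / 2))) =
      of_real (2 * pi) * (LINT y|lborel. g (t + e * y) * of_real (N y))" if e: "0 < e" for e
  proof -
    have Ne: "integrable lborel (\<lambda>\<tau>. N (e * \<tau>))"
      using lborel_integrable_real_affine[OF N(1), of e 0] e by simp
    have "(LINT \<tau>|lborel. cis (t * \<tau>) * h \<tau> * of_real (exp (- (e * \<tau>)\<^sup>2 / 2))) =
        (LINT \<tau>|lborel. LINT s|lborel. of_real (sqrt (2 * pi)) * (g s * (cis ((t - s) * \<tau>) * of_real (N (e * \<tau>)))))"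
    proof (rule Bochner_Integration.integral_cong)
      fix \<tau>
      have "cis (t * \<tau>) * h \<tau> * of_real (exp (- (e * \<tau>)\<^sup>2 / 2)) =
         (LINT s|lborel. (cis (t * \<tau>) * of_real (sqrt (2 * pi) * N (e * \<tau>))) * (cis (- (s * \<tau>)) * g s))"
        unfolding h_def by (subst integral_mult_right_zero) (simp add: Nexp mult_ac)
      also have "\<dots> = (LINT s|lborel. of_real (sqrt (2 * pi)) * (g s * (cis ((t - s) * \<tau>) * of_real (N (e * \<tau>)))))"
      proof -
        have "cis ((t - s) * \<tau>) = cis (t * \<tau>) * cis (- (s * \<tau>))" for s
          by (simp add: cis_mult left_diff_distrib)
        then show ?thesis by (simp only: of_real_mult mult_ac)
      qed
      finally show "cis (t * \<tau>) * h \<tau> * of_real (exp (- (e * \<tau>)\<^sup>2 / 2)) = \<dots>" .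
    qed simp
    also have "\<dots> = (LINT s|lborel. LINT \<tau>|lborel. of_real (sqrt (2 * pi)) * (g s * (cis ((t - s) * \<tau>) * of_real (N (e * \<tau>)))))"
    proof (rule lborel_pair.Fubini_integral)
      have "integrable (lborel \<Otimes>\<^sub>M lborel) (\<lambda>(s, \<tau>). g s * complex_of_real (N (e * \<tau>)))"
        by (intro integrable_pair_mult g integrable_of_real Ne)
      from integrable_mult_right[OF this, of "of_real (sqrt (2 * pi))"]
      show "integrable (lborel \<Otimes>\<^sub>M lborel) (\<lambda>(s, \<tau>). of_real (sqrt (2 * pi)) * (g s * (cis ((t - s) * \<tau>) * of_real (N (e * \<tau>)))))"
        by (rule Bochner_Integration.integrable_bound) (auto simp: norm_mult split_beta')
    qed
    also have "\<dots> = (LINT s|lborel. of_real (sqrt (2 * pi) / e) * (g s * of_real (exp (- ((t - s) / e)\<^sup>2 / 2))))"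
    proof (rule Bochner_Integration.integral_cong)
      fix s
      have "(LINT \<tau>|lborel. cis ((t - s) * \<tau>) * of_real (N (e * \<tau>))) =
          \<bar>1 / e\<bar> *\<^sub>R (LINT y|lborel. cis ((t - s) * (0 + 1 / e * y)) * of_real (N (e * (0 + 1 / e * y))))"
        using e by (intro lborel_integral_real_affine) simp
      also have "\<dots> = of_real (1 / e) * (LINT y|lborel. cis ((t - s) / e * y) * of_real (N y))"
        using e by (simp add: scaleR_conv_of_real)
      also have "\<dots> = of_real (1 / e) * of_real (exp (- ((t - s) / e)\<^sup>2 / 2))"
        unfolding N_def integral_cis_normal_density ..
      finally show "(LINT \<tau>|lborel. of_real (sqrt (2 * pi)) * (g s * (cis ((t - s) * \<tau>) * of_real (N (e * \<tau>))))) =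
          of_real (sqrt (2 * pi) / e) * (g s * of_real (exp (- ((t - s) / e)\<^sup>2 / 2)))"
        unfolding integral_mult_right_zero by simp
    qed simp
    also have "\<dots> = \<bar>e\<bar> *\<^sub>R (LINT y|lborel. of_real (sqrt (2 * pi) / e) *
        (g (t + e * y) * of_real (exp (- ((t - (t + e * y)) / e)\<^sup>2 / 2))))"
      using e by (intro lborel_integral_real_affine) simp
    also have "\<dots> = \<bar>e\<bar> *\<^sub>R (LINT y|lborel. of_real (2 * pi / e) * (g (t + e * y) * of_real (N y)))"
    proof (intro arg_cong2[where f = scaleR] Bochner_Integration.integral_cong refl)
      fix y
      have "sqrt (2 * pi) / e * exp (- ((t - (t + e * y)) / e)\<^sup>2 / 2) = 2 * pi / e * N y"
        using e real_sqrt_mult_self[of "2 * pi"] by (simp add: Nexp field_simps)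
      then show "of_real (sqrt (2 * pi) / e) * (g (t + e * y) * of_real (exp (- ((t - (t + e * y)) / e)\<^sup>2 / 2))) =
          of_real (2 * pi / e) * (g (t + e * y) * of_real (N y))"
        by (metis (no_types, lifting) mult.left_commute of_real_mult)
    qed
    also have "\<dots> = of_real (2 * pi) * (LINT y|lborel. g (t + e * y) * of_real (N y))"
      using e by (subst integral_mult_right_zero) (simp add: scaleR_conv_of_real)
    finally show ?thesis .
  qed
  define e where "e = (\<lambda>n. 1 / real (Suc n))"
  have e0: "e \<longlonglongrightarrow> 0" unfolding e_def by (rule LIMSEQ_Suc[OF lim_const_over_n])
  have epos: "0 < e n" for n by (simp add: e_def)
  have 1: "(\<lambda>n. LINT \<tau>|lborel. cis (t * \<tau>) * h \<tau> * of_real (exp (- (e n * \<tau>)\<^sup>2 / 2))) \<longlonglongrightarrow>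
      (LINT \<tau>|lborel. cis (t * \<tau>) * h \<tau>)"
  proof (rule integral_dominated_convergence[where w = "\<lambda>\<tau>. norm (h \<tau>)"])
    show "integrable lborel (\<lambda>\<tau>. norm (h \<tau>))" using gh by (intro integrable_norm) (simp add: h_def)
    show "AE \<tau> in lborel. (\<lambda>n. cis (t * \<tau>) * h \<tau> * of_real (exp (- (e n * \<tau>)\<^sup>2 / 2))) \<longlonglongrightarrow> cis (t * \<tau>) * h \<tau>"
    proof (rule AE_I2)
      fix \<tau>
      have "(\<lambda>n. cis (t * \<tau>) * h \<tau> * of_real (exp (- (e n * \<tau>)\<^sup>2 / 2))) \<longlonglongrightarrow>
          cis (t * \<tau>) * h \<tau> * of_real (exp (- (0 * \<tau>)\<^sup>2 / 2))"
        by (intro tendsto_mult tendsto_const tendsto_of_real tendsto_exp tendsto_divide tendsto_minus tendsto_power e0) simp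
      then show "(\<lambda>n. cis (t * \<tau>) * h \<tau> * of_real (exp (- (e n * \<tau>)\<^sup>2 / 2))) \<longlonglongrightarrow> cis (t * \<tau>) * h \<tau>"
        by simp
    qed
  qed (auto simp: norm_mult intro!: mult_left_le)
  have 2: "(\<lambda>n. LINT y|lborel. g (t + e n * y) * of_real (N y)) \<longlonglongrightarrow> (LINT y|lborel. g t * of_real (N y))"
  proof (rule integral_dominated_convergence[where w = "\<lambda>y. B * N y"])
    show "integrable lborel (\<lambda>y. B * N y)" by (intro integrable_mult_right N)
    show "AE y in lborel. (\<lambda>n. g (t + e n * y) * of_real (N y)) \<longlonglongrightarrow> g t * of_real (N y)"
    proof (rule AE_I2)
      fix y
      have "(\<lambda>n. t + e n * y) \<longlonglongrightarrow> t"
          using tendsto_add[OF tendsto_const tendsto_mult[OF e0 tendsto_const[of y]], of t] by simp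
      then have "(\<lambda>n. g (t + e n * y)) \<longlonglongrightarrow> g t"
        using cont by (intro continuous_on_tendsto_compose[OF cont]) auto
      then show "(\<lambda>n. g (t + e n * y) * of_real (N y)) \<longlonglongrightarrow> g t * of_real (N y)"
        by (intro tendsto_mult tendsto_const)
    qed
    show "AE y in lborel. norm (g (t + e n * y) * of_real (N y)) \<le> B * N y" for n
      using N(2) bd by (auto simp: norm_mult intro!: mult_right_mono)
  qed auto
  have "(LINT y|lborel. g t * of_real (N y)) = g t * of_real (LINT y|lborel. N y)"
    by simp
  with 2 have "(\<lambda>n. of_real (2 * pi) * (LINT y|lborel. g (t + e n * y) * of_real (N y))) \<longlonglongrightarrow> of_real (2 * pi) * g t"
    using N(3) by (intro tendsto_mult tendsto_const) simp
  with 1 have "(LINT \<tau>|lborel. cis (t * \<tau>) * h \<tau>) = of_real (2 * pi) * g t"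
    unfolding key[OF epos] by (rule LIMSEQ_unique)
  then show ?thesis by (simp add: h_def)
qed

text \<open>Both signs occur later: \<open>s = - 1\<close> when the transform in x is rewritten as a
  full transform, \<open>s = 1\<close> when a test function is recovered in
  \<open>is_density_bilin\<close>. The reflection \<tau> \<mapsto> -\<tau> reduces the former to the
  latter.\<close>

lemma ft_inversion:
  assumes f: "schwartz f" and s: "s = 1 \<or> s = - 1"
  shows "ft s (ft (- s) f) = (\<lambda>z. of_real (2 * pi) * f z)"
proof (intro ext)
  fix z :: "real \<times> real"
  obtain x t where z: "z = (x, t)" by (cases z)
  obtain B where B: "\<And>z. norm (f z) \<le> B" using schwartz_bounded[OF f, of 0] by auto
  have inv: "(LINT \<tau>|lborel. cis (t * \<tau>) * (LINT r|lborel. cis (- (r * \<tau>)) * f (x, r))) = of_real (2 * pi) * f (x, t)"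
  proof (rule fourier_inversion_1d)
    show "integrable lborel (\<lambda>t. f (x, t))" by (rule schwartz_integrable_snd[OF f])
    show "continuous_on UNIV (\<lambda>t. f (x, t))"
      by (rule continuous_on_compose2[OF schwartz_continuous[OF f, of UNIV]]) (auto intro: continuous_intros)
    show "norm (f (x, t)) \<le> B" for t by (rule B)
    show "integrable lborel (\<lambda>\<tau>. LINT s|lborel. cis (- (s * \<tau>)) * f (x, s))"
      using schwartz_integrable_snd[OF schwartz_ft[OF f, of "-1"], of x] by (simp add: ft_def)
  qed
  have "ft s (ft (- s) f) (x, t) = (LINT \<tau>|lborel. cis (t * \<tau>) * (LINT r|lborel. cis (- (r * \<tau>)) * f (x, r)))"
    using s
  proof
    assume "s = 1"
    then show ?thesis by (simp add: ft_def mult.commute)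
  next
    assume "s = -1"
    then show ?thesis
      by (simp add: ft_def) (subst lborel_integral_real_affine[of "-1" _ 0], auto simp: mult.commute)
  qed
  then show "ft s (ft (- s) f) z = of_real (2 * pi) * f z" using inv z by simp
qed

section \<open>Relations between full and partial transforms\<close>

lemma fourier_eq_ft:
  assumes "schwartz f"
  shows "fourier f (\<xi>, \<tau>) = (LINT x|lborel. cis (- (x * \<xi>)) * ft (-1) f (x, \<tau>))"
proof -
  have int: "integrable (lborel \<Otimes>\<^sub>M lborel) (\<lambda>z. cis (- (fst z * \<xi> + snd z * \<tau>)) * f z)"
    by (intro integrable_cis_mult schwartz_integrable assms) simp
  have "fourier f (\<xi>, \<tau>) = (LINT x|lborel. LINT t|lborel. cis (- (x * \<xi> + t * \<tau>)) * f (x, t))"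
    unfolding fourier_def prod.case lborel_prod[symmetric]
    using lborel_pair.integral_fst'[OF int] by simp
  also have "\<dots> = (LINT x|lborel. LINT t|lborel. cis (- (x * \<xi>)) * (cis (- (t * \<tau>)) * f (x, t)))"
    by (simp add: mult.assoc[symmetric] cis_mult)
  finally show ?thesis by (simp add: ft_def)
qed

text \<open>Undoing the transform in t beforehand leaves only the transform in x. By duality this
  expresses \<open>distr_fourier_x u\<close> through \<open>distr_fourier u\<close>, which is the
  object that the norm of u controls.\<close>

lemma fourier_x_eq_fourier_ft:
  assumes f: "schwartz f"
  shows "fourier_x f = fourier (\<lambda>z. of_real (1 / (2 * pi)) * ft 1 f z)"
proof (intro ext)
  fix z :: "real \<times> real"
  obtain \<xi> t where z: "z = (\<xi>, t)" by (cases z)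
  have "ft (-1) (\<lambda>z. of_real (1 / (2 * pi)) * ft 1 f z) (x, t) = of_real (1 / (2 * pi)) * ft (-1) (ft 1 f) (x, t)" for x
    unfolding ft_def prod.case by (subst integral_mult_right_zero[symmetric]) (simp add: mult_ac)
  then have *: "ft (-1) (\<lambda>z. of_real (1 / (2 * pi)) * ft 1 f z) (x, t) = f (x, t)" for x
    using ft_inversion[OF f, of "-1"] by simp
  have "fourier (\<lambda>z. of_real (1 / (2 * pi)) * ft 1 f z) (\<xi>, t) = (LINT x|lborel. cis (- (x * \<xi>)) * f (x, t))"
    using fourier_eq_ft[OF schwartz_cmult[OF schwartz_ft[OF f, of 1], of "of_real (1 / (2 * pi))"], of \<xi> t]
    unfolding * by simp
  then show "fourier_x f z = fourier (\<lambda>z. of_real (1 / (2 * pi)) * ft 1 f z) z"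
    by (simp add: fourier_x_def z)
qed

text \<open>\<open>fourier_x_inv\<close> cancels the x-part of \<open>fourier\<close>. It acts at
  fixed t, hence passes through any factor \<open>c t\<close>; with the time cutoff as
  \<open>c\<close>, this treats the test functions produced by \<open>mult_time\<close>.\<close>

lemma fourier_x_inv_mult_fourier:
  assumes f: "schwartz f"
  shows "fourier_x_inv (\<lambda>(x, t). c t * fourier f (x, t)) = (\<lambda>(x, t). c t * ft (-1) f (x, t))"
proof (intro ext)
  fix z :: "real \<times> real"
  obtain \<xi> t where z: "z = (\<xi>, t)" by (cases z)
  define g where "g = ft (-1) f"
  have g: "schwartz g" unfolding g_def by (intro schwartz_ft f) simp
  obtain B where B: "\<And>z. norm (g z) \<le> B" using schwartz_bounded[OF g, of 0] by auto
  have "(LINT x|lborel. cis (\<xi> * x) * (LINT y|lborel. cis (- (y * x)) * g (y, t))) = of_real (2 * pi) * g (\<xi>, t)"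
  proof (rule fourier_inversion_1d)
    show "integrable lborel (\<lambda>y. g (y, t))" using schwartz_integrable_snd[OF schwartz_swap[OF g], of t] by simp
    show "continuous_on UNIV (\<lambda>y. g (y, t))"
      by (rule continuous_on_compose2[OF schwartz_continuous[OF g, of UNIV]]) (auto intro: continuous_intros)
    show "norm (g (y, t)) \<le> B" for y by (rule B)
    show "integrable lborel (\<lambda>\<tau>. LINT s|lborel. cis (- (s * \<tau>)) * g (s, t))"
      using schwartz_integrable_snd[OF schwartz_ft[OF schwartz_swap[OF g], of "-1"], of t] by (simp add: ft_def)
  qed
  then have "(LINT x|lborel. cis (\<xi> * x) * fourier f (x, t)) = of_real (2 * pi) * g (\<xi>, t)"
    by (simp add: fourier_eq_ft[OF f] g_def)
  moreover have "(LINT x|lborel. cis (\<xi> * x) * (c t * fourier f (x, t))) = c t * (LINT x|lborel. cis (\<xi> * x) * fourier f (x, t))"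
    by (subst integral_mult_right_zero[symmetric]) (simp add: mult_ac)
  ultimately show "fourier_x_inv (\<lambda>(x, t). c t * fourier f (x, t)) z = (case z of (x, t) \<Rightarrow> c t * ft (-1) f (x, t))"
    by (simp add: fourier_x_inv_def z g_def)
qed

lemma fourier_x_inv_fourier:
  "schwartz f \<Longrightarrow> fourier_x_inv (fourier f) = ft (-1) f"
  using fourier_x_inv_mult_fourier[of f "\<lambda>_. 1"] by (simp add: case_prod_beta')

section \<open>Test functions and uniqueness of densities\<close>

text \<open>A finite order of differentiability makes closure of \<open>smooth_real\<close> under
  products and affine substitutions accessible to induction: the derivative of a product of order n
  + 1 is a sum of products of order n.\<close>

definition differentiable_upto :: "nat \<Rightarrow> (real \<Rightarrow> real) \<Rightarrow> bool" where
  "differentiable_upto n f \<longleftrightarrow> (\<forall>k\<le>n. \<forall>x. ((deriv ^^ k) f) differentiable (at x))"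

lemma smooth_real_iff: "smooth_real f \<longleftrightarrow> (\<forall>n. differentiable_upto n f)"
  by (auto simp: smooth_real_def differentiable_upto_def)

lemma differentiable_upto_0: "differentiable_upto 0 f \<longleftrightarrow> (\<forall>x. f differentiable (at x))"
  by (simp add: differentiable_upto_def)

lemma differentiable_upto_Suc:
  "differentiable_upto (Suc n) f \<longleftrightarrow> (\<forall>x. f differentiable (at x)) \<and> differentiable_upto n (deriv f)"
proof -
  have *: "(deriv ^^ Suc k) f = (deriv ^^ k) (deriv f)" for k
    by (simp only: funpow_Suc_right comp_def)
  have "(\<forall>k\<le>Suc n. P k) \<longleftrightarrow> P 0 \<and> (\<forall>k\<le>n. P (Suc k))" for P
    by (metis Suc_le_mono not0_implies_Suc zero_le)
  then show ?thesis
    unfolding differentiable_upto_def * by (simp only: * funpow_0)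
qed

lemma differentiable_upto_mono: "differentiable_upto n f \<Longrightarrow> m \<le> n \<Longrightarrow> differentiable_upto m f"
  by (auto simp: differentiable_upto_def)

lemma has_field_derivative_deriv:
  fixes f :: "real \<Rightarrow> real"
  shows "f differentiable (at x) \<Longrightarrow> (f has_field_derivative deriv f x) (at x)"
  by (metis DERIV_deriv_iff_real_differentiable)

lemma differentiable_upto_add:
  "differentiable_upto n f \<Longrightarrow> differentiable_upto n g \<Longrightarrow> differentiable_upto n (\<lambda>x. f x + g x)"
proof (induction n arbitrary: f g)
  case (Suc n)
  have "deriv (\<lambda>x. f x + g x) = (\<lambda>x. deriv f x + deriv g x)"
    using Suc.prems by (intro ext DERIV_imp_deriv DERIV_add has_field_derivative_deriv) (auto simp: differentiable_upto_Suc)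
  then show ?case
    using Suc by (simp add: differentiable_upto_Suc differentiable_add)
qed (simp add: differentiable_upto_0 differentiable_add)

lemma differentiable_upto_mult:
  "differentiable_upto n f \<Longrightarrow> differentiable_upto n g \<Longrightarrow> differentiable_upto n (\<lambda>x. f x * g x)"
proof (induction n arbitrary: f g)
  case (Suc n)
  have "deriv (\<lambda>x. f x * g x) = (\<lambda>x. deriv f x * g x + deriv g x * f x)"
    using Suc.prems by (intro ext DERIV_imp_deriv DERIV_mult has_field_derivative_deriv) (auto simp: differentiable_upto_Suc)
  moreover have "differentiable_upto n (\<lambda>x. deriv f x * g x)" "differentiable_upto n (\<lambda>x. deriv g x * f x)"
    using Suc.prems differentiable_upto_mono[of "Suc n" _ n]
    by (auto intro!: Suc.IH simp: differentiable_upto_Suc)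
  ultimately show ?case
    using Suc.prems by (simp add: differentiable_upto_Suc differentiable_upto_add differentiable_mult)
qed (simp add: differentiable_upto_0 differentiable_mult)

lemma differentiable_upto_const: "differentiable_upto n (\<lambda>x. c)"
proof (induction n arbitrary: c)
  case (Suc n)
  have "deriv (\<lambda>x. c :: real) = (\<lambda>x. 0)" by (intro ext DERIV_imp_deriv) simp
  then show ?case using Suc by (simp add: differentiable_upto_Suc)
qed (simp add: differentiable_upto_0)

lemma differentiable_upto_affine:
  "differentiable_upto n f \<Longrightarrow> differentiable_upto n (\<lambda>x. f (a * x + b))"
proof (induction n arbitrary: f)
  case 0
  have "(f \<circ> (\<lambda>x. a * x + b)) differentiable (at x)" for x
    using 0 by (intro differentiable_chain_at) (auto simp: differentiable_upto_0 intro!: derivative_intros)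
  then show ?case by (simp add: differentiable_upto_0 comp_def)
next
  case (Suc n)
  have d: "((\<lambda>x. f (a * x + b)) has_field_derivative deriv f (a * x + b) * a) (at x)" for x
    by (rule DERIV_chain2[of f]) (use Suc.prems in \<open>auto intro!: has_field_derivative_deriv derivative_eq_intros simp: differentiable_upto_Suc\<close>)
  have "deriv (\<lambda>x. f (a * x + b)) = (\<lambda>x. deriv f (a * x + b) * a)"
    by (rule ext, rule DERIV_imp_deriv[OF d])
  moreover have "differentiable_upto n (\<lambda>x. deriv f (a * x + b) * a)"
    using Suc.prems by (intro differentiable_upto_mult[OF Suc.IH differentiable_upto_const]) (simp add: differentiable_upto_Suc)
  moreover have "(\<lambda>x. f (a * x + b)) differentiable (at x)" for x
    using d real_differentiable_def by blast
  ultimately show ?case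
    by (simp add: differentiable_upto_Suc)
qed

lemma smooth_real_mult: "smooth_real f \<Longrightarrow> smooth_real g \<Longrightarrow> smooth_real (\<lambda>x. f x * g x)"
  by (simp add: smooth_real_iff differentiable_upto_mult)

lemma smooth_real_affine: "smooth_real f \<Longrightarrow> smooth_real (\<lambda>x. f (a * x + b))"
  by (simp add: smooth_real_iff differentiable_upto_affine)

lemma smooth_real_power: "smooth_real f \<Longrightarrow> smooth_real (\<lambda>x. f x ^ n)"
  by (induction n) (simp_all add: smooth_real_iff differentiable_upto_mult differentiable_upto_const)

lemma smooth_real_deriv: "smooth_real f \<Longrightarrow> smooth_real (deriv f)"
  by (meson differentiable_upto_Suc smooth_real_iff)

lemma smooth_real_has_derivative: "smooth_real f \<Longrightarrow> (f has_field_derivative deriv f x) (at x)"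
  by (meson differentiable_upto_0 smooth_real_iff has_field_derivative_deriv)

lemma smooth_real_continuous: "smooth_real f \<Longrightarrow> continuous_on A f"
  by (meson smooth_real_has_derivative DERIV_isCont continuous_at_imp_continuous_on)

lemma deriv_eq_0_outside:
  assumes "\<And>x. R < \<bar>x\<bar> \<Longrightarrow> f x = (0::real)" "R < \<bar>x\<bar>"
  shows "deriv f x = 0"
proof (rule DERIV_imp_deriv)
  have "open {x::real. R < \<bar>x\<bar>}" by (intro open_Collect_less continuous_intros)
  then show "(f has_field_derivative 0) (at x)"
    by (rule has_field_derivative_transform_within_open[of "\<lambda>_. 0", rotated]) (use assms in auto)
qed

text \<open>One radius \<open>R\<close> serves for all derivatives, since the complement of the
  interval from -R to R is open and a function vanishing there has vanishing derivative there. Decay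
  then follows from boundedness on a compact square.\<close>

lemma schwartz_tensor:
  assumes "smooth_real f" "smooth_real g" and "\<And>x. R < \<bar>x\<bar> \<Longrightarrow> f x = 0" "\<And>x. R < \<bar>x\<bar> \<Longrightarrow> g x = 0"
  shows "schwartz (\<lambda>z. of_real (f (fst z) * g (snd z)))"
proof (rule schwartz_coinduct[where P = "\<lambda>h. \<exists>f g. smooth_real f \<and> smooth_real g \<and>
    (\<forall>x. R < \<bar>x\<bar> \<longrightarrow> f x = 0 \<and> g x = 0) \<and> h = (\<lambda>z. of_real (f (fst z) * g (snd z)))"])
  show "\<exists>f' g'. smooth_real f' \<and> smooth_real g' \<and> (\<forall>x. R < \<bar>x\<bar> \<longrightarrow> f' x = 0 \<and> g' x = 0) \<and>
      (\<lambda>z. complex_of_real (f (fst z) * g (snd z))) = (\<lambda>z. of_real (f' (fst z) * g' (snd z)))"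
    using assms by blast
next
  fix h n
  assume "\<exists>f g. smooth_real f \<and> smooth_real g \<and>
    (\<forall>x. R < \<bar>x\<bar> \<longrightarrow> f x = 0 \<and> g x = 0) \<and> h = (\<lambda>z. complex_of_real (f (fst z) * g (snd z)))"
  then obtain f g where f: "smooth_real f" and g: "smooth_real g" and R: "\<And>x. R < \<bar>x\<bar> \<Longrightarrow> f x = 0" "\<And>x. R < \<bar>x\<bar> \<Longrightarrow> g x = 0"
    and h: "h = (\<lambda>z. complex_of_real (f (fst z) * g (snd z)))" by blast
  have d1: "((\<lambda>y. h (y, t)) has_vector_derivative complex_of_real (deriv f (fst (x, t)) * g (snd (x, t)))) (at x)" for x t
    unfolding h
    by (intro has_vector_derivative_of_real) (auto intro!: derivative_eq_intros smooth_real_has_derivative[OF f])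
  have d2: "((\<lambda>s. h (x, s)) has_vector_derivative complex_of_real (f (fst (x, t)) * deriv g (snd (x, t)))) (at t)" for x t
    unfolding h
    by (intro has_vector_derivative_of_real) (auto intro!: derivative_eq_intros smooth_real_has_derivative[OF g])
  show "h differentiable (at z)" for z
  proof (rule differentiable_if_partials[OF d1 d2])
    show "continuous_on UNIV (\<lambda>z. complex_of_real (f (fst z) * deriv g (snd z)))"
      by (intro continuous_intros continuous_on_compose2[OF smooth_real_continuous[OF f, of UNIV]]
          continuous_on_compose2[OF smooth_real_continuous[OF smooth_real_deriv[OF g], of UNIV]]) auto
  qed
  show "\<exists>f g. smooth_real f \<and> smooth_real g \<and>
    (\<forall>x. R < \<bar>x\<bar> \<longrightarrow> f x = 0 \<and> g x = 0) \<and> partial_1 h = (\<lambda>z. complex_of_real (f (fst z) * g (snd z)))"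
    using partial_1_eqI[of h "\<lambda>z. complex_of_real (deriv f (fst z) * g (snd z))", OF d1]
      g R(2) smooth_real_deriv[OF f] deriv_eq_0_outside[OF R(1)]
    by (intro exI[of _ "deriv f"] exI[of _ g]) simp
  show "\<exists>f g. smooth_real f \<and> smooth_real g \<and>
    (\<forall>x. R < \<bar>x\<bar> \<longrightarrow> f x = 0 \<and> g x = 0) \<and> partial_2 h = (\<lambda>z. complex_of_real (f (fst z) * g (snd z)))"
    using partial_2_eqI[of h "\<lambda>z. complex_of_real (f (fst z) * deriv g (snd z))", OF d2]
      f R(1) smooth_real_deriv[OF g] deriv_eq_0_outside[OF R(2)]
    by (intro exI[of _ f] exI[of _ "deriv g"]) simp
  define K where "K = cbox (- R, - R) (R, R)"
  have "continuous_on K (\<lambda>z. (1 + norm z) ^ n * norm (h z))"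
    unfolding h
    by (intro continuous_intros continuous_on_compose2[OF smooth_real_continuous[OF f, of UNIV]]
        continuous_on_compose2[OF smooth_real_continuous[OF g, of UNIV]]) auto
  then have "compact ((\<lambda>z. (1 + norm z) ^ n * norm (h z)) ` K)"
    unfolding K_def by (intro compact_continuous_image compact_cbox)
  then have "bdd_above ((\<lambda>z. (1 + norm z) ^ n * norm (h z)) ` K)"
    by (intro bounded_imp_bdd_above compact_imp_bounded)
  then obtain B where B: "\<And>z. z \<in> K \<Longrightarrow> (1 + norm z) ^ n * norm (h z) \<le> B"
    unfolding bdd_above_def by blast
  have "(1 + norm z) ^ n * norm (h z) \<le> max B 0" for z
  proof (cases "z \<in> K")
    case False
    then have "R < \<bar>fst z\<bar> \<or> R < \<bar>snd z\<bar>"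
      by (cases z) (auto simp: K_def cbox_Pair_eq abs_le_iff not_le)
    then show ?thesis using R by (auto simp: h)
  qed (use B in \<open>simp add: le_max_iff_disj\<close>)
  then show "\<exists>B. \<forall>z. (1 + norm z) ^ n * norm (h z) \<le> B" by blast
qed

section \<open>Elementary properties of the cutoff\<close>

lemma cutoff_outside:
  assumes "cutoff \<phi>" "5 / 4 < \<bar>x\<bar>"
  shows "\<phi> x = 0"
proof (rule ccontr)
  assume "\<phi> x \<noteq> 0"
  then have "x \<in> closure {x. \<phi> x \<noteq> 0}" by (intro closure_subset[THEN subsetD]) simp
  moreover have "closure {x. \<phi> x \<noteq> 0} \<subseteq> {- 5 / 4..5 / 4}" using assms(1) by (simp add: cutoff_def)
  ultimately have "- 5 / 4 \<le> x" "x \<le> 5 / 4" by (meson atLeastAtMost_iff subsetD)+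
  then show False using assms(2) by linarith
qed

lemma cutoff_bounds:
  assumes "cutoff \<phi>"
  shows "0 \<le> \<phi> x" "\<phi> x \<le> 1" "\<bar>x\<bar> \<le> 1 \<Longrightarrow> \<phi> x = 1"
proof -
  show "0 \<le> \<phi> x" using assms by (auto simp: cutoff_def)
  show "\<phi> x = 1" if "\<bar>x\<bar> \<le> 1" using assms that by (auto simp: cutoff_def abs_le_iff)
  have "\<phi> \<bar>x\<bar> \<le> \<phi> 0"
    using assms abs_ge_zero[of x] order_refl[of 0] unfolding cutoff_def by blast
  moreover have "\<phi> 0 = 1" "\<phi> \<bar>x\<bar> = \<phi> x"
    using assms by (auto simp: cutoff_def abs_if)
  ultimately show "\<phi> x \<le> 1" by simp
qed

text \<open>Powers of \<phi> converge to the indicator of the set where \<phi> equals 1. Evenness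
  and monotonicity make this set a symmetric interval, and continuity makes it closed; its
  half-length \<alpha> may exceed 1, so it has to be named.\<close>

lemma cutoff_level:
  assumes "cutoff \<phi>"
  obtains \<alpha> where "1 \<le> \<alpha>" "\<And>x. \<bar>x\<bar> \<le> \<alpha> \<longleftrightarrow> \<phi> x = 1"
proof -
  define S where "S = {x. 0 \<le> x \<and> \<phi> x = 1}"
  have sm: "smooth_real \<phi>" using assms by (simp add: cutoff_def)
  have "closed S"
    unfolding S_def by (intro closed_Collect_conj closed_Collect_le closed_Collect_eq continuous_intros smooth_real_continuous[OF sm])
  moreover have bdd: "bdd_above S"
  proof (rule bdd_aboveI[of _ "5/4"])
    show "x \<le> 5 / 4" if "x \<in> S" for x
      using that cutoff_outside[OF assms, of x] by (cases "x \<le> 5 / 4") (auto simp: S_def)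
  qed
  moreover have "1 \<in> S" using cutoff_bounds(3)[OF assms, of 1] by (simp add: S_def)
  ultimately have m: "Sup S \<in> S" by (intro closed_contains_Sup) auto
  have abs: "\<phi> \<bar>x\<bar> = \<phi> x" for x using assms by (auto simp: cutoff_def abs_if)
  have "\<bar>x\<bar> \<le> Sup S \<longleftrightarrow> \<phi> x = 1" for x
  proof
    assume "\<bar>x\<bar> \<le> Sup S"
    then have "\<phi> (Sup S) \<le> \<phi> \<bar>x\<bar>" using assms by (auto simp: cutoff_def)
    then show "\<phi> x = 1" using m cutoff_bounds(2)[OF assms, of x] by (simp add: abs S_def)
  next
    assume "\<phi> x = 1"
    then have "\<bar>x\<bar> \<in> S" by (simp add: S_def abs)
    then show "\<bar>x\<bar> \<le> Sup S" using bdd by (rule cSup_upper)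
  qed
  moreover have "1 \<le> Sup S" using \<open>1 \<in> S\<close> bdd by (rule cSup_upper)
  ultimately show ?thesis using that by blast
qed

section \<open>Test functions determine densities almost everywhere\<close>

text \<open>Open boxes are an intersection-stable generator of the Borel sets, and \<open>f0\<close>
  starts the complement step, as the whole space is not a box. The hypothesis speaks of closed boxes
  because these are what powers of cutoffs approximate; the boundary is a null set.\<close>

lemma AE_eq_0_if_integral_cbox_eq_0:
  fixes f :: "'a::euclidean_space \<Rightarrow> complex"
  assumes f: "integrable lborel f" and f0: "(LINT z|lborel. f z) = 0"
    and box: "\<And>a b. (\<forall>i\<in>Basis. a \<bullet> i < b \<bullet> i) \<Longrightarrow> (LINT z|lborel. indicator (cbox a b) z *\<^sub>R f z) = 0"
  shows "AE z in lborel. f z = 0"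
proof (rule sigma_finite_measure.density_zero[OF sigma_finite_lborel f])
  fix A :: "'a set"
  assume "A \<in> sets lborel"
  then have A: "A \<in> sigma_sets UNIV (range (\<lambda>(a, b). box a b))"
    by (simp add: borel_eq_box)
  have "Int_stable (range (\<lambda>(a, b). box a b :: 'a set))"
    by (auto simp: Int_stable_def box_Int_box)
  moreover have "range (\<lambda>(a, b). box a b :: 'a set) \<subseteq> Pow UNIV" by auto
  moreover note A
  ultimately show "(LINT z:A|lborel. f z) = 0"
  proof (induction rule: sigma_sets_induct_disjoint)
    case (basic A)
    then obtain a b where A: "A = box a b" by auto
    show ?case
    proof (cases "\<forall>i\<in>Basis. a \<bullet> i < b \<bullet> i")
      case True
      have "AE z in lborel. (indicator (box a b) z :: real) = indicator (cbox a b) z"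
      proof (rule AE_I')
        have "emeasure lborel (cbox a b - box a b) = emeasure lborel (cbox a b) - emeasure lborel (box a b)"
          using emeasure_lborel_box_finite[of a b] by (intro emeasure_Diff) (auto simp: box_subset_cbox)
        also have "\<dots> = 0"
          using True by (simp add: emeasure_lborel_cbox_eq emeasure_lborel_box_eq less_imp_le)
        finally show "cbox a b - box a b \<in> null_sets lborel" by (simp add: null_sets_def)
      qed (use box_subset_cbox[of a b] in \<open>auto simp: indicator_def split: if_splits\<close>)
      then have "(LINT z:A|lborel. f z) = (LINT z|lborel. indicator (cbox a b) z *\<^sub>R f z)"
        unfolding set_lebesgue_integral_def A using f
        by (intro integral_cong_AE) (auto intro: borel_measurable_scaleR dest: borel_measurable_integrable)
      then show ?thesis using box[OF True] by simp
    next
      case False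
      then have "A = {}" by (auto simp: A box_eq_empty not_less)
      then show ?thesis by (simp add: set_lebesgue_integral_def)
    qed
  next
    case empty
    then show ?case by (simp add: set_lebesgue_integral_def)
  next
    case (compl A)
    then have A: "A \<in> sets lborel" by (simp add: borel_eq_box)
    have "(LINT z:UNIV - A|lborel. f z) = (LINT z|lborel. f z - indicator A z *\<^sub>R f z)"
      unfolding set_lebesgue_integral_def by (intro Bochner_Integration.integral_cong) (auto simp: indicator_def)
    also have "\<dots> = 0"
      using compl.IH f0 f integrable_mult_indicator[OF A f]
      by (subst Bochner_Integration.integral_diff) (auto simp: set_lebesgue_integral_def)
    finally show ?case .
  next
    case (union A)
    then have A: "A i \<in> sets lborel" for i by (auto simp: borel_eq_box)
    have "(LINT z:(\<Union>i. A i)|lborel. f z) = (\<Sum>i. (LINT z:A i|lborel. f z))"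
      using union.hyps f A
      by (intro lebesgue_integral_countable_add)
        (auto simp: disjoint_family_on_def set_integrable_def intro!: integrable_mult_indicator sets.countable_UN)
    then show ?case using union.IH by simp
  qed
qed

text \<open>
  The powers of an affine image of the cutoff decrease to the indicator of the interval on which it
  equals one, so that indicators of boxes are limits of test functions.
\<close>

lemma AE_zero_if_orthogonal_schwartz:
  assumes phi: "cutoff \<phi>"
    and meas: "D \<in> borel_measurable lborel"
    and int: "\<And>\<psi>. schwartz \<psi> \<Longrightarrow> integrable lborel (\<lambda>z. D z * \<psi> z)"
    and orth: "\<And>\<psi>. schwartz \<psi> \<Longrightarrow> (LINT z|lborel. D z * \<psi> z) = 0"
  shows "AE z in lborel. D z = 0"
proof -
  have sm: "smooth_real \<phi>" using phi by (simp add: cutoff_def)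
  note [measurable] = meas borel_measurable_continuous_onI[OF smooth_real_continuous[OF sm]]
  obtain \<alpha> where \<alpha>: "1 \<le> \<alpha>" and level: "\<And>x. \<bar>x\<bar> \<le> \<alpha> \<longleftrightarrow> \<phi> x = 1" using cutoff_level[OF phi] by blast
  \<comment> \<open>\<open>D\<close> itself need not be integrable. Its product with a compactly
    supported test function is, and the factor equals 1 on squares that exhaust the plane as
    \<open>M\<close> grows.\<close>
  have "AE z in lborel. D z * of_real (\<phi> (1 / real (Suc M) * fst z + 0) * \<phi> (1 / real (Suc M) * snd z + 0)) = 0" for M
  proof -
    define c where "c = 1 / real (Suc M)"
    have c: "0 < c" by (simp add: c_def)
    define w where "w = (\<lambda>z. complex_of_real (\<phi> (c * fst z + 0) * \<phi> (c * snd z + 0)))"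
    have out: "\<phi> (c * x + 0) = 0" if "5 / 4 / c < \<bar>x\<bar>" for x
      using that c by (intro cutoff_outside[OF phi]) (simp add: abs_mult field_simps)
    have w: "schwartz w"
      unfolding w_def by (rule schwartz_tensor[OF _ _ out out]) (intro smooth_real_affine[OF sm] | assumption)+
    have "AE z in lborel. D z * w z = 0"
    proof (rule AE_eq_0_if_integral_cbox_eq_0[OF int[OF w] orth[OF w]])
      fix p q :: "real \<times> real"
      assume pq: "\<forall>i\<in>Basis. p \<bullet> i < q \<bullet> i"
      obtain a1 a2 b1 b2 where p: "p = (a1, a2)" and q: "q = (b1, b2)" by (cases p, cases q)
      from pq have lt: "a1 < b1" "a2 < b2" by (auto simp: p q Basis_prod_def)
      \<comment> \<open>The increasing affine map carrying the interval from \<open>a\<close> to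
        \<open>b\<close> onto the interval from -\<alpha> to \<alpha>, on which \<phi> equals
        1.\<close>
      define l where "l = (\<lambda>a b x. 2 * \<alpha> / (b - a) * x + - \<alpha> * (a + b) / (b - a) :: real)"
      have l: "\<bar>l a b x\<bar> \<le> \<alpha> \<longleftrightarrow> a \<le> x \<and> x \<le> b" if "a < b" for a b x
      proof -
        have "l a b x = \<alpha> * ((2 * x - a - b) / (b - a))" 
          by (simp add: l_def add_divide_distrib diff_divide_distrib algebra_simps)
        then have "\<bar>l a b x\<bar> = \<alpha> * \<bar>(2 * x - a - b) / (b - a)\<bar>"
          using \<alpha> by (simp only: abs_mult)
        then have "\<bar>l a b x\<bar> \<le> \<alpha> \<longleftrightarrow> \<bar>(2 * x - a - b) / (b - a)\<bar> \<le> 1"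
          using mult_le_cancel_left_pos[of \<alpha> "\<bar>(2 * x - a - b) / (b - a)\<bar>" 1] \<alpha> by simp
        also have "\<dots> \<longleftrightarrow> \<bar>2 * x - a - b\<bar> \<le> b - a" using that by (simp add: abs_divide)
        finally show ?thesis using that by (auto simp: abs_le_iff)
      qed
      define \<psi> where "\<psi> = (\<lambda>n z. complex_of_real ((\<phi> (c * fst z + 0) * \<phi> (l a1 b1 (fst z)) ^ n) * (\<phi> (c * snd z + 0) * \<phi> (l a2 b2 (snd z)) ^ n)))"
      have \<psi>: "schwartz (\<psi> n)" for n
        unfolding \<psi>_def
      proof (rule schwartz_tensor)
        show "smooth_real (\<lambda>x. \<phi> (c * x + 0) * \<phi> (l a1 b1 x) ^ n)" "smooth_real (\<lambda>x. \<phi> (c * x + 0) * \<phi> (l a2 b2 x) ^ n)"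
          unfolding l_def by (intro smooth_real_mult smooth_real_power smooth_real_affine[OF sm])+
      qed (use out in auto)
      have lim: "(\<lambda>n. \<phi> (l a b x) ^ n) \<longlonglongrightarrow> indicator {a..b} x" if "a < b" for a b x
      proof (cases "x \<in> {a..b}")
        case True
        then have "\<phi> (l a b x) = 1" using l[OF that, of x] level by auto
        then show ?thesis using True by simp
      next
        case False
        then have "\<phi> (l a b x) \<noteq> 1" using l[OF that, of x] level by auto
        then have "\<bar>\<phi> (l a b x)\<bar> < 1" using cutoff_bounds(1,2)[OF phi, of "l a b x"] by auto
        then show ?thesis using False by (auto intro: LIMSEQ_power_zero)
      qed
      have "(\<lambda>n. LINT z|lborel. D z * \<psi> n z) \<longlonglongrightarrow> (LINT z|lborel. indicator (cbox p q) z *\<^sub>R (D z * w z))"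
      proof (rule integral_dominated_convergence[where w = "\<lambda>z. norm (D z * w z)"])
        show "integrable lborel (\<lambda>z. norm (D z * w z))" by (intro integrable_norm int w)
        show "(\<lambda>z. D z * \<psi> n z) \<in> borel_measurable lborel" for n
          using int[OF \<psi>] by (rule borel_measurable_integrable)
        show "(\<lambda>z. indicator (cbox p q) z *\<^sub>R (D z * w z)) \<in> borel_measurable lborel"
          using int[OF w] by (intro borel_measurable_scaleR) (auto dest: borel_measurable_integrable)
        show "AE z in lborel. (\<lambda>n. D z * \<psi> n z) \<longlonglongrightarrow> indicator (cbox p q) z *\<^sub>R (D z * w z)"
        proof (rule AE_I2)
          fix z :: "real \<times> real"
          have "(\<lambda>n. D z * \<psi> n z) \<longlonglongrightarrow> D z * complex_of_real ((\<phi> (c * fst z + 0) * indicator {a1..b1} (fst z)) * (\<phi> (c * snd z + 0) * indicator {a2..b2} (snd z)))"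
            unfolding \<psi>_def by (intro tendsto_mult tendsto_const tendsto_of_real lim lt)
          also have "D z * complex_of_real ((\<phi> (c * fst z + 0) * indicator {a1..b1} (fst z)) * (\<phi> (c * snd z + 0) * indicator {a2..b2} (snd z))) = indicator (cbox p q) z *\<^sub>R (D z * w z)"
            by (cases z) (auto simp: p q cbox_Pair_eq w_def indicator_def)
          finally show "(\<lambda>n. D z * \<psi> n z) \<longlonglongrightarrow> indicator (cbox p q) z *\<^sub>R (D z * w z)" .
        qed
        show "AE z in lborel. norm (D z * \<psi> n z) \<le> norm (D z * w z)" for n
        proof (rule AE_I2)
          fix z
          have "\<phi> (l a1 b1 (fst z)) ^ n * \<phi> (l a2 b2 (snd z)) ^ n \<le> 1"
            by (intro mult_le_one power_le_one) (auto simp: cutoff_bounds[OF phi])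
          then have "norm (\<psi> n z) \<le> norm (w z)"
            using mult_left_mono[of "\<phi> (l a1 b1 (fst z)) ^ n * \<phi> (l a2 b2 (snd z)) ^ n" 1 "\<phi> (c * fst z + 0) * \<phi> (c * snd z + 0)"]
              cutoff_bounds(1)[OF phi]
            by (simp add: \<psi>_def w_def norm_mult norm_power abs_mult mult_ac)
          then show "norm (D z * \<psi> n z) \<le> norm (D z * w z)"
            unfolding norm_mult by (intro mult_left_mono) auto
        qed
      qed
      then show "(LINT z|lborel. indicator (cbox p q) z *\<^sub>R (D z * w z)) = 0"
        using orth[OF \<psi>] by (simp add: LIMSEQ_const_iff)
    qed
    then show ?thesis by (simp add: w_def c_def)
  qed
  then have "AE z in lborel. \<forall>M. D z * of_real (\<phi> (1 / real (Suc M) * fst z + 0) * \<phi> (1 / real (Suc M) * snd z + 0)) = 0"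
    unfolding AE_all_countable by blast
  then show ?thesis
  proof (rule AE_mp, intro AE_I2 impI)
    fix z
    assume z: "\<forall>M. D z * of_real (\<phi> (1 / real (Suc M) * fst z + 0) * \<phi> (1 / real (Suc M) * snd z + 0)) = 0"
    obtain M :: nat where "\<bar>fst z\<bar> + \<bar>snd z\<bar> \<le> real M" using real_arch_simple by blast
    then have "\<bar>1 / real (Suc M) * fst z + 0\<bar> \<le> 1" "\<bar>1 / real (Suc M) * snd z + 0\<bar> \<le> 1"
      by (auto simp: abs_mult divide_simps)
    then have "\<phi> (1 / real (Suc M) * fst z + 0) = 1" "\<phi> (1 / real (Suc M) * snd z + 0) = 1"
      by (auto intro: cutoff_bounds(3)[OF phi])
    with z[rule_format, of M] show "D z = 0" by simp
  qed
qed

text \<open>The cutoff is the source of compactly supported test functions; the difference of two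
  densities is orthogonal to all of them.\<close>

lemma is_density_unique:
  assumes "cutoff \<phi>" "is_density T G" "is_density T H"
  shows "AE z in lborel. G z = H z"
proof -
  have "AE z in lborel. G z - H z = 0"
  proof (rule AE_zero_if_orthogonal_schwartz[OF assms(1)])
    show "(\<lambda>z. G z - H z) \<in> borel_measurable lborel"
      using assms by (intro borel_measurable_diff) (auto simp: is_density_def)
    fix \<psi> assume \<psi>: "schwartz \<psi>"
    have G: "integrable lborel (\<lambda>z. G z * \<psi> z)" "T \<psi> = (LINT z|lborel. G z * \<psi> z)"
      and H: "integrable lborel (\<lambda>z. H z * \<psi> z)" "T \<psi> = (LINT z|lborel. H z * \<psi> z)"
      using assms(2,3) \<psi> by (auto simp: is_density_def distr_of_def)
    show "integrable lborel (\<lambda>z. (G z - H z) * \<psi> z)"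
      unfolding left_diff_distrib by (intro Bochner_Integration.integrable_diff G H)
    show "(LINT z|lborel. (G z - H z) * \<psi> z) = 0"
      unfolding left_diff_distrib using G H by (subst Bochner_Integration.integral_diff) auto
  qed
  then show ?thesis by simp
qed

lemma is_density_density_of: "is_density T G \<Longrightarrow> is_density T (density_of T)"
  unfolding density_of_def by (rule someI[of "is_density T"])

lemma density_of_eq:
  "cutoff \<phi> \<Longrightarrow> is_density T G \<Longrightarrow> AE z in lborel. density_of T z = G z"
  using is_density_unique is_density_density_of by blast

section \<open>The Fourier transform of the bilinear operators\<close>

lemma borel_measurable_fst_snd [measurable]:
  "fst \<in> borel_measurable (borel :: ('a::second_countable_topology \<times> 'b::second_countable_topology) measure)"
  "snd \<in> borel_measurable (borel :: ('a::second_countable_topology \<times> 'b::second_countable_topology) measure)"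
  by (intro borel_measurable_continuous_onI continuous_intros)+

lemma integral_lborel_pair:
  fixes f :: "'a::euclidean_space \<times> 'b::euclidean_space \<Rightarrow> complex"
  assumes "integrable lborel f"
  shows "(LINT z|lborel. f z) = (LINT x|lborel. LINT y|lborel. f (x, y))"
    and "integrable lborel (\<lambda>x. LINT y|lborel. f (x, y))"
    and "integrable lborel (\<lambda>x. LINT y|lborel. norm (f (x, y)))"
    and "AE x in lborel. integrable lborel (\<lambda>y. f (x, y))"
proof -
  have *: "integrable (lborel \<Otimes>\<^sub>M lborel) f" using assms by (simp add: lborel_prod)
  show "(LINT z|lborel. f z) = (LINT x|lborel. LINT y|lborel. f (x, y))"
    using lborel_pair.integral_fst'[OF *] by (simp add: lborel_prod)
  show "integrable lborel (\<lambda>x. LINT y|lborel. f (x, y))"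
    by (rule lborel_pair.integrable_fst'[OF *])
  show "integrable lborel (\<lambda>x. LINT y|lborel. norm (f (x, y)))"
    by (rule lborel_pair.integrable_fst'[OF integrable_norm[OF *]])
  show "AE x in lborel. integrable lborel (\<lambda>y. f (x, y))"
    by (rule lborel_pair.AE_integrable_fst'[OF *])
qed

text \<open>Fubini for a bounded kernel. The kernel is left general because both exponentials and
  translates of \<open>cutoff_hat\<close> are inserted.\<close>

lemma multiplication_formula:
  fixes f g :: "real \<Rightarrow> complex"
  assumes f: "integrable lborel f" and g: "integrable lborel g"
    and K: "K \<in> borel_measurable borel" and bd: "\<And>z. norm (K z) \<le> M"
  shows "(LINT t|lborel. (LINT \<tau>|lborel. K (t, \<tau>) * f \<tau>) * g t) =
    (LINT \<tau>|lborel. f \<tau> * (LINT t|lborel. K (t, \<tau>) * g t))"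
proof -
  have M: "0 \<le> M" using bd[of undefined] norm_ge_zero order_trans by blast
  have int: "integrable (lborel \<Otimes>\<^sub>M lborel) (\<lambda>(t, \<tau>). K (t, \<tau>) * (g t * f \<tau>))"
  proof (rule Bochner_Integration.integrable_bound)
    show "integrable (lborel \<Otimes>\<^sub>M lborel) (\<lambda>z. of_real M * (case z of (t, \<tau>) \<Rightarrow> g t * f \<tau>))"
      by (intro integrable_mult_right integrable_pair_mult f g)
    show "(\<lambda>(t, \<tau>). K (t, \<tau>) * (g t * f \<tau>)) \<in> borel_measurable (lborel \<Otimes>\<^sub>M lborel)"
      using borel_measurable_integrable[OF f] borel_measurable_integrable[OF g] K by measurable
    show "AE z in lborel \<Otimes>\<^sub>M lborel. norm (case z of (t, \<tau>) \<Rightarrow> K (t, \<tau>) * (g t * f \<tau>)) \<le>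
        norm (of_real M * (case z of (t, \<tau>) \<Rightarrow> g t * f \<tau>))"
      using M by (intro AE_I2) (auto simp: norm_mult split_beta' intro!: mult_right_mono bd)
  qed
  have "(LINT t|lborel. (LINT \<tau>|lborel. K (t, \<tau>) * f \<tau>) * g t) =
      (LINT t|lborel. LINT \<tau>|lborel. K (t, \<tau>) * (g t * f \<tau>))"
    by (intro Bochner_Integration.integral_cong refl, subst integral_mult_left_zero[symmetric]) (simp only: mult_ac)
  also have "\<dots> = (LINT \<tau>|lborel. LINT t|lborel. K (t, \<tau>) * (g t * f \<tau>))"
    by (rule lborel_pair.Fubini_integral[OF int, symmetric])
  also have "\<dots> = (LINT \<tau>|lborel. f \<tau> * (LINT t|lborel. K (t, \<tau>) * g t))"
    by (intro Bochner_Integration.integral_cong refl, subst integral_mult_right_zero[symmetric]) (simp only: mult_ac)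
  finally show ?thesis .
qed

lemma borel_measurable_partial_kernel:
  fixes G K :: "real \<times> real \<Rightarrow> complex"
  assumes [measurable]: "G \<in> borel_measurable borel" "K \<in> borel_measurable borel"
  shows "(\<lambda>z. LINT \<tau>|lborel. K (snd z, \<tau>) * G (fst z, \<tau>)) \<in> borel_measurable borel"
  by measurable

text \<open>The weight \<open>w\<close> allows a \<open>G\<close> that is integrable only after
  multiplication by \<open>w\<close>, provided that \<Theta> is small where \<open>w\<close> is. It
  is used with \<open>1 / (1 + x\<^sup>2)\<close> for the transforms of u and v, and with the
  constant 1 for their multiplier convolution, which is integrable.\<close>

lemma partial_multiplication_formula:
  fixes G \<Theta> K :: "real \<times> real \<Rightarrow> complex" and w :: "real \<Rightarrow> real"
  assumes G: "G \<in> borel_measurable borel" and w: "w \<in> borel_measurable borel" "\<And>x. 0 < w x"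
    and int: "integrable lborel (\<lambda>z. of_real (w (fst z)) * G z)"
    and \<Theta>: "\<Theta> \<in> borel_measurable borel" "\<And>x t. norm (\<Theta> (x, t)) \<le> B * w x * (1 / (1 + t\<^sup>2))"
    and K: "K \<in> borel_measurable borel" "\<And>z. norm (K z) \<le> M"
  shows "integrable lborel (\<lambda>z. (LINT \<tau>|lborel. K (snd z, \<tau>) * G (fst z, \<tau>)) * \<Theta> z)" (is "integrable _ ?L")
    and "integrable lborel (\<lambda>z. G z * (LINT t|lborel. K (t, snd z) * \<Theta> (fst z, t)))" (is "integrable _ ?R")
    and "(LINT z|lborel. (LINT \<tau>|lborel. K (snd z, \<tau>) * G (fst z, \<tau>)) * \<Theta> z) =
      (LINT z|lborel. G z * (LINT t|lborel. K (t, snd z) * \<Theta> (fst z, t)))"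
proof -
  note [measurable] = G w(1) \<Theta>(1) K(1)
  have M: "0 \<le> M" using K(2)[of undefined] norm_ge_zero order_trans by blast
  have B: "0 \<le> B"
    using order_trans[OF norm_ge_zero \<Theta>(2)[of 0 0]] w(2)[of 0] by (simp add: zero_le_mult_iff)
  have wi: "integrable lborel (\<lambda>t. B * w x * (1 / (1 + t\<^sup>2)))" for x
    by (intro integrable_mult_right inverse_square_integrable)
  have \<Theta>int: "integrable lborel (\<lambda>t. \<Theta> (x, t))" for x
    by (rule Bochner_Integration.integrable_bound[OF wi[of x]]) (auto intro!: AE_I2 intro: order_trans[OF \<Theta>(2)] order_trans[OF _ abs_ge_self] simp del: times_divide_eq_right)
  have Gint: "AE x in lborel. integrable lborel (\<lambda>\<tau>. G (x, \<tau>))"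
    using integral_lborel_pair(4)[OF int]
  proof eventually_elim
    case (elim x)
    from integrable_mult_right[OF elim, of "of_real (1 / w x)"] show ?case
      using w(2)[of x] by simp
  qed
  show L: "integrable lborel ?L"
  proof (rule Bochner_Integration.integrable_bound)
    \<comment> \<open>The dominating function is a product of a function of x and one of t. The
      factor \<open>w x\<close> in the bound on \<Theta> joins \<open>G\<close>, which makes the
      function of x integrable.\<close>
    have dom: "integrable (lborel \<Otimes>\<^sub>M lborel)
      (\<lambda>(x, t). (LINT \<tau>|lborel. norm (of_real (w x) * G (x, \<tau>))) * (M * B * (1 / (1 + t\<^sup>2))))"
      using integral_lborel_pair(3)[OF int]
      by (intro integrable_pair_mult integrable_mult_right inverse_square_integrable) simp
    then show "integrable lborel
      (\<lambda>(x, t). (LINT \<tau>|lborel. norm (of_real (w x) * G (x, \<tau>))) * (M * B * (1 / (1 + t\<^sup>2))))"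
      by (simp add: lborel_prod)
    show Lm: "?L \<in> borel_measurable lborel" by measurable
    show "AE z in lborel. norm (?L z) \<le> norm (case z of (x, t) \<Rightarrow>
        (LINT \<tau>|lborel. norm (of_real (w x) * G (x, \<tau>))) * (M * B * (1 / (1 + t\<^sup>2))))"
    proof -
      have "AE z in lborel \<Otimes>\<^sub>M lborel. norm (?L z) \<le> norm (case z of (x, t) \<Rightarrow>
        (LINT \<tau>|lborel. norm (of_real (w x) * G (x, \<tau>))) * (M * B * (1 / (1 + t\<^sup>2))))"
      proof (rule lborel_pair.AE_pair_measure)
        show "AE x in lborel. AE t in lborel. norm (?L (x, t)) \<le> norm (case (x, t) of (x, t) \<Rightarrow>
            (LINT \<tau>|lborel. norm (of_real (w x) * G (x, \<tau>))) * (M * B * (1 / (1 + t\<^sup>2))))"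
          using Gint
        proof eventually_elim
          case (elim x)
          show ?case
          proof (rule AE_I2)
            fix t :: real
            have "norm (LINT \<tau>|lborel. K (t, \<tau>) * G (x, \<tau>)) \<le> (LINT \<tau>|lborel. norm (K (t, \<tau>) * G (x, \<tau>)))"
              by (rule integral_norm_bound)
            also have "\<dots> \<le> (LINT \<tau>|lborel. M * norm (G (x, \<tau>)))"
            proof (rule integral_mono)
              have *: "integrable lborel (\<lambda>\<tau>. K (t, \<tau>) * G (x, \<tau>))"
                by (rule Bochner_Integration.integrable_bound[OF integrable_mult_right[OF integrable_norm[OF elim], of M]])
                  (use M K(2) in \<open>auto simp: norm_mult intro!: AE_I2 mult_right_mono\<close>)
              show "integrable lborel (\<lambda>\<tau>. norm (K (t, \<tau>) * G (x, \<tau>)))" by (rule integrable_norm[OF *])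
              show "integrable lborel (\<lambda>\<tau>. M * norm (G (x, \<tau>)))" by (intro integrable_mult_right integrable_norm elim)
            qed (use K(2) in \<open>simp add: norm_mult mult_right_mono\<close>)
            finally have 1: "norm (LINT \<tau>|lborel. K (t, \<tau>) * G (x, \<tau>)) \<le> M * (LINT \<tau>|lborel. norm (G (x, \<tau>)))"
              by simp
            have "norm (?L (x, t)) \<le> (M * (LINT \<tau>|lborel. norm (G (x, \<tau>)))) * (B * w x * (1 / (1 + t\<^sup>2)))"
              unfolding norm_mult fst_conv snd_conv
              by (intro mult_mono 1 \<Theta>(2)) (auto intro!: mult_nonneg_nonneg M)
            also have "\<dots> = (LINT \<tau>|lborel. norm (of_real (w x) * G (x, \<tau>))) * (M * B * (1 / (1 + t\<^sup>2)))"
              using w(2)[of x] by (simp add: norm_mult)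
            finally show "norm (?L (x, t)) \<le> norm (case (x, t) of (x, t) \<Rightarrow>
                (LINT \<tau>|lborel. norm (of_real (w x) * G (x, \<tau>))) * (M * B * (1 / (1 + t\<^sup>2))))"
              by (simp del: times_divide_eq_right)
          qed
        qed
        show "{z \<in> space (lborel \<Otimes>\<^sub>M lborel). norm (?L z) \<le> norm (case z of (x, t) \<Rightarrow>
            (LINT \<tau>|lborel. norm (of_real (w x) * G (x, \<tau>))) * (M * B * (1 / (1 + t\<^sup>2))))}
            \<in> sets (lborel \<Otimes>\<^sub>M lborel)"
          using Lm borel_measurable_integrable[OF dom]
          by (intro borel_measurable_le borel_measurable_norm) (simp_all add: lborel_prod)
      qed
      then show ?thesis unfolding lborel_prod .
    qed
  qed
  show R: "integrable lborel ?R"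
  proof (rule Bochner_Integration.integrable_bound)
    show "integrable lborel (\<lambda>z. of_real (M * B * (LINT t|lborel. 1 / (1 + t\<^sup>2))) * (of_real (w (fst z)) * G z))"
      by (intro integrable_mult_right int)
    show "?R \<in> borel_measurable lborel" by measurable
    show "AE z in lborel. norm (?R z) \<le> norm (of_real (M * B * (LINT t|lborel. 1 / (1 + t\<^sup>2))) * (of_real (w (fst z)) * G z))"
    proof (rule AE_I2)
      fix z :: "real \<times> real"
      obtain x \<tau> where z: "z = (x, \<tau>)" by (cases z)
      have le: "norm (K (t, \<tau>) * \<Theta> (x, t)) \<le> M * (B * w x * (1 / (1 + t\<^sup>2)))" for t
        unfolding norm_mult by (intro mult_mono K(2) \<Theta>(2)) (auto intro: M)
      have "norm (LINT t|lborel. K (t, \<tau>) * \<Theta> (x, t)) \<le> (LINT t|lborel. norm (K (t, \<tau>) * \<Theta> (x, t)))"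
        by (rule integral_norm_bound)
      also have "\<dots> \<le> (LINT t|lborel. M * (B * w x * (1 / (1 + t\<^sup>2))))"
      proof (rule integral_mono)
        show i: "integrable lborel (\<lambda>t. M * (B * w x * (1 / (1 + t\<^sup>2))))"
          by (rule integrable_mult_right[OF wi])
        show "integrable lborel (\<lambda>t. norm (K (t, \<tau>) * \<Theta> (x, t)))"
          by (intro integrable_norm Bochner_Integration.integrable_bound[OF i])
            (auto intro!: AE_I2 intro: order_trans[OF le abs_ge_self] simp del: times_divide_eq_right)
      qed (rule le)
      also have "\<dots> = M * B * (LINT t|lborel. 1 / (1 + t\<^sup>2)) * w x"
        unfolding integral_mult_right_zero by simp
      finally have "norm (LINT t|lborel. K (t, \<tau>) * \<Theta> (x, t)) \<le> M * B * (LINT t|lborel. 1 / (1 + t\<^sup>2)) * w x" .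
      then have "norm (?R z) \<le> norm (G z) * (M * B * (LINT t|lborel. 1 / (1 + t\<^sup>2)) * w x)"
        unfolding norm_mult z fst_conv snd_conv by (intro mult_left_mono) auto
      also have "\<dots> = norm (of_real (M * B * (LINT t|lborel. 1 / (1 + t\<^sup>2))) * (of_real (w (fst z)) * G z))"
      proof -
        have "0 \<le> (LINT t|lborel. 1 / (1 + t\<^sup>2 :: real))" by (intro integral_nonneg_AE) (auto intro!: AE_I2)
        then show ?thesis using M B w(2)[of x] by (simp add: z norm_mult abs_mult)
      qed
      finally show "norm (?R z) \<le> norm (of_real (M * B * (LINT t|lborel. 1 / (1 + t\<^sup>2))) * (of_real (w (fst z)) * G z))" .
    qed
  qed
  have "(LINT z|lborel. ?L z) = (LINT x|lborel. LINT t|lborel. ?L (x, t))"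
    by (rule integral_lborel_pair(1)[OF L])
  also have "\<dots> = (LINT x|lborel. LINT \<tau>|lborel. ?R (x, \<tau>))"
  proof (rule integral_cong_AE)
    show "(\<lambda>x. LINT t|lborel. ?L (x, t)) \<in> borel_measurable lborel" "(\<lambda>x. LINT t|lborel. ?R (x, t)) \<in> borel_measurable lborel"
      using integral_lborel_pair(2)[OF L] integral_lborel_pair(2)[OF R] by (auto dest: borel_measurable_integrable)
    show "AE x in lborel. (LINT t|lborel. ?L (x, t)) = (LINT \<tau>|lborel. ?R (x, \<tau>))"
      using Gint
    proof eventually_elim
      case (elim x)
      show ?case
        using multiplication_formula[OF elim \<Theta>int[of x] K] by simp
    qed
  qed
  also have "\<dots> = (LINT z|lborel. ?R z)"
    by (rule integral_lborel_pair(1)[OF R, symmetric])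
  finally show "(LINT z|lborel. ?L z) = (LINT z|lborel. ?R z)" .
qed

lemma continuous_weight: "(\<lambda>x::real. 1 / (1 + x\<^sup>2)) \<in> borel_measurable borel" "0 < 1 / (1 + (x::real)\<^sup>2)"
  by (auto simp: add_pos_nonneg)

text \<open>Inverting the transform in \<tau> at fixed \<xi> gives an explicit density, up to null
  sets the one chosen inside \<open>bilin_mult\<close>. The weighted integrability makes the inner
  integral converge for almost every \<xi>.\<close>

lemma is_density_fourier_x:
  assumes G: "is_density (distr_fourier u) G"
    and int: "integrable lborel (\<lambda>z. of_real (1 / (1 + (fst z)\<^sup>2)) * G z)"
  shows "is_density (distr_fourier_x u) (\<lambda>z. of_real (1 / (2 * pi)) * (LINT \<tau>|lborel. cis (snd z * \<tau>) * G (fst z, \<tau>)))"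
  unfolding is_density_def
proof (intro conjI allI impI)
  have Gm[measurable]: "G \<in> borel_measurable borel" using G by (simp add: is_density_def)
  show "(\<lambda>z. of_real (1 / (2 * pi)) * (LINT \<tau>|lborel. cis (snd z * \<tau>) * G (fst z, \<tau>))) \<in> borel_measurable lborel"
    using borel_measurable_partial_kernel[OF Gm, of "\<lambda>z. cis (fst z * snd z)"]
    by (simp add: borel_measurable_cis borel_measurable_fst_snd borel_measurable_times)
  fix \<psi> assume \<psi>: "schwartz \<psi>"
  obtain B where B: "\<And>x t. norm (\<psi> (x, t)) \<le> B * (1 / (1 + x\<^sup>2)) * (1 / (1 + t\<^sup>2))"
    using schwartz_decay[OF \<psi>] by metis
  have "(\<lambda>z. cis (fst z * snd z)) \<in> borel_measurable borel" by measurable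
  note m = partial_multiplication_formula[OF Gm continuous_weight int schwartz_measurable[OF \<psi>] B this, of 1]
  from m(1) have "integrable lborel (\<lambda>z. of_real (1 / (2 * pi)) * ((LINT \<tau>|lborel. cis (snd z * \<tau>) * G (fst z, \<tau>)) * \<psi> z))"
    by (intro integrable_mult_right) simp
  then show "integrable lborel (\<lambda>z. of_real (1 / (2 * pi)) * (LINT \<tau>|lborel. cis (snd z * \<tau>) * G (fst z, \<tau>)) * \<psi> z)"
    by (simp only: mult.assoc)
  have K: "schwartz (\<lambda>z. of_real (1 / (2 * pi)) * ft 1 \<psi> z)"
    by (intro schwartz_cmult schwartz_ft \<psi>) simp
  have "distr_fourier_x u \<psi> = distr_fourier u (\<lambda>z. of_real (1 / (2 * pi)) * ft 1 \<psi> z)"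
    unfolding distr_fourier_x_def distr_fourier_def fourier_x_eq_fourier_ft[OF \<psi>] ..
  also have "\<dots> = (LINT z|lborel. G z * (of_real (1 / (2 * pi)) * ft 1 \<psi> z))"
    using G K by (simp add: is_density_def distr_of_def)
  also have "\<dots> = (LINT z|lborel. of_real (1 / (2 * pi)) * (G z * (LINT t|lborel. cis (t * snd z) * \<psi> (fst z, t))))"
    by (simp add: ft_def case_prod_beta' mult_ac)
  also have "\<dots> = of_real (1 / (2 * pi)) * (LINT z|lborel. G z * (LINT t|lborel. cis (t * snd z) * \<psi> (fst z, t)))"
    by (rule integral_mult_right_zero)
  also have "\<dots> = of_real (1 / (2 * pi)) * (LINT z|lborel. (LINT \<tau>|lborel. cis (snd z * \<tau>) * G (fst z, \<tau>)) * \<psi> z)"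
    using m(3) by simp
  also have "\<dots> = distr_of (\<lambda>z. of_real (1 / (2 * pi)) * (LINT \<tau>|lborel. cis (snd z * \<tau>) * G (fst z, \<tau>))) \<psi>"
    unfolding distr_of_def by (subst integral_mult_right_zero[symmetric]) (simp only: mult.assoc)
  finally show "distr_fourier_x u \<psi> = \<dots>" .
qed

section \<open>The multiplier convolution\<close>

lemma nn_integral_lborel_shift:
  fixes c :: "'a::euclidean_space"
  assumes [measurable]: "f \<in> borel_measurable borel"
  shows "(\<integral>\<^sup>+x. f (x - c) \<partial>lborel) = (\<integral>\<^sup>+x. f x \<partial>lborel)"
proof -
  have "(\<integral>\<^sup>+x. f x \<partial>lborel) = (\<integral>\<^sup>+x. f x \<partial>distr lborel borel ((+) (- c)))"
    by (simp add: lborel_distr_plus)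
  also have "\<dots> = (\<integral>\<^sup>+x. f (x - c) \<partial>lborel)"
    by (subst nn_integral_distr) auto
  finally show ?thesis by simp
qed

lemma integral_lborel_shift:
  fixes f :: "real \<Rightarrow> complex"
  shows "(LINT x|lborel. f (x - c)) = (LINT x|lborel. f x)"
  using lborel_integral_real_affine[of 1 f "- c"] by simp

text \<open>Carries an almost everywhere statement about the density of v over to the argument \<xi>
  - \<xi>1.\<close>

lemma AE_lborel_reflect:
  fixes P :: "real \<Rightarrow> bool"
  assumes "AE x in lborel. P x"
  shows "AE x in lborel. P (c - x)"
proof -
  obtain N where N: "N \<in> sets lborel" "emeasure lborel N = 0" "{x \<in> space lborel. \<not> P x} \<subseteq> N"
    using assms unfolding eventually_ae_filter by (auto simp: null_sets_def)
  have "(\<integral>\<^sup>+x. indicator N (c + (- 1) * x) \<partial>lborel) = (\<integral>\<^sup>+x. indicator N x \<partial>lborel)"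
    using N(1) by (subst (2) nn_integral_real_affine[of _ "-1" c]) auto
  also have "\<dots> = 0" using N by simp
  finally have "AE x in lborel. indicator N (c - x) = (0 :: ennreal)"
    using N(1) by (subst (asm) nn_integral_0_iff_AE) auto
  then show ?thesis
    by eventually_elim (use N(3) in \<open>auto simp: indicator_def split: if_splits\<close>)
qed

definition mconv :: "(real \<times> real \<Rightarrow> complex) \<Rightarrow> (real \<times> real \<Rightarrow> complex) \<Rightarrow>
    (real \<times> real \<Rightarrow> complex) \<Rightarrow> real \<times> real \<Rightarrow> complex" where
  "mconv m f g = (\<lambda>\<zeta>. LINT z|lborel. m (fst z, fst \<zeta> - fst z) * (f z * g (\<zeta> - z)))"

text \<open>Young's inequality for two integrable functions, as the multiplier is bounded by 1.
  Joint integrability, rather than integrability of the convolution alone, is what the interchanges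
  of integrals need.\<close>

lemma mconv_integrable_pair:
  fixes m f g :: "real \<times> real \<Rightarrow> complex"
  assumes [measurable]: "m \<in> borel_measurable borel" and bd: "\<And>p. norm (m p) \<le> 1"
    and f: "integrable lborel f" and g: "integrable lborel g"
  shows "integrable (lborel \<Otimes>\<^sub>M lborel) (\<lambda>(\<zeta>, z). m (fst z, fst \<zeta> - fst z) * (f z * g (\<zeta> - z)))"
    (is "integrable _ (case_prod ?F)")
proof (rule integrableI_bounded)
  note [measurable] = borel_measurable_integrable[OF f] borel_measurable_integrable[OF g]
  show meas[measurable]: "case_prod ?F \<in> borel_measurable (lborel \<Otimes>\<^sub>M lborel)" by measurable
  have "(\<integral>\<^sup>+p. norm (case_prod ?F p) \<partial>(lborel \<Otimes>\<^sub>M lborel)) = (\<integral>\<^sup>+z. \<integral>\<^sup>+\<zeta>. norm (?F \<zeta> z) \<partial>lborel \<partial>lborel)"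
    by (subst lborel_pair.nn_integral_snd[symmetric]) auto
  also have "\<dots> \<le> (\<integral>\<^sup>+z. \<integral>\<^sup>+\<zeta>. ennreal (norm (f z)) * ennreal (norm (g (\<zeta> - z))) \<partial>lborel \<partial>lborel)"
  proof (intro nn_integral_mono)
    fix z \<zeta>
    have "norm (?F \<zeta> z) \<le> 1 * norm (f z * g (\<zeta> - z))"
      unfolding norm_mult[of "m _"] by (intro mult_right_mono bd) auto
    then show "ennreal (norm (?F \<zeta> z)) \<le> ennreal (norm (f z)) * ennreal (norm (g (\<zeta> - z)))"
      by (simp add: norm_mult ennreal_mult[symmetric])
  qed
  also have "\<dots> = (\<integral>\<^sup>+z. ennreal (norm (f z)) * (\<integral>\<^sup>+\<zeta>. ennreal (norm (g \<zeta>)) \<partial>lborel) \<partial>lborel)"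
  proof (intro nn_integral_cong)
    fix z
    have "(\<integral>\<^sup>+\<zeta>. ennreal (norm (g (\<zeta> - z))) \<partial>lborel) = (\<integral>\<^sup>+\<zeta>. ennreal (norm (g \<zeta>)) \<partial>lborel)"
      by (rule nn_integral_lborel_shift[of "\<lambda>x. ennreal (norm (g x))"]) simp
    then show "(\<integral>\<^sup>+\<zeta>. ennreal (norm (f z)) * ennreal (norm (g (\<zeta> - z))) \<partial>lborel) =
        ennreal (norm (f z)) * (\<integral>\<^sup>+\<zeta>. ennreal (norm (g \<zeta>)) \<partial>lborel)"
      by (subst nn_integral_cmult) auto
  qed
  also have "\<dots> = (\<integral>\<^sup>+z. ennreal (norm (f z)) \<partial>lborel) * (\<integral>\<^sup>+\<zeta>. ennreal (norm (g \<zeta>)) \<partial>lborel)"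
    by (rule nn_integral_multc) simp
  also have "\<dots> < \<infinity>"
    using f g by (auto simp: integrable_iff_bounded ennreal_mult_less_top)
  finally show "(\<integral>\<^sup>+p. norm (case_prod ?F p) \<partial>(lborel \<Otimes>\<^sub>M lborel)) < \<infinity>" .
qed

lemma mconv_integrable:
  assumes "m \<in> borel_measurable borel" "\<And>p. norm (m p) \<le> 1" "integrable lborel f" "integrable lborel g"
  shows "integrable lborel (mconv m f g)"
  using lborel_pair.integrable_fst'[OF mconv_integrable_pair[OF assms]] by (simp add: mconv_def)

text \<open>The transform in \<tau> turns the convolution in \<tau> into a product and leaves
  \<open>m\<close> alone, which depends on the \<xi>-variables only. The exceptional null set of
  \<xi> is independent of t, because absolute convergence does not see the factor
  \<open>cis (t * \<tau>)\<close>.\<close>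

lemma mconv_fourier_2:
  assumes m[measurable]: "m \<in> borel_measurable borel" and bd: "\<And>p. norm (m p) \<le> 1"
    and f: "integrable lborel f" and g: "integrable lborel g"
  shows "AE \<xi> in lborel. \<forall>t. (LINT \<xi>1|lborel. m (\<xi>1, \<xi> - \<xi>1) *
      (LINT \<tau>|lborel. cis (t * \<tau>) * f (\<xi>1, \<tau>)) * (LINT \<tau>|lborel. cis (t * \<tau>) * g (\<xi> - \<xi>1, \<tau>))) =
    (LINT \<tau>|lborel. cis (t * \<tau>) * mconv m f g (\<xi>, \<tau>))"
proof -
  note [measurable] = borel_measurable_integrable[OF f] borel_measurable_integrable[OF g]
  define F where "F = (\<lambda>\<zeta> z. m (fst z, fst \<zeta> - fst z) * (f z * g (\<zeta> - z)))"
  have Fm[measurable]: "case_prod F \<in> borel_measurable (lborel \<Otimes>\<^sub>M lborel)"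
    unfolding F_def by measurable
  have Fm'[measurable]: "(\<lambda>(\<tau>, z). F (\<xi>, \<tau>) z) \<in> borel_measurable (lborel \<Otimes>\<^sub>M lborel)" for \<xi>
    unfolding F_def by measurable
  have Fint: "integrable (lborel \<Otimes>\<^sub>M lborel) (case_prod F)"
    unfolding F_def by (rule mconv_integrable_pair[OF assms])
  have "(\<integral>\<^sup>+\<xi>. \<integral>\<^sup>+\<tau>. \<integral>\<^sup>+z. norm (F (\<xi>, \<tau>) z) \<partial>lborel \<partial>lborel \<partial>lborel) =
      (\<integral>\<^sup>+\<zeta>. \<integral>\<^sup>+z. norm (F \<zeta> z) \<partial>lborel \<partial>(lborel \<Otimes>\<^sub>M lborel))"
    by (subst lborel.nn_integral_fst) (auto simp: lborel_prod)
  also have "\<dots> = (\<integral>\<^sup>+p. norm (case_prod F p) \<partial>(lborel \<Otimes>\<^sub>M lborel))"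
    unfolding lborel_prod[where 'a = real and 'b = real] by (subst lborel.nn_integral_fst[symmetric]) auto
  also have "\<dots> < \<infinity>" using Fint by (simp add: integrable_iff_bounded)
  finally have "AE \<xi> in lborel. (\<integral>\<^sup>+\<tau>. \<integral>\<^sup>+z. norm (F (\<xi>, \<tau>) z) \<partial>lborel \<partial>lborel) \<noteq> \<infinity>"
    by (intro nn_integral_noteq_infinite) (auto simp: F_def)
  then show ?thesis
  proof (eventually_elim, intro allI)
    fix \<xi> t
    assume fin: "(\<integral>\<^sup>+\<tau>. \<integral>\<^sup>+z. norm (F (\<xi>, \<tau>) z) \<partial>lborel \<partial>lborel) \<noteq> \<infinity>"
    have "integrable (lborel \<Otimes>\<^sub>M lborel) (\<lambda>(\<tau>, z). F (\<xi>, \<tau>) z)"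
    proof (rule integrableI_bounded)
      have "(\<integral>\<^sup>+p. norm (case p of (\<tau>, z) \<Rightarrow> F (\<xi>, \<tau>) z) \<partial>(lborel \<Otimes>\<^sub>M lborel)) =
          (\<integral>\<^sup>+\<tau>. \<integral>\<^sup>+z. norm (F (\<xi>, \<tau>) z) \<partial>lborel \<partial>lborel)"
        by (subst lborel.nn_integral_fst[symmetric]) auto
      then show "(\<integral>\<^sup>+p. norm (case p of (\<tau>, z) \<Rightarrow> F (\<xi>, \<tau>) z) \<partial>(lborel \<Otimes>\<^sub>M lborel)) < \<infinity>"
        using fin by (simp add: less_top)
    qed (rule Fm')
    then have int: "integrable (lborel \<Otimes>\<^sub>M lborel) (\<lambda>(\<tau>, z). cis (t * \<tau>) * F (\<xi>, \<tau>) z)"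
      by (rule Bochner_Integration.integrable_bound) (auto simp: norm_mult split_beta')
    have "(LINT \<tau>|lborel. cis (t * \<tau>) * mconv m f g (\<xi>, \<tau>)) = (LINT \<tau>|lborel. LINT z|lborel. cis (t * \<tau>) * F (\<xi>, \<tau>) z)"
      by (simp add: mconv_def F_def)
    also have "\<dots> = (LINT z|lborel. LINT \<tau>|lborel. cis (t * \<tau>) * F (\<xi>, \<tau>) z)"
      by (rule lborel_pair.Fubini_integral[OF int, symmetric])
    also have "\<dots> = (LINT \<xi>1|lborel. LINT \<tau>1|lborel. LINT \<tau>|lborel. cis (t * \<tau>) * F (\<xi>, \<tau>) (\<xi>1, \<tau>1))"
      by (rule integral_lborel_pair(1)) (rule lborel_pair.integrable_snd[OF int])
    also have "\<dots> = (LINT \<xi>1|lborel. m (\<xi>1, \<xi> - \<xi>1) *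
        (LINT \<tau>|lborel. cis (t * \<tau>) * f (\<xi>1, \<tau>)) * (LINT \<tau>|lborel. cis (t * \<tau>) * g (\<xi> - \<xi>1, \<tau>)))"
    proof (intro Bochner_Integration.integral_cong refl)
      fix \<xi>1
      have "(LINT \<tau>|lborel. cis (t * \<tau>) * F (\<xi>, \<tau>) (\<xi>1, \<tau>1)) =
          m (\<xi>1, \<xi> - \<xi>1) * (LINT \<tau>|lborel. cis (t * \<tau>) * g (\<xi> - \<xi>1, \<tau>)) * (cis (t * \<tau>1) * f (\<xi>1, \<tau>1))" for \<tau>1
      proof -
        have "(LINT \<tau>|lborel. cis (t * \<tau>) * F (\<xi>, \<tau>) (\<xi>1, \<tau>1)) =
            (LINT \<tau>|lborel. (m (\<xi>1, \<xi> - \<xi>1) * (cis (t * \<tau>1) * f (\<xi>1, \<tau>1))) * (cis (t * (\<tau> - \<tau>1)) * g (\<xi> - \<xi>1, \<tau> - \<tau>1)))"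
        proof (intro Bochner_Integration.integral_cong refl)
          fix \<tau>
          have "cis (t * \<tau>) = cis (t * \<tau>1) * cis (t * (\<tau> - \<tau>1))"
            by (simp add: cis_mult right_diff_distrib)
          then show "cis (t * \<tau>) * F (\<xi>, \<tau>) (\<xi>1, \<tau>1) =
              (m (\<xi>1, \<xi> - \<xi>1) * (cis (t * \<tau>1) * f (\<xi>1, \<tau>1))) * (cis (t * (\<tau> - \<tau>1)) * g (\<xi> - \<xi>1, \<tau> - \<tau>1))"
            by (simp add: F_def mult_ac)
        qed
        also have "\<dots> = (m (\<xi>1, \<xi> - \<xi>1) * (cis (t * \<tau>1) * f (\<xi>1, \<tau>1))) * (LINT \<tau>|lborel. cis (t * (\<tau> - \<tau>1)) * g (\<xi> - \<xi>1, \<tau> - \<tau>1))"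
          by (rule integral_mult_right_zero)
        also have "(LINT \<tau>|lborel. cis (t * (\<tau> - \<tau>1)) * g (\<xi> - \<xi>1, \<tau> - \<tau>1)) = (LINT \<tau>|lborel. cis (t * \<tau>) * g (\<xi> - \<xi>1, \<tau>))"
          by (rule integral_lborel_shift[of "\<lambda>\<tau>. cis (t * \<tau>) * g (\<xi> - \<xi>1, \<tau>)"])
        finally show ?thesis by (simp add: mult_ac)
      qed
      then show "(LINT \<tau>1|lborel. LINT \<tau>|lborel. cis (t * \<tau>) * F (\<xi>, \<tau>) (\<xi>1, \<tau>1)) =
          m (\<xi>1, \<xi> - \<xi>1) * (LINT \<tau>|lborel. cis (t * \<tau>) * f (\<xi>1, \<tau>)) * (LINT \<tau>|lborel. cis (t * \<tau>) * g (\<xi> - \<xi>1, \<tau>))"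
        by (simp only: integral_mult_right_zero) (simp add: mult_ac)
    qed
    finally show "(LINT \<xi>1|lborel. m (\<xi>1, \<xi> - \<xi>1) *
        (LINT \<tau>|lborel. cis (t * \<tau>) * f (\<xi>1, \<tau>)) * (LINT \<tau>|lborel. cis (t * \<tau>) * g (\<xi> - \<xi>1, \<tau>))) =
        (LINT \<tau>|lborel. cis (t * \<tau>) * mconv m f g (\<xi>, \<tau>))" ..
  qed
qed

text \<open>On |\<xi>| \<le> R the weight is bounded below by 1 / (1 + R^2).\<close>

lemma integrable_truncate:
  fixes G :: "real \<times> real \<Rightarrow> complex"
  assumes G: "G \<in> borel_measurable borel"
    and int: "integrable lborel (\<lambda>z. of_real (1 / (1 + (fst z)\<^sup>2)) * G z)"
  shows "integrable lborel (\<lambda>z. indicator {x. \<bar>x\<bar> \<le> R} (fst z) * G z)"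
proof (rule Bochner_Integration.integrable_bound[OF integrable_mult_right[OF int, of "of_real (1 + R\<^sup>2)"]])
  note [measurable] = G
  show "(\<lambda>z. indicator {x. \<bar>x\<bar> \<le> R} (fst z) * G z) \<in> borel_measurable lborel" by measurable
  show "AE z in lborel. norm (indicator {x. \<bar>x\<bar> \<le> R} (fst z) * G z) \<le>
      norm (of_real (1 + R\<^sup>2) * (of_real (1 / (1 + (fst z)\<^sup>2)) * G z))"
  proof (rule AE_I2)
    fix z :: "real \<times> real"
    have "indicator {x. \<bar>x\<bar> \<le> R} (fst z) \<le> (1 + R\<^sup>2) * (1 / (1 + (fst z)\<^sup>2))"
    proof (cases "\<bar>fst z\<bar> \<le> R")
      case True
      then have "(fst z)\<^sup>2 \<le> R\<^sup>2" by (simp add: abs_le_square_iff[symmetric])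
      then show ?thesis using True by (simp add: divide_simps add_pos_nonneg)
    qed (simp add: add_nonneg_nonneg)
    then have "indicator {x. \<bar>x\<bar> \<le> R} (fst z) * norm (G z) \<le> (1 + R\<^sup>2) * (1 / (1 + (fst z)\<^sup>2)) * norm (G z)"
      by (intro mult_right_mono) auto
    moreover have "norm (of_real (1 + R\<^sup>2) * (of_real (1 / (1 + (fst z)\<^sup>2)) * G z)) =
        (1 + R\<^sup>2) * (1 / (1 + (fst z)\<^sup>2)) * norm (G z)"
      unfolding norm_mult norm_of_real by (simp add: abs_of_pos add_pos_nonneg)
    moreover have "norm (indicator {x. \<bar>x\<bar> \<le> R} (fst z) * G z) = indicator {x. \<bar>x\<bar> \<le> R} (fst z) * norm (G z)"
      by (simp add: indicator_def)
    ultimately show "norm (indicator {x. \<bar>x\<bar> \<le> R} (fst z) * G z) \<le>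
        norm (of_real (1 + R\<^sup>2) * (of_real (1 / (1 + (fst z)\<^sup>2)) * G z))"
      by (simp only:)
  qed
qed

lemma mconv_truncate:
  assumes "\<And>a b. m (a, b) \<noteq> 0 \<Longrightarrow> \<bar>a\<bar> \<le> R \<and> \<bar>b\<bar> \<le> R"
  shows "mconv m (\<lambda>z. indicator {x. \<bar>x\<bar> \<le> R} (fst z) * f z) (\<lambda>z. indicator {x. \<bar>x\<bar> \<le> R} (fst z) * g z) = mconv m f g"
  unfolding mconv_def
proof (intro ext Bochner_Integration.integral_cong refl)
  fix \<zeta> z :: "real \<times> real"
  show "m (fst z, fst \<zeta> - fst z) * (indicator {x. \<bar>x\<bar> \<le> R} (fst z) * f z * (indicator {x. \<bar>x\<bar> \<le> R} (fst (\<zeta> - z)) * g (\<zeta> - z))) =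
      m (fst z, fst \<zeta> - fst z) * (f z * g (\<zeta> - z))"
    using assms[of "fst z" "fst \<zeta> - fst z"] by (cases "m (fst z, fst \<zeta> - fst z) = 0") auto
qed

text \<open>\<open>bilin_mult\<close> integrates products of densities that are fixed only up to
  null sets. Since m has bounded support, they may be replaced by inverse transforms of truncated,
  integrable functions, to which \<open>mconv_fourier_2\<close> applies. The factor
  \<open>1 / (4 * pi\<^sup>2)\<close> collects one \<open>1 / (2 * pi)\<close> each from u and
  v.\<close>

lemma bilin_integrand_eq:
  fixes u v :: distr
  assumes phi: "cutoff \<phi>"
    and G: "is_density (distr_fourier u) G" and K: "is_density (distr_fourier v) K"
    and Gint: "integrable lborel (\<lambda>z. of_real (1 / (1 + (fst z)\<^sup>2)) * G z)"
    and Kint: "integrable lborel (\<lambda>z. of_real (1 / (1 + (fst z)\<^sup>2)) * K z)"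
    and m: "m \<in> borel_measurable borel" "\<And>p. norm (m p) \<le> 1"
    and supp: "\<And>a b. m (a, b) \<noteq> 0 \<Longrightarrow> \<bar>a\<bar> \<le> R \<and> \<bar>b\<bar> \<le> R"
  defines "U \<equiv> density_of (distr_fourier_x u)" and "V \<equiv> density_of (distr_fourier_x v)"
  shows "integrable lborel (mconv m G K)"
    and "(\<lambda>(\<xi>, t). LINT \<xi>1|lborel. m (\<xi>1, \<xi> - \<xi>1) * U (\<xi>1, t) * V (\<xi> - \<xi>1, t)) \<in> borel_measurable borel"
    and "AE z in lborel. (case z of (\<xi>, t) \<Rightarrow> LINT \<xi>1|lborel. m (\<xi>1, \<xi> - \<xi>1) * U (\<xi>1, t) * V (\<xi> - \<xi>1, t)) =
      of_real (1 / (4 * pi\<^sup>2)) * (LINT \<tau>|lborel. cis (snd z * \<tau>) * mconv m G K (fst z, \<tau>))"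
proof -
  define f where "f = (\<lambda>z. indicator {x. \<bar>x\<bar> \<le> R} (fst z) * G z)"
  define g where "g = (\<lambda>z. indicator {x. \<bar>x\<bar> \<le> R} (fst z) * K z)"
  have Gm: "G \<in> borel_measurable borel" and Km: "K \<in> borel_measurable borel"
    using G K by (auto simp: is_density_def)
  have f: "integrable lborel f" and g: "integrable lborel g"
    unfolding f_def g_def by (intro integrable_truncate Gm Km Gint Kint)+
  have h: "mconv m f g = mconv m G K"
    unfolding f_def g_def by (rule mconv_truncate[OF supp])
  show hint: "integrable lborel (mconv m G K)"
    using mconv_integrable[OF m f g] by (simp add: h)
  define c where "c = complex_of_real (1 / (2 * pi))"
  define U0 where "U0 = (\<lambda>z. c * (LINT \<tau>|lborel. cis (snd z * \<tau>) * G (fst z, \<tau>)))"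
  define V0 where "V0 = (\<lambda>z. c * (LINT \<tau>|lborel. cis (snd z * \<tau>) * K (fst z, \<tau>)))"
  have U0: "is_density (distr_fourier_x u) U0" and V0: "is_density (distr_fourier_x v) V0"
    unfolding U0_def V0_def c_def by (intro is_density_fourier_x G K Gint Kint)+
  have UU: "AE z in lborel. U z = U0 z" and VV: "AE z in lborel. V z = V0 z"
    unfolding U_def V_def by (intro density_of_eq[OF phi] U0 V0)+
  have meas: "U \<in> borel_measurable borel" "V \<in> borel_measurable borel" "U0 \<in> borel_measurable borel" "V0 \<in> borel_measurable borel"
    using is_density_density_of[OF U0] is_density_density_of[OF V0] U0 V0 by (auto simp: U_def V_def is_density_def)
  note [measurable] = meas m(1)
  have Hm: "(\<lambda>z. LINT \<xi>1|lborel. m (\<xi>1, fst z - \<xi>1) * U (\<xi>1, snd z) * V (fst z - \<xi>1, snd z)) \<in> borel_measurable borel"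
    by measurable
  then show "(\<lambda>(\<xi>, t). LINT \<xi>1|lborel. m (\<xi>1, \<xi> - \<xi>1) * U (\<xi>1, t) * V (\<xi> - \<xi>1, t)) \<in> borel_measurable borel"
    by (simp add: case_prod_beta')
  \<comment> \<open>The densities are multiplied and integrated over \<xi>1 at fixed t, so equality
    almost everywhere in the plane is needed in the form: for almost every t, for almost every first
    variable.\<close>
  have swap: "AE t in lborel. AE x in lborel. P (x, t) = Q (x, t)"
    if "AE z in lborel. P z = Q z" and [measurable]: "P \<in> borel_measurable borel" "Q \<in> borel_measurable borel"
    for P Q :: "real \<times> real \<Rightarrow> complex"
  proof -
    have "AE z in lborel \<Otimes>\<^sub>M lborel. P z = Q z"
      using that(1) unfolding lborel_prod .
    then have "AE x in lborel. AE t in lborel. P (x, t) = Q (x, t)"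
      by (rule lborel_pair.AE_pair)
    then show ?thesis
      by (subst (asm) lborel_pair.AE_commute) measurable
  qed
  define E where "E = (\<lambda>z. LINT \<tau>|lborel. cis (snd z * \<tau>) * mconv m G K (fst z, \<tau>))"
  have Em: "E \<in> borel_measurable borel"
    unfolding E_def using borel_measurable_partial_kernel[of "mconv m G K" "\<lambda>z. cis (fst z * snd z)"] borel_measurable_integrable[OF hint]
    by (simp add: borel_measurable_cis borel_measurable_fst_snd borel_measurable_times)
  define H where "H = (\<lambda>z. LINT \<xi>1|lborel. m (\<xi>1, fst z - \<xi>1) * U (\<xi>1, snd z) * V (fst z - \<xi>1, snd z))"
  have Hm': "H \<in> borel_measurable borel" unfolding H_def by (rule Hm)
  have c2: "of_real (1 / (4 * pi\<^sup>2)) = c * c"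
    by (simp add: c_def power2_eq_square)
  have "AE t in lborel. AE \<xi> in lborel. H (\<xi>, t) = c * c * E (\<xi>, t)"
    using swap[OF UU meas(1,3)] swap[OF VV meas(2,4)]
  proof eventually_elim
    case (elim t)
    show ?case
      using mconv_fourier_2[OF m f g]
    proof eventually_elim
      fix \<xi>
      assume *: "\<forall>t. (LINT \<xi>1|lborel. m (\<xi>1, \<xi> - \<xi>1) *
        (LINT \<tau>|lborel. cis (t * \<tau>) * f (\<xi>1, \<tau>)) * (LINT \<tau>|lborel. cis (t * \<tau>) * g (\<xi> - \<xi>1, \<tau>))) =
        (LINT \<tau>|lborel. cis (t * \<tau>) * mconv m f g (\<xi>, \<tau>))"
      have "H (\<xi>, t) = (LINT \<xi>1|lborel. m (\<xi>1, \<xi> - \<xi>1) * U0 (\<xi>1, t) * V0 (\<xi> - \<xi>1, t))"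
        unfolding H_def fst_conv snd_conv
      proof (rule integral_cong_AE)
        show "AE \<xi>1 in lborel. m (\<xi>1, \<xi> - \<xi>1) * U (\<xi>1, t) * V (\<xi> - \<xi>1, t) = m (\<xi>1, \<xi> - \<xi>1) * U0 (\<xi>1, t) * V0 (\<xi> - \<xi>1, t)"
          using elim(1) AE_lborel_reflect[OF elim(2), of \<xi>] by eventually_elim simp
      qed measurable
      also have "\<dots> = (LINT \<xi>1|lborel. (c * c) * (m (\<xi>1, \<xi> - \<xi>1) *
        (LINT \<tau>|lborel. cis (t * \<tau>) * f (\<xi>1, \<tau>)) * (LINT \<tau>|lborel. cis (t * \<tau>) * g (\<xi> - \<xi>1, \<tau>))))"
      proof (intro Bochner_Integration.integral_cong refl)
        fix \<xi>1
        show "m (\<xi>1, \<xi> - \<xi>1) * U0 (\<xi>1, t) * V0 (\<xi> - \<xi>1, t) = (c * c) * (m (\<xi>1, \<xi> - \<xi>1) *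
          (LINT \<tau>|lborel. cis (t * \<tau>) * f (\<xi>1, \<tau>)) * (LINT \<tau>|lborel. cis (t * \<tau>) * g (\<xi> - \<xi>1, \<tau>)))"
        proof (cases "m (\<xi>1, \<xi> - \<xi>1) = 0")
          case False
          from supp[OF False] show ?thesis by (simp add: U0_def V0_def f_def g_def)
        qed simp
      qed
      also have "\<dots> = c * c * E (\<xi>, t)"
        using * by (simp only: integral_mult_right_zero) (simp add: E_def h)
      finally show "H (\<xi>, t) = c * c * E (\<xi>, t)" .
    qed
  qed
  \<comment> \<open>Measurability of the set of equality permits the way back from iterated null
    sets to a null set of the plane.\<close>
  moreover have set: "{z \<in> space (lborel \<Otimes>\<^sub>M lborel). H z = c * c * E z} \<in> sets (lborel \<Otimes>\<^sub>M lborel)"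
    using measurable_equality_set[of H "lborel \<Otimes>\<^sub>M lborel" "\<lambda>z. c * c * E z"] Hm' Em by (simp add: lborel_prod)
  ultimately have "AE \<xi> in lborel. AE t in lborel. H (\<xi>, t) = c * c * E (\<xi>, t)"
    by (subst lborel_pair.AE_commute) (simp_all only: prod.collapse)
  then have "AE z in lborel \<Otimes>\<^sub>M lborel. H z = c * c * E z"
    by (intro lborel_pair.AE_pair_measure set)
  then have "AE z in lborel. H z = c * c * E z" unfolding lborel_prod .
  then show "AE z in lborel. (case z of (\<xi>, t) \<Rightarrow> LINT \<xi>1|lborel. m (\<xi>1, \<xi> - \<xi>1) * U (\<xi>1, t) * V (\<xi> - \<xi>1, t)) =
      of_real (1 / (4 * pi\<^sup>2)) * (LINT \<tau>|lborel. cis (snd z * \<tau>) * mconv m G K (fst z, \<tau>))"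
    unfolding c2 by (simp add: H_def E_def case_prod_beta')
qed

text \<open>The sign of the exponent is the one arising when the cutoff is moved onto the test
  function; for an even \<phi> this is the usual Fourier transform.\<close>

definition cutoff_hat :: "(real \<Rightarrow> real) \<Rightarrow> real \<Rightarrow> complex" where
  "cutoff_hat \<phi> \<sigma> = (LINT t|lborel. cis (t * \<sigma>) * of_real (\<phi> t))"

lemma schwartz_cutoff_tensor:
  assumes "cutoff \<phi>"
  shows "schwartz (\<lambda>z. of_real (\<phi> (fst z) * \<phi> (snd z)))"
  using assms by (intro schwartz_tensor[of \<phi> \<phi> "5 / 4"] cutoff_outside[OF assms]) (auto simp: cutoff_def)

text \<open>As \<phi>(0) = 1, the transform of \<phi> is the slice at x = 0 of the partial transform
  of a tensor product. Thus the theory on the plane yields its integrability and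
  boundedness.\<close>

lemma cutoff_hat_eq_ft:
  assumes "cutoff \<phi>"
  shows "cutoff_hat \<phi> \<sigma> = ft 1 (\<lambda>z. of_real (\<phi> (fst z) * \<phi> (snd z))) (0, \<sigma>)"
  using cutoff_bounds(3)[OF assms, of 0] by (simp add: cutoff_hat_def ft_def)

lemma cutoff_hat_integrable:
  assumes "cutoff \<phi>"
  shows "integrable lborel (cutoff_hat \<phi>)"
proof -
  have "cutoff_hat \<phi> = (\<lambda>\<sigma>. ft 1 (\<lambda>z. of_real (\<phi> (fst z) * \<phi> (snd z))) (0, \<sigma>))"
    by (intro ext cutoff_hat_eq_ft assms)
  then show ?thesis
    using schwartz_integrable_snd[OF schwartz_ft[OF schwartz_cutoff_tensor[OF assms], of 1], of 0] by simp
qed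

lemma cutoff_hat_bounded:
  assumes "cutoff \<phi>"
  obtains M where "\<And>\<sigma>. norm (cutoff_hat \<phi> \<sigma>) \<le> M"
  using ft_bounded[OF schwartz_cutoff_tensor[OF assms], of 1] unfolding cutoff_hat_eq_ft[OF assms] by blast

lemma cutoff_integrable:
  assumes "cutoff \<phi>"
  shows "integrable lborel (\<lambda>t. complex_of_real (\<phi> t))"
  using schwartz_integrable_snd[OF schwartz_cutoff_tensor[OF assms], of 0] cutoff_bounds(3)[OF assms, of 0]
  by simp

text \<open>The factor \<open>1\<close> is the constant weight \<open>w\<close> in
  \<open>partial_multiplication_formula\<close>.\<close>

lemma schwartz_decay_snd:
  assumes "schwartz f"
  obtains B where "\<And>x t. norm (f (x, t)) \<le> B * 1 * (1 / (1 + t\<^sup>2))"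
proof -
  obtain B where B0: "0 \<le> B" and B: "\<And>x t. norm (f (x, t)) \<le> B * (1 / (1 + x\<^sup>2)) * (1 / (1 + t\<^sup>2))"
    using schwartz_decay[OF assms] by metis
  have "norm (f (x, t)) \<le> B * 1 * (1 / (1 + t\<^sup>2))" for x t
  proof (rule order_trans[OF B])
    show "B * (1 / (1 + x\<^sup>2)) * (1 / (1 + t\<^sup>2)) \<le> B * 1 * (1 / (1 + t\<^sup>2))"
      using B0 by (intro mult_mono mult_left_mono) (auto simp: divide_simps add_pos_nonneg)
  qed
  then show ?thesis using that by blast
qed

section \<open>The densities of the two bilinear operators\<close>

context
  fixes \<phi> :: "real \<Rightarrow> real" and u v :: distr and G K m :: "real \<times> real \<Rightarrow> complex" and R :: real
  assumes phi: "cutoff \<phi>"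
    and G: "is_density (distr_fourier u) G" and K: "is_density (distr_fourier v) K"
    and Gint: "integrable lborel (\<lambda>z. of_real (1 / (1 + (fst z)\<^sup>2)) * G z)"
    and Kint: "integrable lborel (\<lambda>z. of_real (1 / (1 + (fst z)\<^sup>2)) * K z)"
    and m: "m \<in> borel_measurable borel" "\<And>p. norm (m p) \<le> 1"
    and supp: "\<And>a b. m (a, b) \<noteq> 0 \<Longrightarrow> \<bar>a\<bar> \<le> R \<and> \<bar>b\<bar> \<le> R"
begin

private lemma hint: "integrable lborel (mconv m G K)"
  by (rule bilin_integrand_eq(1)[OF phi G K Gint Kint m supp])

private lemma hmeas: "mconv m G K \<in> borel_measurable borel"
  using borel_measurable_integrable[OF hint] by simp

text \<open>The test function enters only through its inverse transform \<Theta> in x, of which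
  measurability and decay in t are asked. This covers both \<open>fourier \<psi>\<close> and its
  product with the time cutoff.\<close>

lemma bilin_mult_eq:
  assumes F: "fourier_x_inv f = \<Theta>" "\<Theta> \<in> borel_measurable borel" "\<And>x t. norm (\<Theta> (x, t)) \<le> B * 1 * (1 / (1 + t\<^sup>2))"
  shows "bilin_mult (\<lambda>a b. m (a, b)) u v f =
    of_real (1 / (4 * pi\<^sup>2)) * (LINT z|lborel. mconv m G K z * (LINT t|lborel. cis (t * snd z) * \<Theta> (fst z, t)))"
proof -
  note bi = bilin_integrand_eq[OF phi G K Gint Kint m supp]
  define H where "H = (\<lambda>(\<xi>, t). LINT \<xi>1|lborel. m (\<xi>1, \<xi> - \<xi>1) * density_of (distr_fourier_x u) (\<xi>1, t) * density_of (distr_fourier_x v) (\<xi> - \<xi>1, t))"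
  have Hm: "H \<in> borel_measurable borel" unfolding H_def by (rule bi(2))
  define c where "c = complex_of_real (1 / (4 * pi\<^sup>2))"
  define E where "E = (\<lambda>z. LINT \<tau>|lborel. cis (snd z * \<tau>) * mconv m G K (fst z, \<tau>))"
  have ae: "AE z in lborel. H z = c * E z"
    using bi(3) unfolding H_def E_def c_def by simp
  have "integrable lborel (\<lambda>z. of_real 1 * mconv m G K z)" using hint by simp
  moreover have "(\<lambda>z. cis (fst z * snd z)) \<in> borel_measurable borel" by measurable
  ultimately have mult: "integrable lborel (\<lambda>z. E z * \<Theta> z)"
    "(LINT z|lborel. E z * \<Theta> z) = (LINT z|lborel. mconv m G K z * (LINT t|lborel. cis (t * snd z) * \<Theta> (fst z, t)))"
    using partial_multiplication_formula[OF hmeas, of "\<lambda>_. 1" \<Theta> B "\<lambda>z. cis (fst z * snd z)" 1] F(2,3)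
    by (simp_all add: E_def)
  have "bilin_mult (\<lambda>a b. m (a, b)) u v f = (LINT z|lborel. H z * \<Theta> z)"
    by (simp add: bilin_mult_def distr_fourier_x_inv_def distr_of_def F(1) H_def)
  also have "\<dots> = (LINT z|lborel. c * (E z * \<Theta> z))"
  proof (rule integral_cong_AE)
    show "(\<lambda>z. H z * \<Theta> z) \<in> borel_measurable lborel" using Hm F(2) by simp
    show "(\<lambda>z. c * (E z * \<Theta> z)) \<in> borel_measurable lborel"
      using borel_measurable_integrable[OF mult(1)] by (rule borel_measurable_times[OF borel_measurable_const])
    show "AE z in lborel. H z * \<Theta> z = c * (E z * \<Theta> z)"
      using ae by eventually_elim simp
  qed
  also have "\<dots> = c * (LINT z|lborel. E z * \<Theta> z)" by (rule integral_mult_right_zero)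
  finally show ?thesis unfolding mult(2) c_def .
qed

text \<open>Inversion in t contributes \<open>2 * pi\<close>, which leaves
  \<open>1 / (2 * pi)\<close> of the factor \<open>1 / (4 * pi\<^sup>2)\<close> in
  \<open>bilin_mult_eq\<close>.\<close>

lemma is_density_bilin:
  "is_density (distr_fourier (bilin_mult (\<lambda>a b. m (a, b)) u v)) (\<lambda>z. of_real (1 / (2 * pi)) * mconv m G K z)"
  unfolding is_density_def
proof (intro conjI allI impI)
  show "(\<lambda>z. of_real (1 / (2 * pi)) * mconv m G K z) \<in> borel_measurable lborel" using hmeas by simp
  fix \<psi> assume \<psi>: "schwartz \<psi>"
  obtain M where M: "\<And>z. norm (\<psi> z) \<le> M" using schwartz_bounded[OF \<psi>, of 0] by auto
  have M0: "0 \<le> M" using M[of 0] norm_ge_zero order_trans by blast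
  note [measurable] = hmeas schwartz_measurable[OF \<psi>]
  show "integrable lborel (\<lambda>z. of_real (1 / (2 * pi)) * mconv m G K z * \<psi> z)"
  proof (rule Bochner_Integration.integrable_bound)
    show "integrable lborel (\<lambda>z. of_real (M * (1 / (2 * pi))) * mconv m G K z)"
      by (intro integrable_mult_right hint)
    show "(\<lambda>z. of_real (1 / (2 * pi)) * mconv m G K z * \<psi> z) \<in> borel_measurable lborel" by measurable
    show "AE z in lborel. norm (of_real (1 / (2 * pi)) * mconv m G K z * \<psi> z) \<le> norm (of_real (M * (1 / (2 * pi))) * mconv m G K z)"
    proof (rule AE_I2)
      fix z
      have "norm (of_real (1 / (2 * pi)) * mconv m G K z) * norm (\<psi> z) \<le> norm (of_real (1 / (2 * pi)) * mconv m G K z) * M"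
        by (intro mult_left_mono M) auto
      then show "norm (of_real (1 / (2 * pi)) * mconv m G K z * \<psi> z) \<le> norm (of_real (M * (1 / (2 * pi))) * mconv m G K z)"
        using M0 by (simp add: norm_mult norm_divide abs_mult mult_ac)
    qed
  qed
  have f: "schwartz (ft (-1) \<psi>)" by (rule schwartz_ft[OF \<psi>]) simp
  obtain B where B: "\<And>x t. norm (ft (-1) \<psi> (x, t)) \<le> B * 1 * (1 / (1 + t\<^sup>2))"
    using schwartz_decay_snd[OF f] by metis
  have inv: "(LINT t|lborel. cis (t * snd z) * ft (-1) \<psi> (fst z, t)) = of_real (2 * pi) * \<psi> z" for z
    using fun_cong[OF ft_inversion[OF \<psi>, of 1], of z] by (cases z) (simp add: ft_def[of 1])
  have "distr_fourier (bilin_mult (\<lambda>a b. m (a, b)) u v) \<psi> =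
      of_real (1 / (4 * pi\<^sup>2)) * (LINT z|lborel. mconv m G K z * (of_real (2 * pi) * \<psi> z))"
    unfolding distr_fourier_def
    by (subst bilin_mult_eq[OF fourier_x_inv_fourier[OF \<psi>] schwartz_measurable[OF f] B]) (simp only: inv)
  also have "\<dots> = (LINT z|lborel. of_real (1 / (4 * pi\<^sup>2)) * (mconv m G K z * (of_real (2 * pi) * \<psi> z)))"
    by (rule integral_mult_right_zero[symmetric])
  also have "\<dots> = distr_of (\<lambda>z. of_real (1 / (2 * pi)) * mconv m G K z) \<psi>"
    unfolding distr_of_def by (intro Bochner_Integration.integral_cong refl) (simp add: power2_eq_square)
  finally show "distr_fourier (bilin_mult (\<lambda>a b. m (a, b)) u v) \<psi> = \<dots>" .
qed

text \<open>By duality the cutoff multiplies the test function, where it becomes a convolution with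
  \<open>cutoff_hat\<close> in \<tau>; the multiplication formula moves this convolution back onto
  the density.\<close>

lemma is_density_mult_time_bilin:
  "is_density (distr_fourier (mult_time \<phi> (bilin_mult (\<lambda>a b. m (a, b)) u v)))
    (\<lambda>z. of_real (1 / (4 * pi\<^sup>2)) * (LINT \<tau>|lborel. cutoff_hat \<phi> (\<tau> - snd z) * mconv m G K (fst z, \<tau>)))"
  unfolding is_density_def
proof (intro conjI allI impI)
  have ch: "cutoff_hat \<phi> \<in> borel_measurable borel"
    using borel_measurable_integrable[OF cutoff_hat_integrable[OF phi]] by simp
  obtain M where M: "\<And>\<sigma>. norm (cutoff_hat \<phi> \<sigma>) \<le> M" using cutoff_hat_bounded[OF phi] by metis
  have Km: "(\<lambda>z. cutoff_hat \<phi> (snd z - fst z)) \<in> borel_measurable borel" using ch by measurable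
  have one: "integrable lborel (\<lambda>z. of_real 1 * mconv m G K z)" using hint by simp
  show "(\<lambda>z. of_real (1 / (4 * pi\<^sup>2)) * (LINT \<tau>|lborel. cutoff_hat \<phi> (\<tau> - snd z) * mconv m G K (fst z, \<tau>))) \<in> borel_measurable lborel"
    using borel_measurable_partial_kernel[OF hmeas Km] by simp
  fix \<psi> assume \<psi>: "schwartz \<psi>"
  obtain B where B: "\<And>x t. norm (\<psi> (x, t)) \<le> B * 1 * (1 / (1 + t\<^sup>2))"
    using schwartz_decay_snd[OF \<psi>] by metis
  have mult: "integrable lborel (\<lambda>z. (LINT \<tau>|lborel. cutoff_hat \<phi> (\<tau> - snd z) * mconv m G K (fst z, \<tau>)) * \<psi> z)"
    "(LINT z|lborel. (LINT \<tau>|lborel. cutoff_hat \<phi> (\<tau> - snd z) * mconv m G K (fst z, \<tau>)) * \<psi> z) =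
      (LINT z|lborel. mconv m G K z * (LINT s|lborel. cutoff_hat \<phi> (snd z - s) * \<psi> (fst z, s)))"
    using partial_multiplication_formula[OF hmeas _ _ one schwartz_measurable[OF \<psi>] B Km M]
    by simp_all
  from integrable_mult_right[OF mult(1), of "of_real (1 / (4 * pi\<^sup>2))"]
  show "integrable lborel (\<lambda>z. of_real (1 / (4 * pi\<^sup>2)) * (LINT \<tau>|lborel. cutoff_hat \<phi> (\<tau> - snd z) * mconv m G K (fst z, \<tau>)) * \<psi> z)"
    by (simp only: mult.assoc)
  have f: "schwartz (ft (-1) \<psi>)" by (rule schwartz_ft[OF \<psi>]) simp
  obtain B' where B': "\<And>x t. norm (ft (-1) \<psi> (x, t)) \<le> B' * 1 * (1 / (1 + t\<^sup>2))"
    using schwartz_decay_snd[OF f] by metis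
  define \<Theta> where "\<Theta> = (\<lambda>(x, t). complex_of_real (\<phi> t) * ft (-1) \<psi> (x, t))"
  have "smooth_real \<phi>" using phi by (simp add: cutoff_def)
  note [measurable] = borel_measurable_continuous_onI[OF smooth_real_continuous[OF this]]
  have "(\<lambda>z. complex_of_real (\<phi> (snd z)) * ft (-1) \<psi> z) \<in> borel_measurable borel"
    using schwartz_measurable[OF f] by measurable
  then have \<Theta>m: "\<Theta> \<in> borel_measurable borel" by (simp add: \<Theta>_def case_prod_beta')
  have \<Theta>b: "norm (\<Theta> (x, t)) \<le> B' * 1 * (1 / (1 + t\<^sup>2))" for x t
  proof -
    have "norm (\<Theta> (x, t)) = \<phi> t * norm (ft (-1) \<psi> (x, t))"
      using cutoff_bounds(1)[OF phi, of t] by (simp add: \<Theta>_def norm_mult)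
    also have "\<dots> \<le> 1 * norm (ft (-1) \<psi> (x, t))"
      using cutoff_bounds(2)[OF phi, of t] by (intro mult_right_mono) auto
    finally show ?thesis using B'[of x t] by linarith
  qed
  have inner: "(LINT t|lborel. cis (t * \<tau>) * \<Theta> (x, t)) = (LINT s|lborel. cutoff_hat \<phi> (\<tau> - s) * \<psi> (x, s))" for x \<tau>
  proof -
    have "(LINT t|lborel. cis (t * \<tau>) * \<Theta> (x, t)) =
        (LINT t|lborel. (LINT s|lborel. cis (- (fst (t, s) * snd (t, s))) * \<psi> (x, s)) * (cis (t * \<tau>) * complex_of_real (\<phi> t)))"
      by (simp add: \<Theta>_def ft_def mult_ac)
    also have "\<dots> = (LINT s|lborel. \<psi> (x, s) * (LINT t|lborel. cis (- (fst (t, s) * snd (t, s))) * (cis (t * \<tau>) * complex_of_real (\<phi> t))))"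
      by (rule multiplication_formula[where M = 1])
        (auto intro: schwartz_integrable_snd[OF \<psi>] integrable_cis_mult cutoff_integrable[OF phi])
    also have "\<dots> = (LINT s|lborel. \<psi> (x, s) * cutoff_hat \<phi> (\<tau> - s))"
      by (simp add: cutoff_hat_def mult.assoc[symmetric] cis_mult right_diff_distrib)
    finally show ?thesis by (simp add: mult.commute)
  qed
  have "distr_fourier (mult_time \<phi> (bilin_mult (\<lambda>a b. m (a, b)) u v)) \<psi> =
      bilin_mult (\<lambda>a b. m (a, b)) u v (\<lambda>(x, t). of_real (\<phi> t) * fourier \<psi> (x, t))"
    by (simp add: distr_fourier_def mult_time_def)
  also have "\<dots> = of_real (1 / (4 * pi\<^sup>2)) * (LINT z|lborel. mconv m G K z * (LINT t|lborel. cis (t * snd z) * \<Theta> (fst z, t)))"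
    by (rule bilin_mult_eq[OF _ \<Theta>m \<Theta>b]) (simp add: \<Theta>_def fourier_x_inv_mult_fourier[OF \<psi>])
  also have "\<dots> = of_real (1 / (4 * pi\<^sup>2)) * (LINT z|lborel. (LINT \<tau>|lborel. cutoff_hat \<phi> (\<tau> - snd z) * mconv m G K (fst z, \<tau>)) * \<psi> z)"
    unfolding inner mult(2) ..
  also have "\<dots> = (LINT z|lborel. of_real (1 / (4 * pi\<^sup>2)) * ((LINT \<tau>|lborel. cutoff_hat \<phi> (\<tau> - snd z) * mconv m G K (fst z, \<tau>)) * \<psi> z))"
    by (rule integral_mult_right_zero[symmetric])
  also have "\<dots> = distr_of (\<lambda>z. of_real (1 / (4 * pi\<^sup>2)) * (LINT \<tau>|lborel. cutoff_hat \<phi> (\<tau> - snd z) * mconv m G K (fst z, \<tau>))) \<psi>"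
    unfolding distr_of_def by (simp only: mult.assoc)
  finally show "distr_fourier (mult_time \<phi> (bilin_mult (\<lambda>a b. m (a, b)) u v)) \<psi> = \<dots>" .
qed

end

section \<open>Estimates\<close>

lemma bracket_ge: "1 \<le> bracket a" "\<bar>a\<bar> \<le> bracket a"
proof -
  have "bracket a = sqrt (1 + a\<^sup>2)"
    by (simp add: bracket_def powr_half_sqrt add_nonneg_nonneg)
  then show "1 \<le> bracket a" "\<bar>a\<bar> \<le> bracket a"
    by (auto intro: real_le_rsqrt)
qed

lemma bracket_pos: "0 < bracket a"
  using bracket_ge(1)[of a] by linarith

lemma bracket_minus [simp]: "bracket (- a) = bracket a"
  by (simp add: bracket_def)

lemma borel_measurable_bracket [measurable]: "bracket \<in> borel_measurable borel"
  unfolding bracket_def[abs_def] by measurable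

lemma nn_integral_powr_tail:
  assumes "1 < \<beta>"
  shows "(\<integral>\<^sup>+x. ennreal (x powr (- \<beta>)) * indicator {1..} x \<partial>lborel) < \<infinity>"
proof -
  have "(\<integral>\<^sup>+x. ennreal (x powr (- \<beta>)) * indicator {1..} x \<partial>lborel) = 0 - 1 powr (1 - \<beta>) / (1 - \<beta>)"
  proof (rule nn_integral_FTC_atLeast[where F = "\<lambda>x. x powr (1 - \<beta>) / (1 - \<beta>)" and T = 0])
    show "((\<lambda>x. x powr (1 - \<beta>) / (1 - \<beta>)) has_real_derivative x powr (- \<beta>)) (at x)" if "1 \<le> x" for x
      using that assms by (auto intro!: derivative_eq_intros)
    show "((\<lambda>x. x powr (1 - \<beta>) / (1 - \<beta>)) \<longlongrightarrow> 0) at_top"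
      using assms by (intro tendsto_divide_zero tendsto_neg_powr filterlim_ident) simp
  qed auto
  then show ?thesis by simp
qed

text \<open>Used with \<open>b * r\<close> for \<beta>: this is where the assumption b > 1/r becomes
  effective.\<close>

lemma nn_integral_bracket_finite:
  assumes "1 < \<beta>"
  shows "(\<integral>\<^sup>+x. ennreal (bracket x powr (- \<beta>)) \<partial>lborel) < \<infinity>"
proof -
  define T where "T = (\<lambda>x. ennreal (x powr (- \<beta>)) * indicator {1..} x)"
  have [measurable]: "T \<in> borel_measurable borel" unfolding T_def by measurable
  have "(\<integral>\<^sup>+x. ennreal (bracket x powr (- \<beta>)) \<partial>lborel) \<le>
      (\<integral>\<^sup>+x. indicator {-1..1} x + (T x + T (0 + (-1) * x)) \<partial>lborel)"
  proof (intro nn_integral_mono)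
    fix x :: real
    have b1: "bracket x powr (- \<beta>) \<le> 1"
      using bracket_ge(1)[of x] assms powr_mono[of "- \<beta>" 0 "bracket x"] by simp
    have b2: "bracket x powr (- \<beta>) \<le> \<bar>x\<bar> powr (- \<beta>)" if "x \<noteq> 0"
      using that bracket_ge(2)[of x] assms by (intro powr_mono2') auto
    consider "\<bar>x\<bar> \<le> 1" | "1 < x" | "x < - 1" by linarith
    then show "ennreal (bracket x powr (- \<beta>)) \<le> indicator {-1..1} x + (T x + T (0 + (-1) * x))"
    proof cases
      case 1
      have "ennreal (bracket x powr (- \<beta>)) \<le> 1" using b1 by simp
      from add_mono[OF this zero_le[of "T x + T (0 + (-1) * x)"]] show ?thesis
        using 1 by (simp add: abs_le_iff)
    next
      case 2
      then show ?thesis using b2 by (auto simp: T_def indicator_def intro!: ennreal_leI)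
    next
      case 3
      then show ?thesis using b2 by (auto simp: T_def indicator_def intro!: ennreal_leI)
    qed
  qed
  also have "\<dots> = (\<integral>\<^sup>+x. indicator {-1..1::real} x \<partial>lborel) + ((\<integral>\<^sup>+x. T x \<partial>lborel) + (\<integral>\<^sup>+x. T (0 + (-1) * x) \<partial>lborel))"
    by (subst nn_integral_add, measurable, subst nn_integral_add, measurable)
  also have "(\<integral>\<^sup>+x. T (0 + (-1) * x) \<partial>lborel) = (\<integral>\<^sup>+x. T x \<partial>lborel)"
    using nn_integral_real_affine[of T "-1" 0] by simp
  also have "(\<integral>\<^sup>+x. indicator {-1..1::real} x \<partial>lborel) + ((\<integral>\<^sup>+x. T x \<partial>lborel) + (\<integral>\<^sup>+x. T x \<partial>lborel)) < \<infinity>"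
    using nn_integral_powr_tail[OF assms] by (simp add: T_def)
  finally show ?thesis .
qed

section \<open>Hoelder's inequality and the phase integral\<close>

text \<open>A form for p-th powers in which \<open>g\<close> is a kernel of controlled size
  \<open>S\<close> and \<open>f\<close> carries the functions to be estimated. The right-hand side
  may be infinite, and \<open>x\<close> is only assumed to be dominated by the integral of
  \<open>f * g\<close>, so no integrability has to be established first. The proof applies Young's
  inequality to normalised functions.\<close>

lemma hoelder_bound:
  fixes f g :: "'a \<Rightarrow> real"
  assumes r: "1 < r" and p: "1 < p" and rp: "1 / r + 1 / p = 1"
    and f[measurable]: "f \<in> borel_measurable M" and f0: "\<And>z. 0 \<le> f z"
    and g[measurable]: "g \<in> borel_measurable M" and g0: "\<And>z. 0 \<le> g z"
    and S: "0 < S" "(\<integral>\<^sup>+z. ennreal (g z powr r) \<partial>M) \<le> ennreal S"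
    and x: "0 \<le> x" "ennreal x \<le> (\<integral>\<^sup>+z. ennreal (f z * g z) \<partial>M)"
  shows "ennreal (x powr p) \<le> ennreal (S powr (p / r)) * (\<integral>\<^sup>+z. ennreal (f z powr p) \<partial>M)"
proof -
  define J where "J = (\<integral>\<^sup>+z. ennreal (f z powr p) \<partial>M)"
  consider "J = \<infinity>" | "J = 0" | j where "J = ennreal j" "0 < j"
    by (cases J) (auto simp: less_le)
  then show ?thesis
  proof cases
    case 1
    then show ?thesis using S(1) by (simp add: J_def ennreal_mult_top)
  next
    case 2
    then have "AE z in M. ennreal (f z powr p) = 0"
      unfolding J_def by (subst (asm) nn_integral_0_iff_AE) auto
    then have "AE z in M. ennreal (f z * g z) = 0"
      by eventually_elim (use f0 in \<open>auto simp: ennreal_eq_0_iff\<close>)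
    then have "(\<integral>\<^sup>+z. ennreal (f z * g z) \<partial>M) = 0"
      by (subst nn_integral_0_iff_AE) auto
    then have "x = 0" using x by (simp add: ennreal_eq_0_iff)
    then show ?thesis by simp
  next
    case (3 j)
    \<comment> \<open>The bound that Hoelder's inequality should give. With this normalisation the
      two terms from Young's inequality sum to at most c (1/r + 1/p) = c.\<close>
    define c where "c = j powr (1 / p) * S powr (1 / r)"
    have c: "0 < c" using 3 S by (simp add: c_def)
    have "(\<integral>\<^sup>+z. ennreal (f z * g z) \<partial>M) \<le> (\<integral>\<^sup>+z. ennreal (c / (p * j)) * ennreal (f z powr p) + ennreal (c / (r * S)) * ennreal (g z powr r) \<partial>M)"
    proof (intro nn_integral_mono)
      fix z
      have "(f z / j powr (1 / p)) * (g z / S powr (1 / r)) \<le>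
          (f z / j powr (1 / p)) powr p / p + (g z / S powr (1 / r)) powr r / r"
        using f0[of z] g0[of z] rp by (intro Youngs_inequality p r) auto
      also have "(f z / j powr (1 / p)) powr p = f z powr p / j"
        using f0[of z] 3 p by (simp add: powr_divide powr_powr)
      also have "(g z / S powr (1 / r)) powr r = g z powr r / S"
        using g0[of z] S r by (simp add: powr_divide powr_powr)
      finally have "c * ((f z / j powr (1 / p)) * (g z / S powr (1 / r))) \<le> c * (f z powr p / j / p + g z powr r / S / r)"
        using c by (intro mult_left_mono) auto
      moreover have "c * ((f z / j powr (1 / p)) * (g z / S powr (1 / r))) = f z * g z"
        using 3 S by (simp add: c_def)
      moreover have "c * (f z powr p / j / p + g z powr r / S / r) = c / (p * j) * f z powr p + c / (r * S) * g z powr r"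
        by (simp add: distrib_left mult_ac)
      ultimately show "ennreal (f z * g z) \<le> ennreal (c / (p * j)) * ennreal (f z powr p) + ennreal (c / (r * S)) * ennreal (g z powr r)"
        using c 3 S r p by (simp add: ennreal_mult[symmetric] ennreal_plus[symmetric] ennreal_leI del: ennreal_plus)
    qed
    also have "\<dots> = ennreal (c / (p * j)) * J + ennreal (c / (r * S)) * (\<integral>\<^sup>+z. ennreal (g z powr r) \<partial>M)"
      unfolding J_def by (subst nn_integral_add) (auto simp: nn_integral_cmult)
    also have "\<dots> \<le> ennreal (c / (p * j)) * ennreal j + ennreal (c / (r * S)) * ennreal S"
      using 3 S by (intro add_mono mult_left_mono) auto
    also have "\<dots> = ennreal (c / (p * j) * j + c / (r * S) * S)"
      using c 3 S r p by (simp add: ennreal_mult[symmetric] ennreal_plus[symmetric] del: ennreal_plus)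
    also have "c / (p * j) * j + c / (r * S) * S = c * (1 / r + 1 / p)"
      using 3 S p r by (simp add: field_simps)
    finally have "ennreal x \<le> ennreal c" using x(2) rp by (metis mult.right_neutral order_trans)
    then have "x \<le> c" using c by (simp add: ennreal_le_iff)
    then have "x powr p \<le> c powr p" using x p by (intro powr_mono2) auto
    also have "c powr p = S powr (p / r) * j"
      using 3 S p by (simp add: c_def powr_mult powr_powr)
    finally show ?thesis
      using 3 S unfolding J_def[symmetric] by (simp add: ennreal_mult[symmetric] ennreal_leI)
  qed
qed

text \<open>Where the derivative of P is at least \<kappa>, the integral over x is at most
  1/\<kappa> times the integral over the values of P; enlarging the range of values to the whole
  line only increases the latter.\<close>

lemma nn_integral_substitution_le:
  fixes w P P' :: "real \<Rightarrow> real"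
  assumes w[measurable]: "w \<in> borel_measurable borel" and w0: "\<And>x. 0 \<le> w x"
    and P: "\<And>x. (P has_real_derivative P' x) (at x)" and cont: "continuous_on UNIV P'"
    and lam: "0 < \<kappa>" "\<And>x. x \<in> {c..d} \<Longrightarrow> \<kappa> \<le> P' x"
  shows "ennreal \<kappa> * (\<integral>\<^sup>+x. ennreal (w (P x)) * indicator {c..d} x \<partial>lborel) \<le> (\<integral>\<^sup>+x. ennreal (w x) \<partial>lborel)"
proof (cases "c \<le> d")
  case True
  have [measurable]: "P \<in> borel_measurable borel"
    using P by (intro borel_measurable_continuous_onI) (auto intro!: continuous_at_imp_continuous_on DERIV_isCont)
  have [measurable]: "P' \<in> borel_measurable borel"
    by (intro borel_measurable_continuous_onI cont)
  have "ennreal \<kappa> * (\<integral>\<^sup>+x. ennreal (w (P x)) * indicator {c..d} x \<partial>lborel) =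
      (\<integral>\<^sup>+x. ennreal \<kappa> * (ennreal (w (P x)) * indicator {c..d} x) \<partial>lborel)"
    by (subst nn_integral_cmult) auto
  also have "\<dots> \<le> (\<integral>\<^sup>+x. ennreal (w (P x) * P' x * indicator {c..d} x) \<partial>lborel)"
  proof (intro nn_integral_mono)
    fix x
    show "ennreal \<kappa> * (ennreal (w (P x)) * indicator {c..d} x) \<le> ennreal (w (P x) * P' x * indicator {c..d} x)"
    proof (cases "x \<in> {c..d}")
      case True
      then have "\<kappa> * w (P x) \<le> w (P x) * P' x" 
        using mult_right_mono[OF lam(2) w0[of "P x"]] by (simp add: mult.commute)
      then show ?thesis using True lam(1) w0 by (simp add: ennreal_mult[symmetric] ennreal_leI)
    qed simp
  qed
  also have "\<dots> = (\<integral>\<^sup>+x. ennreal (w x * indicator {P c..P d} x) \<partial>lborel)"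
    using True lam P by (intro nn_integral_substitution[symmetric])
      (auto intro: continuous_on_subset[OF cont] order_trans[OF less_imp_le] simp: set_borel_measurable_def)
  also have "\<dots> \<le> (\<integral>\<^sup>+x. ennreal (w x) \<partial>lborel)"
    using w0 by (intro nn_integral_mono ennreal_leI) (auto simp: indicator_def)
  finally show ?thesis .
qed simp

text \<open>The phase $x^3 + (\xi - x)^3$ has derivative $3 \xi (2 x - \xi)$, of constant sign on either side of $\xi / 2$.\<close>

lemma nn_integral_phase_le:
  fixes w :: "real \<Rightarrow> real"
  assumes w[measurable]: "w \<in> borel_measurable borel" and w0: "\<And>x. 0 \<le> w x" and even: "\<And>x. w (- x) = w x"
    and mu: "0 < \<mu>1" "0 < \<mu>2" and xi: "\<mu>1 \<le> \<bar>\<xi>\<bar>"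
  shows "ennreal (3 * \<mu>1 * \<mu>2) * (\<integral>\<^sup>+x. ennreal (w (a - x ^ 3 - (\<xi> - x) ^ 3)) * indicator {x. \<mu>2 \<le> \<bar>2 * x - \<xi>\<bar> \<and> \<bar>x\<bar> \<le> R} x \<partial>lborel)
    \<le> 2 * (\<integral>\<^sup>+x. ennreal (w x) \<partial>lborel)"
proof -
  define P where "P = (\<lambda>x. x ^ 3 + (\<xi> - x) ^ 3 - a)"
  \<comment> \<open>The sign for which \<open>e * P\<close> increases to the right of \<xi>/2 and
    \<open>- e * P\<close> to its left. Evenness of \<open>w\<close> lets the sign be inserted, and
    the bound R keeps both intervals compact, as the substitution requires.\<close>
  define e where "e = sgn \<xi>"
  have e: "e = 1 \<or> e = -1" "e * \<xi> = \<bar>\<xi>\<bar>" using xi mu by (auto simp: e_def sgn_if)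
  have wP: "w (a - x ^ 3 - (\<xi> - x) ^ 3) = w (s * P x)" if "s = 1 \<or> s = -1" for s x
    using that even[of "P x"] by (auto simp: P_def algebra_simps)
  have dP: "((\<lambda>x. s * P x) has_real_derivative s * (3 * \<xi> * (2 * x - \<xi>))) (at x)" for s x
    unfolding P_def by (auto intro!: derivative_eq_intros simp: power2_eq_square algebra_simps)
  have cont: "continuous_on UNIV (\<lambda>x. s * (3 * \<xi> * (2 * x - \<xi>)))" for s
    by (intro continuous_intros)
  have main: "ennreal (3 * \<mu>1 * \<mu>2) * (\<integral>\<^sup>+x. ennreal (w (a - x ^ 3 - (\<xi> - x) ^ 3)) * indicator {c..d} x \<partial>lborel)
      \<le> (\<integral>\<^sup>+x. ennreal (w x) \<partial>lborel)"
    if s: "s = 1 \<or> s = -1" and sd: "\<And>x. x \<in> {c..d} \<Longrightarrow> 3 * \<mu>1 * \<mu>2 \<le> s * (3 * \<xi> * (2 * x - \<xi>))" for s c d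
    unfolding wP[OF s] using mu by (intro nn_integral_substitution_le[OF w w0 dP cont] sd) auto
  have 1: "3 * \<mu>1 * \<mu>2 \<le> e * (3 * \<xi> * (2 * x - \<xi>))" if "x \<in> {(\<xi> + \<mu>2) / 2..R}" for x
  proof -
    have "\<mu>1 * \<mu>2 \<le> \<bar>\<xi>\<bar> * (2 * x - \<xi>)" using that mu xi by (intro mult_mono) (auto simp: field_simps)
    then show ?thesis unfolding e(2)[symmetric] by (simp add: algebra_simps)
  qed
  have 2: "3 * \<mu>1 * \<mu>2 \<le> (- e) * (3 * \<xi> * (2 * x - \<xi>))" if "x \<in> {- R..(\<xi> - \<mu>2) / 2}" for x
  proof -
    have "\<mu>1 * \<mu>2 \<le> \<bar>\<xi>\<bar> * (\<xi> - 2 * x)" using that mu xi by (intro mult_mono) (auto simp: field_simps)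
    then show ?thesis unfolding e(2)[symmetric] by (simp add: algebra_simps)
  qed
  have me: "- e = 1 \<or> - e = - 1" using e(1) by auto
  let ?w = "\<lambda>x. ennreal (w (a - x ^ 3 - (\<xi> - x) ^ 3))"
  have "(\<integral>\<^sup>+x. ?w x * indicator {x. \<mu>2 \<le> \<bar>2 * x - \<xi>\<bar> \<and> \<bar>x\<bar> \<le> R} x \<partial>lborel) \<le>
      (\<integral>\<^sup>+x. ?w x * indicator {(\<xi> + \<mu>2) / 2..R} x + ?w x * indicator {- R..(\<xi> - \<mu>2) / 2} x \<partial>lborel)"
  proof (intro nn_integral_mono)
    fix x
    have "\<mu>2 \<le> \<bar>2 * x - \<xi>\<bar> \<and> \<bar>x\<bar> \<le> R \<Longrightarrow> x \<in> {(\<xi> + \<mu>2) / 2..R} \<or> x \<in> {- R..(\<xi> - \<mu>2) / 2}"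
      by (auto simp: abs_le_iff field_simps abs_if split: if_splits)
    then show "?w x * indicator {x. \<mu>2 \<le> \<bar>2 * x - \<xi>\<bar> \<and> \<bar>x\<bar> \<le> R} x \<le>
        ?w x * indicator {(\<xi> + \<mu>2) / 2..R} x + ?w x * indicator {- R..(\<xi> - \<mu>2) / 2} x"
      by (auto simp: indicator_def)
  qed
  also have "\<dots> = (\<integral>\<^sup>+x. ?w x * indicator {(\<xi> + \<mu>2) / 2..R} x \<partial>lborel) + (\<integral>\<^sup>+x. ?w x * indicator {- R..(\<xi> - \<mu>2) / 2} x \<partial>lborel)"
    by (rule nn_integral_add) auto
  finally have "ennreal (3 * \<mu>1 * \<mu>2) * (\<integral>\<^sup>+x. ?w x * indicator {x. \<mu>2 \<le> \<bar>2 * x - \<xi>\<bar> \<and> \<bar>x\<bar> \<le> R} x \<partial>lborel) \<le>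
     ennreal (3 * \<mu>1 * \<mu>2) * (\<integral>\<^sup>+x. ?w x * indicator {(\<xi> + \<mu>2) / 2..R} x \<partial>lborel) +
     ennreal (3 * \<mu>1 * \<mu>2) * (\<integral>\<^sup>+x. ?w x * indicator {- R..(\<xi> - \<mu>2) / 2} x \<partial>lborel)"
    by (simp add: distrib_left[symmetric] mult_left_mono)
  also have "\<dots> \<le> (\<integral>\<^sup>+x. ennreal (w x) \<partial>lborel) + (\<integral>\<^sup>+x. ennreal (w x) \<partial>lborel)"
    using main[of e "(\<xi> + \<mu>2) / 2" R, OF e(1) 1] main[of "- e" "- R" "(\<xi> - \<mu>2) / 2", OF me 2]
    by (rule add_mono)
  finally show ?thesis unfolding mult_2 .
qed

definition modulation_norm :: "real \<Rightarrow> (real \<times> real \<Rightarrow> complex) \<Rightarrow> real \<times> real \<Rightarrow> real" where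
  "modulation_norm b G z = bracket (snd z - fst z ^ 3) powr b * norm (G z)"

lemma modulation_norm_nonneg: "0 \<le> modulation_norm b G z"
  by (simp add: modulation_norm_def)

lemma borel_measurable_modulation_norm [measurable]:
  "G \<in> borel_measurable borel \<Longrightarrow> modulation_norm b G \<in> borel_measurable borel"
  unfolding modulation_norm_def[abs_def] by measurable

lemma nn_integral_lborel_pair:
  fixes f :: "'a::euclidean_space \<times> 'b::euclidean_space \<Rightarrow> ennreal"
  assumes "f \<in> borel_measurable borel"
  shows "(\<integral>\<^sup>+z. f z \<partial>lborel) = (\<integral>\<^sup>+x. \<integral>\<^sup>+y. f (x, y) \<partial>lborel \<partial>lborel)"
  using lborel.nn_integral_fst[of f lborel] assms by (simp add: lborel_prod)

text \<open>With \<xi> = x + y and 2 x - \<xi> = x - y, the conditions on \<open>D\<close> bound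
  both factors of the derivative of the phase from below. They are symmetric in the two
  combinations, so one lemma covers both multipliers with the roles of \<mu>1 and \<mu>2 exchanged.
  Each of the two integrations contributes a \<open>W\<close>, and the two monotone branches of the
  phase the factor 2.\<close>

lemma nn_integral_kernel_le:
  assumes br: "1 < b * r" and r: "0 < r"
    and W: "0 < W" "(\<integral>\<^sup>+x. ennreal (bracket x powr (- (b * r))) \<partial>lborel) \<le> ennreal W"
    and mu: "0 < \<mu>1" "0 < \<mu>2"
    and D: "D \<in> sets borel" "\<And>x y. (x, y) \<in> D \<Longrightarrow> \<mu>1 \<le> \<bar>x + y\<bar> \<and> \<mu>2 \<le> \<bar>x - y\<bar> \<and> \<bar>x\<bar> \<le> R"
  shows "(\<integral>\<^sup>+z. ennreal ((indicator D (fst z, \<xi> - fst z) *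
      (bracket (snd z - fst z ^ 3) powr (- b) * bracket (\<tau> - snd z - (\<xi> - fst z) ^ 3) powr (- b))) powr r) \<partial>lborel)
    \<le> ennreal (2 * W * W / (3 * \<mu>1 * \<mu>2))"
proof (cases "\<mu>1 \<le> \<bar>\<xi>\<bar>")
  case False
  then have "(fst z, \<xi> - fst z) \<notin> D" for z :: "real \<times> real"
    using D(2)[of "fst z" "\<xi> - fst z"] by auto
  then show ?thesis by simp
next
  case True
  note [measurable] = D(1)
  define w where "w = (\<lambda>x. bracket x powr (- (b * r)))"
  have w[measurable]: "w \<in> borel_measurable borel" unfolding w_def by measurable
  have w0: "0 \<le> w x" for x by (simp add: w_def)
  define I where "I = {x. \<mu>2 \<le> \<bar>2 * x - \<xi>\<bar> \<and> \<bar>x\<bar> \<le> R}"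
  have [measurable]: "I \<in> sets borel" unfolding I_def by measurable
  have "(\<integral>\<^sup>+z. ennreal ((indicator D (fst z, \<xi> - fst z) *
      (bracket (snd z - fst z ^ 3) powr (- b) * bracket (\<tau> - snd z - (\<xi> - fst z) ^ 3) powr (- b))) powr r) \<partial>lborel)
    \<le> (\<integral>\<^sup>+z. indicator I (fst z) * (ennreal (w (snd z - fst z ^ 3)) * ennreal (w (\<tau> - snd z - (\<xi> - fst z) ^ 3))) \<partial>lborel)"
  proof (intro nn_integral_mono)
    fix z :: "real \<times> real"
    show "ennreal ((indicator D (fst z, \<xi> - fst z) *
      (bracket (snd z - fst z ^ 3) powr (- b) * bracket (\<tau> - snd z - (\<xi> - fst z) ^ 3) powr (- b))) powr r)
      \<le> indicator I (fst z) * (ennreal (w (snd z - fst z ^ 3)) * ennreal (w (\<tau> - snd z - (\<xi> - fst z) ^ 3)))"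
    proof (cases "(fst z, \<xi> - fst z) \<in> D")
      case True
      then have "fst z \<in> I" using D(2)[OF True] by (auto simp: I_def)
      then show ?thesis using True
        by (simp add: w_def powr_mult powr_powr ennreal_mult[symmetric])
    qed simp
  qed
  also have "\<dots> = (\<integral>\<^sup>+x. \<integral>\<^sup>+y. indicator I x * (ennreal (w (y - x ^ 3)) * ennreal (w (\<tau> - y - (\<xi> - x) ^ 3))) \<partial>lborel \<partial>lborel)"
    by (subst nn_integral_lborel_pair) auto
  \<comment> \<open>Shifting y by x^3 frees the first factor of x. The integral over x then meets
    the second factor alone, whose argument is the phase.\<close>
  also have "\<dots> = (\<integral>\<^sup>+x. \<integral>\<^sup>+y. ennreal (w y) * (ennreal (w ((\<tau> - y) - x ^ 3 - (\<xi> - x) ^ 3)) * indicator I x) \<partial>lborel \<partial>lborel)"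
  proof (rule nn_integral_cong)
    fix x :: real
    have "(\<integral>\<^sup>+y. indicator I x * (ennreal (w (y - x ^ 3)) * ennreal (w (\<tau> - y - (\<xi> - x) ^ 3))) \<partial>lborel) =
        (\<integral>\<^sup>+y. ennreal (w (y - x ^ 3)) * (ennreal (w ((\<tau> - (y - x ^ 3)) - x ^ 3 - (\<xi> - x) ^ 3)) * indicator I x) \<partial>lborel)"
      by (intro nn_integral_cong) (simp add: mult_ac)
    also have "\<dots> = (\<integral>\<^sup>+y. ennreal (w y) * (ennreal (w ((\<tau> - y) - x ^ 3 - (\<xi> - x) ^ 3)) * indicator I x) \<partial>lborel)"
      by (rule nn_integral_lborel_shift[of "\<lambda>y. ennreal (w y) * (ennreal (w ((\<tau> - y) - x ^ 3 - (\<xi> - x) ^ 3)) * indicator I x)"]) measurable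
    finally show "(\<integral>\<^sup>+y. indicator I x * (ennreal (w (y - x ^ 3)) * ennreal (w (\<tau> - y - (\<xi> - x) ^ 3))) \<partial>lborel) = \<dots>" .
  qed
  also have "\<dots> = (\<integral>\<^sup>+y. \<integral>\<^sup>+x. ennreal (w y) * (ennreal (w ((\<tau> - y) - x ^ 3 - (\<xi> - x) ^ 3)) * indicator I x) \<partial>lborel \<partial>lborel)"
    by (rule lborel_pair.Fubini') measurable
  also have "\<dots> = (\<integral>\<^sup>+y. ennreal (w y) * (\<integral>\<^sup>+x. ennreal (w ((\<tau> - y) - x ^ 3 - (\<xi> - x) ^ 3)) * indicator I x \<partial>lborel) \<partial>lborel)"
    by (intro nn_integral_cong nn_integral_cmult) measurable
  also have "\<dots> \<le> (\<integral>\<^sup>+y. ennreal (w y) * ennreal (2 * W / (3 * \<mu>1 * \<mu>2)) \<partial>lborel)"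
  proof (intro nn_integral_mono mult_left_mono)
    fix y
    define X where "X = (\<integral>\<^sup>+x. ennreal (w ((\<tau> - y) - x ^ 3 - (\<xi> - x) ^ 3)) * indicator I x \<partial>lborel)"
    have "ennreal (3 * \<mu>1 * \<mu>2) * X \<le> 2 * (\<integral>\<^sup>+x. ennreal (w x) \<partial>lborel)"
      unfolding I_def X_def by (rule nn_integral_phase_le[OF w w0 _ mu True]) (simp add: w_def)
    also have "\<dots> \<le> 2 * ennreal W"
      using W(2) by (intro mult_left_mono) (auto simp: w_def)
    finally have le: "ennreal (3 * \<mu>1 * \<mu>2) * X \<le> ennreal (2 * W)"
      using W(1) by (simp add: ennreal_mult)
    have "X = ennreal (1 / (3 * \<mu>1 * \<mu>2)) * (ennreal (3 * \<mu>1 * \<mu>2) * X)"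
      using mu by (simp add: mult.assoc[symmetric] ennreal_mult[symmetric])
    also have "\<dots> \<le> ennreal (1 / (3 * \<mu>1 * \<mu>2)) * ennreal (2 * W)"
      by (intro mult_left_mono le) auto
    also have "\<dots> = ennreal (2 * W / (3 * \<mu>1 * \<mu>2))"
      using mu W by (simp add: ennreal_mult[symmetric])
    finally show "X \<le> ennreal (2 * W / (3 * \<mu>1 * \<mu>2))" .
  qed auto
  also have "\<dots> = (\<integral>\<^sup>+y. ennreal (w y) \<partial>lborel) * ennreal (2 * W / (3 * \<mu>1 * \<mu>2))"
    by (rule nn_integral_multc) measurable
  also have "\<dots> \<le> ennreal W * ennreal (2 * W / (3 * \<mu>1 * \<mu>2))"
    using W(2) by (intro mult_right_mono) (auto simp: w_def)
  also have "\<dots> = ennreal (2 * W * W / (3 * \<mu>1 * \<mu>2))"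
    using mu W by (simp add: ennreal_mult[symmetric] mult_ac)
  finally show ?thesis .
qed

text \<open>After Hoelder's inequality, integration in \<zeta> and a translation decouple the two
  arguments. As the indicator of \<open>D\<close> sees only the first components, the integrals over
  the modulation variables separate, and only a bilinear form in x and y remains.\<close>

lemma nn_integral_mconv_powr_le:
  assumes r: "1 < r" and p: "1 < p" and rp: "1 / r + 1 / p = 1" and br: "1 < b * r"
    and W: "0 < W" "(\<integral>\<^sup>+x. ennreal (bracket x powr (- (b * r))) \<partial>lborel) \<le> ennreal W"
    and mu: "0 < \<mu>1" "0 < \<mu>2"
    and D: "D \<in> sets borel" "\<And>x y. (x, y) \<in> D \<Longrightarrow> \<mu>1 \<le> \<bar>x + y\<bar> \<and> \<mu>2 \<le> \<bar>x - y\<bar> \<and> \<bar>x\<bar> \<le> R"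
    and m: "m \<in> borel_measurable borel" "\<And>q. norm (m q) \<le> indicator D q"
    and G[measurable]: "G \<in> borel_measurable borel" and K[measurable]: "K \<in> borel_measurable borel"
  shows "(\<integral>\<^sup>+\<zeta>. ennreal (norm (mconv m G K \<zeta>) powr p) \<partial>lborel) \<le>
    ennreal ((2 * W * W / (3 * \<mu>1 * \<mu>2)) powr (p / r)) *
    (\<integral>\<^sup>+x. \<integral>\<^sup>+y. indicator D (x, y) * ((\<integral>\<^sup>+\<tau>. ennreal (modulation_norm b G (x, \<tau>) powr p) \<partial>lborel) *
      (\<integral>\<^sup>+\<tau>. ennreal (modulation_norm b K (y, \<tau>) powr p) \<partial>lborel)) \<partial>lborel \<partial>lborel)"
proof -
  note [measurable] = D(1) m(1)
  define S where "S = 2 * W * W / (3 * \<mu>1 * \<mu>2)"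
  have S: "0 < S" using W mu by (simp add: S_def)
  define mG where "mG = (\<lambda>z. ennreal (modulation_norm b G z powr p))"
  define mK where "mK = (\<lambda>z. ennreal (modulation_norm b K z powr p))"
  have [measurable]: "mG \<in> borel_measurable borel" "mK \<in> borel_measurable borel"
    unfolding mG_def mK_def by measurable
  have "ennreal (norm (mconv m G K \<zeta>) powr p) \<le>
      ennreal (S powr (p / r)) * (\<integral>\<^sup>+z. indicator D (fst z, fst \<zeta> - fst z) * (mG z * mK (\<zeta> - z)) \<partial>lborel)" for \<zeta>
  proof -
    obtain \<xi> \<tau> where \<zeta>: "\<zeta> = (\<xi>, \<tau>)" by (cases \<zeta>)
    define f where "f = (\<lambda>z. indicator D (fst z, fst \<zeta> - fst z) * (modulation_norm b G z * modulation_norm b K (\<zeta> - z)))"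
    define g where "g = (\<lambda>z. indicator D (fst z, \<xi> - fst z) *
      (bracket (snd z - fst z ^ 3) powr (- b) * bracket (\<tau> - snd z - (\<xi> - fst z) ^ 3) powr (- b)))"
    have fg: "norm (m (fst z, fst \<zeta> - fst z) * (G z * K (\<zeta> - z))) \<le> f z * g z" for z
    proof (cases "(fst z, fst \<zeta> - fst z) \<in> D")
      case True
      have "f z * g z = norm (G z) * norm (K (\<zeta> - z))"
        using True bracket_pos[of "snd z - fst z ^ 3"] bracket_pos[of "\<tau> - snd z - (\<xi> - fst z) ^ 3"]
        by (simp add: f_def g_def \<zeta> modulation_norm_def powr_minus field_simps)
      moreover have "norm (m (fst z, fst \<zeta> - fst z)) \<le> 1" using m(2)[of "(fst z, fst \<zeta> - fst z)"] True by simp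
      ultimately show ?thesis
        unfolding norm_mult by (simp add: mult_left_le_one_le)
    next
      case False
      then have "m (fst z, fst \<zeta> - fst z) = 0" using m(2)[of "(fst z, fst \<zeta> - fst z)"] by simp
      then show ?thesis using False by (simp add: f_def)
    qed
    have "ennreal (norm (mconv m G K \<zeta>)) \<le> (\<integral>\<^sup>+z. ennreal (norm (m (fst z, fst \<zeta> - fst z) * (G z * K (\<zeta> - z)))) \<partial>lborel)"
    proof (cases "integrable lborel (\<lambda>z. m (fst z, fst \<zeta> - fst z) * (G z * K (\<zeta> - z)))")
      case True
      then show ?thesis unfolding mconv_def by (rule integral_norm_bound_ennreal)
    next
      \<comment> \<open>The integral is 0 by convention here, so the bound is trivial.\<close>
      case False
      then show ?thesis by (simp add: mconv_def not_integrable_integral_eq)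
    qed
    also have "\<dots> \<le> (\<integral>\<^sup>+z. ennreal (f z * g z) \<partial>lborel)"
      by (intro nn_integral_mono ennreal_leI fg)
    finally have le: "ennreal (norm (mconv m G K \<zeta>)) \<le> (\<integral>\<^sup>+z. ennreal (f z * g z) \<partial>lborel)" .
    have "ennreal (norm (mconv m G K \<zeta>) powr p) \<le> ennreal (S powr (p / r)) * (\<integral>\<^sup>+z. ennreal (f z powr p) \<partial>lborel)"
    proof (rule hoelder_bound[OF r p rp _ _ _ _ S _ _ le])
      show "f \<in> borel_measurable lborel" unfolding f_def by measurable
      show "g \<in> borel_measurable lborel" unfolding g_def by measurable
      show "0 \<le> f z" for z by (simp add: f_def modulation_norm_nonneg)
      show "0 \<le> g z" for z by (simp add: g_def)
      show "(\<integral>\<^sup>+z. ennreal (g z powr r) \<partial>lborel) \<le> ennreal S"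
        unfolding g_def S_def using r by (intro nn_integral_kernel_le[OF br _ W mu D]) auto
    qed simp
    also have "(\<integral>\<^sup>+z. ennreal (f z powr p) \<partial>lborel) = (\<integral>\<^sup>+z. indicator D (fst z, fst \<zeta> - fst z) * (mG z * mK (\<zeta> - z)) \<partial>lborel)"
    proof (rule nn_integral_cong)
      fix z
      show "ennreal (f z powr p) = indicator D (fst z, fst \<zeta> - fst z) * (mG z * mK (\<zeta> - z))"
        by (cases "(fst z, fst \<zeta> - fst z) \<in> D")
          (simp_all add: f_def mG_def mK_def powr_mult modulation_norm_nonneg ennreal_mult)
    qed
    finally show ?thesis .
  qed
  then have "(\<integral>\<^sup>+\<zeta>. ennreal (norm (mconv m G K \<zeta>) powr p) \<partial>lborel) \<le>
      (\<integral>\<^sup>+\<zeta>. ennreal (S powr (p / r)) * (\<integral>\<^sup>+z. indicator D (fst z, fst \<zeta> - fst z) * (mG z * mK (\<zeta> - z)) \<partial>lborel) \<partial>lborel)"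
    by (intro nn_integral_mono)
  also have "\<dots> = ennreal (S powr (p / r)) * (\<integral>\<^sup>+\<zeta>. \<integral>\<^sup>+z. indicator D (fst z, fst \<zeta> - fst z) * (mG z * mK (\<zeta> - z)) \<partial>lborel \<partial>lborel)"
    by (rule nn_integral_cmult) measurable
  also have "(\<integral>\<^sup>+\<zeta>. \<integral>\<^sup>+z. indicator D (fst z, fst \<zeta> - fst z) * (mG z * mK (\<zeta> - z)) \<partial>lborel \<partial>lborel) =
      (\<integral>\<^sup>+z. \<integral>\<^sup>+\<zeta>. indicator D (fst z, fst \<zeta> - fst z) * (mG z * mK (\<zeta> - z)) \<partial>lborel \<partial>lborel)"
    by (rule lborel_pair.Fubini') measurable
  also have "\<dots> = (\<integral>\<^sup>+z. \<integral>\<^sup>+\<zeta>. indicator D (fst z, fst \<zeta>) * (mG z * mK \<zeta>) \<partial>lborel \<partial>lborel)"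
  proof (rule nn_integral_cong)
    fix z :: "real \<times> real"
    have "(\<integral>\<^sup>+\<zeta>. indicator D (fst z, fst (\<zeta> - z)) * (mG z * mK (\<zeta> - z)) \<partial>lborel) =
        (\<integral>\<^sup>+\<zeta>. indicator D (fst z, fst \<zeta>) * (mG z * mK \<zeta>) \<partial>lborel)"
      by (rule nn_integral_lborel_shift[of "\<lambda>\<zeta>. indicator D (fst z, fst \<zeta>) * (mG z * mK \<zeta>)"]) measurable
    then show "(\<integral>\<^sup>+\<zeta>. indicator D (fst z, fst \<zeta> - fst z) * (mG z * mK (\<zeta> - z)) \<partial>lborel) =
        (\<integral>\<^sup>+\<zeta>. indicator D (fst z, fst \<zeta>) * (mG z * mK \<zeta>) \<partial>lborel)" by simp
  qed
  also have "\<dots> = (\<integral>\<^sup>+x. \<integral>\<^sup>+\<tau>. \<integral>\<^sup>+\<zeta>. indicator D (x, fst \<zeta>) * (mG (x, \<tau>) * mK \<zeta>) \<partial>lborel \<partial>lborel \<partial>lborel)"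
    by (subst nn_integral_lborel_pair) auto
  also have "\<dots> = (\<integral>\<^sup>+x. \<integral>\<^sup>+y. indicator D (x, y) * ((\<integral>\<^sup>+\<tau>. mG (x, \<tau>) \<partial>lborel) * (\<integral>\<^sup>+\<tau>. mK (y, \<tau>) \<partial>lborel)) \<partial>lborel \<partial>lborel)"
  proof (rule nn_integral_cong)
    fix x :: real
    define MK where "MK = (\<lambda>y. \<integral>\<^sup>+t. mK (y, t) \<partial>lborel)"
    have [measurable]: "MK \<in> borel_measurable borel" unfolding MK_def by measurable
    have inner: "(\<integral>\<^sup>+\<zeta>. indicator D (x, fst \<zeta>) * (mG (x, \<tau>) * mK \<zeta>) \<partial>lborel) =
        mG (x, \<tau>) * (\<integral>\<^sup>+y. indicator D (x, y) * MK y \<partial>lborel)" for \<tau>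
    proof -
      have "(\<integral>\<^sup>+\<zeta>. indicator D (x, fst \<zeta>) * (mG (x, \<tau>) * mK \<zeta>) \<partial>lborel) =
          (\<integral>\<^sup>+y. \<integral>\<^sup>+t. (mG (x, \<tau>) * indicator D (x, y)) * mK (y, t) \<partial>lborel \<partial>lborel)"
        by (subst nn_integral_lborel_pair) (auto simp: mult_ac)
      also have "\<dots> = (\<integral>\<^sup>+y. mG (x, \<tau>) * (indicator D (x, y) * MK y) \<partial>lborel)"
      proof (rule nn_integral_cong)
        fix y
        have "(\<integral>\<^sup>+t. (mG (x, \<tau>) * indicator D (x, y)) * mK (y, t) \<partial>lborel) = (mG (x, \<tau>) * indicator D (x, y)) * MK y"
          unfolding MK_def by (rule nn_integral_cmult) measurable
        then show "(\<integral>\<^sup>+t. (mG (x, \<tau>) * indicator D (x, y)) * mK (y, t) \<partial>lborel) = mG (x, \<tau>) * (indicator D (x, y) * MK y)"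
          by (simp only: mult.assoc)
      qed
      also have "\<dots> = mG (x, \<tau>) * (\<integral>\<^sup>+y. indicator D (x, y) * MK y \<partial>lborel)"
        by (rule nn_integral_cmult) measurable
      finally show ?thesis .
    qed
    have "(\<integral>\<^sup>+\<tau>. mG (x, \<tau>) * (\<integral>\<^sup>+y. indicator D (x, y) * MK y \<partial>lborel) \<partial>lborel) =
        (\<integral>\<^sup>+\<tau>. mG (x, \<tau>) \<partial>lborel) * (\<integral>\<^sup>+y. indicator D (x, y) * MK y \<partial>lborel)"
      by (rule nn_integral_multc) measurable
    also have "\<dots> = (\<integral>\<^sup>+y. (\<integral>\<^sup>+\<tau>. mG (x, \<tau>) \<partial>lborel) * (indicator D (x, y) * MK y) \<partial>lborel)"
      by (rule nn_integral_cmult[symmetric]) measurable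
    finally show "(\<integral>\<^sup>+\<tau>. \<integral>\<^sup>+\<zeta>. indicator D (x, fst \<zeta>) * (mG (x, \<tau>) * mK \<zeta>) \<partial>lborel \<partial>lborel) =
       (\<integral>\<^sup>+y. indicator D (x, y) * ((\<integral>\<^sup>+\<tau>. mG (x, \<tau>) \<partial>lborel) * (\<integral>\<^sup>+\<tau>. mK (y, \<tau>) \<partial>lborel)) \<partial>lborel)"
      unfolding inner MK_def by (simp only: mult_ac)
  qed
  finally show ?thesis unfolding mG_def mK_def S_def .
qed

section \<open>Counting pairs of unit intervals\<close>

lemma card_int_abs_le:
  assumes "0 \<le> \<rho>"
  shows "finite {k::int. \<bar>real_of_int k\<bar> \<le> \<rho>}" "real (card {k::int. \<bar>real_of_int k\<bar> \<le> \<rho>}) \<le> 2 * \<rho> + 1"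
proof -
  have eq: "{k::int. \<bar>real_of_int k\<bar> \<le> \<rho>} = {- \<lfloor>\<rho>\<rfloor>..\<lfloor>\<rho>\<rfloor>}"
    by (auto simp: le_floor_iff abs_le_iff) linarith+
  show "finite {k::int. \<bar>real_of_int k\<bar> \<le> \<rho>}" unfolding eq by simp
  show "real (card {k::int. \<bar>real_of_int k\<bar> \<le> \<rho>}) \<le> 2 * \<rho> + 1"
    unfolding eq using assms of_int_floor_le[of \<rho>] by simp
qed

text \<open>The weighted AM-GM inequality with weights $2p/q$ and $1 - 2p/q$ replaces Hoelder's inequality here.\<close>

lemma sum_powr_le_card_powr:
  assumes p: "1 < p" and q: "ennreal (2 * p) \<le> q" and fin: "finite I"
    and a0: "\<And>k. 0 \<le> \<alpha> k" and a1: "\<And>k. \<alpha> k \<le> (1::real)"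
    and aq: "q \<noteq> \<infinity> \<Longrightarrow> (\<Sum>k\<in>I. \<alpha> k powr enn2real q) \<le> 1"
  shows "(\<Sum>k\<in>I. \<alpha> k powr (2 * p)) \<le> real (card I) powr (1 - p * enn2real (2 / q))"
proof (cases "q = \<infinity>")
  \<comment> \<open>Here \<open>2 / q\<close> is 0, so the exponent on the right is 1 and counting
    the terms suffices.\<close>
  case True
  have "(\<Sum>k\<in>I. \<alpha> k powr (2 * p)) \<le> (\<Sum>k\<in>I. 1)"
    using a0 a1 p by (intro sum_mono powr_le1) auto
  then show ?thesis using True by simp
next
  case False
  then obtain Q where Q: "q = ennreal Q" "0 \<le> Q" by (cases q) auto
  have Qp: "2 * p \<le> Q" using q p Q by (simp add: ennreal_le_iff)
  define n where "n = real (card I)"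
  define \<theta> where "\<theta> = 2 * p / Q"
  have \<theta>: "0 \<le> \<theta>" "\<theta> \<le> 1" using Qp p by (auto simp: \<theta>_def)
  have e: "p * enn2real (2 / q) = \<theta>"
    using Q Qp p by (simp add: \<theta>_def divide_ennreal flip: ennreal_numeral)
  show ?thesis
  proof (cases "n = 0")
    case True
    then have "I = {}" using fin by (simp add: n_def)
    then show ?thesis by simp
  next
    case False
    then have n: "0 < n" by (simp add: n_def)
    \<comment> \<open>The factor \<open>n\<close> normalises the terms
      \<open>n * \<alpha> k powr Q\<close> to an average of at most 1, so that summation over
      \<open>I\<close> gives exactly \<open>n powr (1 - \<theta>)\<close>.\<close>
    have "\<alpha> k powr (2 * p) \<le> n powr (- \<theta>) * (\<theta> * (n * \<alpha> k powr Q) + (1 - \<theta>))" for k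
    proof (cases "\<alpha> k = 0")
      case True
      then show ?thesis using \<theta> by simp
    next
      case False
      then have pos: "0 < \<alpha> k" using a0[of k] by simp
      have "(n * \<alpha> k powr Q) powr \<theta> * 1 powr (1 - \<theta>) \<le> \<theta> * (n * \<alpha> k powr Q) + (1 - \<theta>) * 1"
        using pos n \<theta> by (intro Youngs_inequality_0) auto
      moreover have "(n * \<alpha> k powr Q) powr \<theta> = n powr \<theta> * \<alpha> k powr (2 * p)"
        using pos n Qp p by (simp add: powr_mult powr_powr \<theta>_def)
      ultimately have "n powr (- \<theta>) * (n powr \<theta> * \<alpha> k powr (2 * p)) \<le> n powr (- \<theta>) * (\<theta> * (n * \<alpha> k powr Q) + (1 - \<theta>))"
        by (intro mult_left_mono) auto
      moreover have "n powr (- \<theta>) * (n powr \<theta> * \<alpha> k powr (2 * p)) = \<alpha> k powr (2 * p)"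
        using n by (simp add: mult.assoc[symmetric] powr_add[symmetric])
      ultimately show ?thesis by simp
    qed
    then have "(\<Sum>k\<in>I. \<alpha> k powr (2 * p)) \<le> (\<Sum>k\<in>I. n powr (- \<theta>) * (\<theta> * (n * \<alpha> k powr Q) + (1 - \<theta>)))"
      by (intro sum_mono)
    also have "\<dots> = n powr (- \<theta>) * (\<theta> * (n * (\<Sum>k\<in>I. \<alpha> k powr Q)) + n * (1 - \<theta>))"
      unfolding sum_distrib_left[symmetric] sum.distrib by (simp add: n_def)
    also have "\<dots> \<le> n powr (- \<theta>) * (\<theta> * (n * 1) + n * (1 - \<theta>))"
      using aq Q n \<theta> \<open>q \<noteq> \<infinity>\<close> by (intro mult_left_mono add_mono) auto
    also have "\<dots> = n powr (- \<theta>) * n powr 1" using n by (simp add: algebra_simps)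
    also have "\<dots> = n powr (1 - \<theta>)" by (simp only: powr_add[symmetric]) simp
    finally show ?thesis by (simp add: e n_def)
  qed
qed

text \<open>Pairs of unit intervals with centres k and l are grouped by the offset d = k + s l,
  where \<open>s = - 1\<close> belongs to m_- and \<open>s = 1\<close> to m_+. There are at most 2
  R3 + 3 offsets, and for each of them l is determined by k, so the double sum becomes a single sum
  over at most 2 R1 + 2 values of k. The coefficients \<alpha> and \<beta> lie in the unit ball of
  the sequence space with exponent q, with the norms kept apart in A and B.\<close>

lemma nn_integral_unit_boxes_le:
  fixes F F' :: "real \<Rightarrow> ennreal" and s :: int
  assumes p: "1 < p" and q: "ennreal (2 * p) \<le> q"
    and F[measurable]: "F \<in> borel_measurable borel" and F'[measurable]: "F' \<in> borel_measurable borel"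
    and a: "0 \<le> A" "\<And>k. 0 \<le> \<alpha> k" "\<And>k. \<alpha> k \<le> 1"
      "\<And>I. finite I \<Longrightarrow> q \<noteq> \<infinity> \<Longrightarrow> (\<Sum>k\<in>I. \<alpha> k powr enn2real q) \<le> 1"
      "\<And>k. (\<integral>\<^sup>+x. F x * indicator {real_of_int k - 1 / 2..real_of_int k + 1 / 2} x \<partial>lborel) \<le> ennreal ((A * \<alpha> k) powr p)"
    and b: "0 \<le> B" "\<And>k. 0 \<le> \<beta> k" "\<And>k. \<beta> k \<le> 1"
      "\<And>I. finite I \<Longrightarrow> q \<noteq> \<infinity> \<Longrightarrow> (\<Sum>k\<in>I. \<beta> k powr enn2real q) \<le> 1"
      "\<And>k. (\<integral>\<^sup>+x. F' x * indicator {real_of_int k - 1 / 2..real_of_int k + 1 / 2} x \<partial>lborel) \<le> ennreal ((B * \<beta> k) powr p)"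
    and s: "s = 1 \<or> s = - 1"
    and R: "0 \<le> R1" "0 \<le> R3"
    and D: "\<And>x y. (x, y) \<in> D \<Longrightarrow> \<bar>x\<bar> \<le> R1 \<and> \<bar>x + of_int s * y\<bar> \<le> R3"
  shows "(\<integral>\<^sup>+x. \<integral>\<^sup>+y. indicator D (x, y) * (F x * F' y) \<partial>lborel \<partial>lborel) \<le>
    ennreal ((A * B) powr p * ((2 * R3 + 3) * (2 * R1 + 2) powr (1 - p * enn2real (2 / q))))"
proof -
  define J where "J = (\<lambda>k::int. {real_of_int k - 1 / 2..real_of_int k + 1 / 2})"
  have [measurable]: "J k \<in> sets borel" for k by (simp add: J_def)
  define Ks where "Ks = {k::int. \<bar>real_of_int k\<bar> \<le> R1 + 1 / 2}"
  define Ds where "Ds = {k::int. \<bar>real_of_int k\<bar> \<le> R3 + 1}"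
  have fin: "finite Ks" "finite Ds" and cards: "real (card Ks) \<le> 2 * R1 + 2" "real (card Ds) \<le> 2 * R3 + 3"
    using card_int_abs_le[of "R1 + 1 / 2"] card_int_abs_le[of "R3 + 1"] R by (auto simp: Ks_def Ds_def)
  define \<theta>' where "\<theta>' = 1 - p * enn2real (2 / q)"
  have \<theta>': "0 \<le> \<theta>'"
  proof (cases "q = \<infinity>")
    case False
    then obtain Q where Q: "q = ennreal Q" "0 \<le> Q" by (cases q) auto
    have Qp: "2 * p \<le> Q" using q p Q by (simp add: ennreal_le_iff)
    have "p * enn2real (2 / q) = 2 * p / Q"
      using Q Qp p by (simp add: divide_ennreal flip: ennreal_numeral)
    then show ?thesis using Qp p by (simp add: \<theta>'_def)
  qed (simp add: \<theta>'_def)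
  have ss: "s * s = 1" using s by auto
  \<comment> \<open>The solution l of d = k + s l, as s is its own inverse.\<close>
  let ?l = "\<lambda>d k. s * (d - k)"
  have "(\<integral>\<^sup>+x. \<integral>\<^sup>+y. indicator D (x, y) * (F x * F' y) \<partial>lborel \<partial>lborel) \<le>
      (\<integral>\<^sup>+x. \<integral>\<^sup>+y. (\<Sum>d\<in>Ds. \<Sum>k\<in>Ks. (F x * indicator (J k) x) * (F' y * indicator (J (?l d k)) y)) \<partial>lborel \<partial>lborel)"
  proof (intro nn_integral_mono)
    fix x y :: real
    show "indicator D (x, y) * (F x * F' y) \<le> (\<Sum>d\<in>Ds. \<Sum>k\<in>Ks. (F x * indicator (J k) x) * (F' y * indicator (J (?l d k)) y))"
    proof (cases "(x, y) \<in> D")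
      case True
      \<comment> \<open>Rounding moves each variable by at most 1/2, hence x by 1/2 and x + s y by
        1; this explains the bounds in \<open>Ks\<close> and \<open>Ds\<close>.\<close>
      define k l d where "k = round x" and "l = round y" and "d = k + s * l"
      have kx: "\<bar>real_of_int k - x\<bar> \<le> 1 / 2" and ly: "\<bar>real_of_int l - y\<bar> \<le> 1 / 2"
        unfolding k_def l_def by (rule of_int_round_abs_le)+
      have l: "?l d k = l" using ss by (simp add: d_def mult.assoc[symmetric])
      have "x \<in> J k" "y \<in> J (?l d k)"
        using kx ly unfolding J_def l atLeastAtMost_iff by linarith+
      have "\<bar>real_of_int k\<bar> \<le> R1 + 1 / 2" using kx D[OF True] by linarith
      then have "k \<in> Ks" by (simp add: Ks_def)
      have "\<bar>real_of_int d\<bar> \<le> R3 + 1"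
      proof -
        have d: "real_of_int d = real_of_int k + real_of_int s * real_of_int l" by (simp add: d_def)
        from s show ?thesis
        proof
          assume "s = 1"
          then have "real_of_int d = real_of_int k + real_of_int l" "x + real_of_int s * y = x + y"
            using d by simp_all
          then show ?thesis using kx ly D[OF True] by linarith
        next
          assume "s = - 1"
          then have "real_of_int d = real_of_int k - real_of_int l" "x + real_of_int s * y = x - y"
            using d by simp_all
          then show ?thesis using kx ly D[OF True] by linarith
        qed
      qed
      then have "d \<in> Ds" by (simp add: Ds_def)
      have "indicator D (x, y) * (F x * F' y) = (F x * indicator (J k) x) * (F' y * indicator (J (?l d k)) y)"
        using True \<open>x \<in> J k\<close> \<open>y \<in> J (?l d k)\<close> by simp
      also have "\<dots> \<le> (\<Sum>k\<in>Ks. (F x * indicator (J k) x) * (F' y * indicator (J (?l d k)) y))"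
        using \<open>k \<in> Ks\<close> fin by (intro member_le_sum[of k Ks "\<lambda>k. (F x * indicator (J k) x) * (F' y * indicator (J (?l d k)) y)"]) auto
      also have "\<dots> \<le> (\<Sum>d\<in>Ds. \<Sum>k\<in>Ks. (F x * indicator (J k) x) * (F' y * indicator (J (?l d k)) y))"
        using \<open>d \<in> Ds\<close> fin by (intro member_le_sum[of d Ds "\<lambda>d. \<Sum>k\<in>Ks. (F x * indicator (J k) x) * (F' y * indicator (J (?l d k)) y)"]) auto
      finally show ?thesis .
    qed simp
  qed
  also have "\<dots> = (\<Sum>d\<in>Ds. \<Sum>k\<in>Ks. (\<integral>\<^sup>+x. F x * indicator (J k) x \<partial>lborel) * (\<integral>\<^sup>+y. F' y * indicator (J (?l d k)) y \<partial>lborel))"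
    by (simp add: nn_integral_sum nn_integral_cmult nn_integral_multc)
  also have "\<dots> \<le> (\<Sum>d\<in>Ds. \<Sum>k\<in>Ks. ennreal ((A * \<alpha> k) powr p) * ennreal ((B * \<beta> (?l d k)) powr p))"
    unfolding J_def by (intro sum_mono mult_mono a(5) b(5)) auto
  also have "\<dots> = ennreal (\<Sum>d\<in>Ds. \<Sum>k\<in>Ks. (A * \<alpha> k) powr p * (B * \<beta> (?l d k)) powr p)"
    by (simp add: ennreal_mult[symmetric] sum_ennreal sum_nonneg)
  also have "\<dots> \<le> ennreal ((A * B) powr p * ((2 * R3 + 3) * (2 * R1 + 2) powr \<theta>'))"
  proof (rule ennreal_leI)
    have in_d: "(\<Sum>k\<in>Ks. (A * \<alpha> k) powr p * (B * \<beta> (?l d k)) powr p) \<le> (A * B) powr p * (2 * R1 + 2) powr \<theta>'" for d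
    proof -
      have "(\<Sum>k\<in>Ks. (A * \<alpha> k) powr p * (B * \<beta> (?l d k)) powr p) \<le>
          (\<Sum>k\<in>Ks. (A * B) powr p * ((\<alpha> k powr (2 * p) + \<beta> (?l d k) powr (2 * p)) / 2))"
      proof (rule sum_mono)
        fix k
        have sq: "x powr (2 * p) = (x powr p)\<^sup>2" for x :: real
          by (simp add: power2_eq_square powr_add[symmetric])
        \<comment> \<open>The AM-GM inequality separates \<alpha> and \<beta> termwise, in place of
          the Cauchy-Schwarz inequality for the sum. No precision is lost, as both sums of 2p-th
          powers obey the same bound.\<close>
        have "\<alpha> k powr p * \<beta> (?l d k) powr p \<le> (\<alpha> k powr (2 * p) + \<beta> (?l d k) powr (2 * p)) / 2"
          using sum_squares_bound[of "\<alpha> k powr p" "\<beta> (?l d k) powr p"] by (simp add: sq)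
        then have "(A * B) powr p * (\<alpha> k powr p * \<beta> (?l d k) powr p) \<le> (A * B) powr p * ((\<alpha> k powr (2 * p) + \<beta> (?l d k) powr (2 * p)) / 2)"
          by (intro mult_left_mono) auto
        then show "(A * \<alpha> k) powr p * (B * \<beta> (?l d k)) powr p \<le> (A * B) powr p * ((\<alpha> k powr (2 * p) + \<beta> (?l d k) powr (2 * p)) / 2)"
          using a(1,2) b(1,2) by (simp add: powr_mult mult_ac)
      qed
      also have "\<dots> = (A * B) powr p * (((\<Sum>k\<in>Ks. \<alpha> k powr (2 * p)) + (\<Sum>k\<in>Ks. \<beta> (?l d k) powr (2 * p))) / 2)"
        by (simp add: sum_distrib_left[symmetric] sum.distrib sum_divide_distrib[symmetric])
      also have "\<dots> \<le> (A * B) powr p * (((2 * R1 + 2) powr \<theta>' + (2 * R1 + 2) powr \<theta>') / 2)"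
      proof (intro mult_left_mono divide_right_mono add_mono)
        have mono: "real (card Ks) powr \<theta>' \<le> (2 * R1 + 2) powr \<theta>'"
          using cards \<theta>' by (intro powr_mono2) auto
        show "(\<Sum>k\<in>Ks. \<alpha> k powr (2 * p)) \<le> (2 * R1 + 2) powr \<theta>'"
          using sum_powr_le_card_powr[OF p q fin(1) a(2,3) a(4)[OF fin(1)]] mono by (simp add: \<theta>'_def)
        have inj: "inj_on (?l d) Ks" using s by (auto simp: inj_on_def)
        have im: "(\<Sum>k\<in>Ks. f (\<beta> (?l d k))) = (\<Sum>l\<in>?l d ` Ks. f (\<beta> l))" for f :: "real \<Rightarrow> real"
          by (simp add: sum.reindex[OF inj] comp_def)
        have "(\<Sum>l\<in>?l d ` Ks. \<beta> l powr (2 * p)) \<le> real (card (?l d ` Ks)) powr \<theta>'"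
          unfolding \<theta>'_def using fin(1) by (intro sum_powr_le_card_powr[OF p q _ b(2,3)] b(4)) auto
        then show "(\<Sum>k\<in>Ks. \<beta> (?l d k) powr (2 * p)) \<le> (2 * R1 + 2) powr \<theta>'"
          using mono by (simp add: card_image[OF inj] im[of "\<lambda>x. x powr (2 * p)"])
      qed auto
      finally show ?thesis by simp
    qed
    have "(\<Sum>d\<in>Ds. \<Sum>k\<in>Ks. (A * \<alpha> k) powr p * (B * \<beta> (?l d k)) powr p) \<le> (\<Sum>d\<in>Ds. (A * B) powr p * (2 * R1 + 2) powr \<theta>')"
      by (intro sum_mono in_d)
    also have "\<dots> = real (card Ds) * ((A * B) powr p * (2 * R1 + 2) powr \<theta>')" by simp
    also have "\<dots> \<le> (2 * R3 + 3) * ((A * B) powr p * (2 * R1 + 2) powr \<theta>')"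
      using cards by (intro mult_right_mono) auto
    finally show "(\<Sum>d\<in>Ds. \<Sum>k\<in>Ks. (A * \<alpha> k) powr p * (B * \<beta> (?l d k)) powr p) \<le> (A * B) powr p * ((2 * R3 + 3) * (2 * R1 + 2) powr \<theta>')"
      by (simp add: mult_ac)
  qed
  finally show ?thesis unfolding \<theta>'_def .
qed

section \<open>From the norms to bounds on unit intervals\<close>

text \<open>On the central unit interval at most three translates of \<phi> are nonzero, each at
  most 1, while \<phi> itself equals 1 there. This is the origin of the factor 3 in
  \<open>Xhat_data\<close>.\<close>

lemma eta_ge:
  assumes phi: "cutoff \<phi>" and x: "\<bar>x\<bar> \<le> 1 / 2"
  shows "1 / 3 \<le> eta \<phi> x"
proof -
  have zero: "\<phi> (x - of_int k) = 0" if "k \<notin> {- 1, 0, 1}" for k :: int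
  proof (rule cutoff_outside[OF phi])
    have "2 \<le> \<bar>k\<bar>" using that by auto
    then have "2 \<le> \<bar>real_of_int k\<bar>" by linarith
    then show "5 / 4 < \<bar>x - real_of_int k\<bar>" using x by linarith
  qed
  have "(\<Sum>\<^sub>\<infinity>k\<in>(UNIV :: int set). \<phi> (x - of_int k)) = (\<Sum>\<^sub>\<infinity>k\<in>{- 1, 0, 1 :: int}. \<phi> (x - of_int k))"
    by (rule infsum_cong_neutral) (use zero in auto)
  also have "\<dots> = \<phi> (x + 1) + (\<phi> x + \<phi> (x - 1))" by simp
  finally have S: "(\<Sum>\<^sub>\<infinity>k\<in>(UNIV :: int set). \<phi> (x - of_int k)) = \<phi> (x + 1) + (\<phi> x + \<phi> (x - 1))" .
  have 1: "\<phi> x = 1" using x by (intro cutoff_bounds(3)[OF phi]) auto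
  have "1 \<le> \<phi> (x + 1) + (\<phi> x + \<phi> (x - 1))" "\<phi> (x + 1) + (\<phi> x + \<phi> (x - 1)) \<le> 3"
    using cutoff_bounds(1,2)[OF phi, of "x + 1"] cutoff_bounds(1,2)[OF phi, of "x - 1"] 1 by linarith+
  then show ?thesis unfolding eta_def S 1 by (simp add: divide_simps)
qed

lemma conj_exp_ennreal:
  assumes "1 < r" "1 / r + 1 / p = 1"
  shows "conj_exp (ennreal r) = ennreal p"
proof -
  have p: "0 < p" using assms by (smt (verit) divide_less_eq_1_pos zero_less_divide_1_iff)
  have "1 - inverse (ennreal r) = ennreal 1 - ennreal (1 / r)"
    using assms by (simp add: inverse_ennreal divide_inverse)
  also have "\<dots> = ennreal (1 / p)"
  proof -
    have "1 - 1 / r = 1 / p" using assms(2) by linarith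
    moreover have "ennreal 1 - ennreal (1 / r) = ennreal (1 - 1 / r)"
      using assms(1) by (intro ennreal_minus) simp
    ultimately show ?thesis by (simp only:)
  qed
  finally show ?thesis using p by (simp add: conj_exp_def inverse_ennreal)
qed

lemma epow_ennreal: "0 \<le> x \<Longrightarrow> epow (ennreal x) a = ennreal (x powr a)"
  by (simp add: epow_def)

lemma Lnorm_ennreal:
  assumes "0 < p"
  shows "Lnorm M (ennreal p) (\<lambda>z. ennreal (norm (g z))) = epow (\<integral>\<^sup>+z. ennreal (norm (g z) powr p) \<partial>M) (1 / p)"
  using assms by (simp add: Lnorm_def epow_ennreal)

text \<open>Finite partial sums of real numbers are all that the counting argument uses, and the
  bounds treat q = \<infinity> alongside finite exponents.\<close>

lemma Lnorm_count_space_bounds: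
  fixes X :: "int \<Rightarrow> ennreal"
  assumes q: "1 \<le> q" and fin: "Lnorm (count_space UNIV) q X < \<infinity>"
  defines "A \<equiv> enn2real (Lnorm (count_space UNIV) q X)"
  shows "X k < \<infinity>" and "enn2real (X k) \<le> A"
    and "q \<noteq> \<infinity> \<Longrightarrow> finite I \<Longrightarrow> (\<Sum>k\<in>I. enn2real (X k) powr enn2real q) \<le> A powr enn2real q"
proof -
  have "X k < \<infinity> \<and> enn2real (X k) \<le> A \<and>
    (q \<noteq> \<infinity> \<longrightarrow> finite I \<longrightarrow> (\<Sum>k\<in>I. enn2real (X k) powr enn2real q) \<le> A powr enn2real q)" for I k
  proof (cases "q = \<infinity>")
    case True
    have le: "X k \<le> Lnorm (count_space UNIV) q X"
      using esssup_AE[of X "count_space UNIV"] by (simp add: True Lnorm_def AE_count_space)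
    then show ?thesis using fin True by (auto simp: A_def intro: enn2real_mono)
  next
    case False
    then obtain Q where Q: "q = ennreal Q" "0 \<le> Q" by (cases q) auto
    have Q1: "1 \<le> Q" using q Q by simp
    define T where "T = (\<integral>\<^sup>+k. epow (X k) Q \<partial>count_space UNIV)"
    have L: "Lnorm (count_space UNIV) q X = epow T (1 / Q)"
      using Q by (simp add: Lnorm_def T_def)
    then have "T \<noteq> \<infinity>" using fin by (auto simp: epow_def)
    then obtain t where t: "T = ennreal t" "0 \<le> t" by (cases T) auto
    have A: "A = t powr (1 / Q)" unfolding A_def L t using t by (simp add: epow_ennreal)
    have sum: "(\<Sum>k\<in>I. epow (X k) Q) \<le> T" if "finite I" for I
    proof -
      have "(\<Sum>k\<in>I. epow (X k) Q) = (\<integral>\<^sup>+k. epow (X k) Q * indicator I k \<partial>count_space UNIV)"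
        using that by (subst nn_integral_count_space'[of I]) auto
      also have "\<dots> \<le> T" unfolding T_def by (intro nn_integral_mono) (auto simp: indicator_def)
      finally show ?thesis .
    qed
    have Xf: "X k < \<infinity>" for k
    proof (rule ccontr)
      assume "\<not> X k < \<infinity>"
      then have "X k = \<infinity>" by (simp add: less_top[symmetric])
      then show False using sum[of "{k}"] t by (simp add: epow_def top_unique)
    qed
    have sumr: "(\<Sum>k\<in>I. enn2real (X k) powr Q) \<le> t" if "finite I" for I
    proof -
      have "ennreal (\<Sum>k\<in>I. enn2real (X k) powr Q) = (\<Sum>k\<in>I. epow (X k) Q)"
        
      proof -
        have "epow (X k) Q = ennreal (enn2real (X k) powr Q)" for k
          using Xf[of k] by (simp add: epow_def less_top)
        then show ?thesis by (simp add: sum_ennreal)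
      qed
      also have "\<dots> \<le> ennreal t" using sum[OF that] t by simp
      finally show ?thesis using t by (simp add: ennreal_le_iff)
    qed
    have "enn2real (X k) = (enn2real (X k) powr Q) powr (1 / Q)"
      using Q1 by (simp add: powr_powr)
    also have "\<dots> \<le> t powr (1 / Q)" using sumr[of "{k}"] Q1 by (intro powr_mono2) auto
    finally have "enn2real (X k) \<le> A" by (simp add: A)
    moreover have "A powr Q = t" using t Q1 by (simp add: A powr_powr)
    ultimately show ?thesis using Xf sumr Q by auto
  qed
  then show "X k < \<infinity>" "enn2real (X k) \<le> A"
    "q \<noteq> \<infinity> \<Longrightarrow> finite I \<Longrightarrow> (\<Sum>k\<in>I. enn2real (X k) powr enn2real q) \<le> A powr enn2real q"
    by blast+
qed

text \<open>Membership in the space, put into the form that \<open>nn_integral_unit_boxes_le\<close>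
  expects: the norm A, coefficients \<alpha> in the unit ball of the sequence space, and sharp unit
  intervals in place of the smooth partition. The latter costs the factor 3.\<close>

lemma Xhat_data:
  assumes phi: "cutoff \<phi>" and r: "1 < r" and p: "1 < p" and rp: "1 / r + 1 / p = 1"
    and q: "1 \<le> q" and u: "u \<in> Xhat \<phi> 0 b (ennreal r) q"
  obtains A \<alpha> where "is_density (distr_fourier u) (density_of (distr_fourier u))"
    and "0 \<le> A" "Xhat_norm \<phi> 0 b (ennreal r) q u = ennreal A"
    and "\<And>k. 0 \<le> \<alpha> k" "\<And>k. \<alpha> k \<le> 1"
    and "\<And>I. finite I \<Longrightarrow> q \<noteq> \<infinity> \<Longrightarrow> (\<Sum>k\<in>I. \<alpha> k powr enn2real q) \<le> 1"
    and "\<And>k::int. (\<integral>\<^sup>+x. (\<integral>\<^sup>+\<tau>. ennreal (modulation_norm b (density_of (distr_fourier u)) (x, \<tau>) powr p) \<partial>lborel) *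
        indicator {real_of_int k - 1 / 2..real_of_int k + 1 / 2} x \<partial>lborel) \<le> ennreal ((3 * A * \<alpha> k) powr p)"
proof -
  define G where "G = density_of (distr_fourier u)"
  have finX: "Xhat_norm \<phi> 0 b (ennreal r) q u < \<infinity>" using u by (simp add: Xhat_def)
  then have ex: "\<exists>G. is_density (distr_fourier u) G" by (auto simp: Xhat_norm_def split: if_splits)
  then have dens: "is_density (distr_fourier u) G" unfolding G_def using is_density_density_of by blast
  then have Gm[measurable]: "G \<in> borel_measurable borel" by (simp add: is_density_def)
  define g where "g = (\<lambda>(k::int) z. complex_of_real (bracket (fst z) powr 0 * bracket (snd z - fst z ^ 3) powr b * eta \<phi> (fst z - of_int k)) * G z)"
  define X where "X = (\<lambda>k. Lnorm lborel (ennreal p) (\<lambda>z. ennreal (norm (g k z))))"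
  have Xn: "Xhat_norm \<phi> 0 b (ennreal r) q u = Lnorm (count_space UNIV) q X"
    using ex unfolding Xhat_norm_def X_def g_def G_def conj_exp_ennreal[OF r rp] by (simp add: case_prod_beta')
  define A where "A = enn2real (Lnorm (count_space UNIV) q X)"
  note bounds = Lnorm_count_space_bounds[OF q finX[unfolded Xn], folded A_def]
  \<comment> \<open>For A = 0 the quotient is 0 by convention, which is consistent because every
    \<open>X k\<close> then has real value 0.\<close>
  define \<alpha> where "\<alpha> = (\<lambda>k. enn2real (X k) / A)"
  have A: "0 \<le> A" "Xhat_norm \<phi> 0 b (ennreal r) q u = ennreal A"
    using finX by (simp_all add: A_def Xn)
  have A\<alpha>: "A * \<alpha> k = enn2real (X k)" for k
    using bounds(2)[of k] enn2real_nonneg[of "X k"] by (cases "A = 0") (auto simp: \<alpha>_def)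
  show ?thesis
  proof (rule that[of A \<alpha>])
    show "is_density (distr_fourier u) (density_of (distr_fourier u))" using dens by (simp add: G_def)
    show "0 \<le> A" "Xhat_norm \<phi> 0 b (ennreal r) q u = ennreal A" by (fact A)+
    show "0 \<le> \<alpha> k" for k using A by (simp add: \<alpha>_def)
    show "\<alpha> k \<le> 1" for k using bounds(2)[of k] A(1) by (cases "A = 0") (simp_all add: \<alpha>_def divide_le_eq_1)
    show "(\<Sum>k\<in>I. \<alpha> k powr enn2real q) \<le> 1" if I: "finite I" "q \<noteq> \<infinity>" for I
    proof -
      have "(\<Sum>k\<in>I. \<alpha> k powr enn2real q) = (\<Sum>k\<in>I. enn2real (X k) powr enn2real q) / A powr enn2real q"
        using A by (simp add: \<alpha>_def powr_divide sum_divide_distrib)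
      also have "\<dots> \<le> 1"
        using bounds(3)[OF I(2,1)] by (simp add: divide_le_eq_1)
      finally show ?thesis .
    qed
    show "(\<integral>\<^sup>+x. (\<integral>\<^sup>+\<tau>. ennreal (modulation_norm b (density_of (distr_fourier u)) (x, \<tau>) powr p) \<partial>lborel) *
        indicator {real_of_int k - 1 / 2..real_of_int k + 1 / 2} x \<partial>lborel) \<le> ennreal ((3 * A * \<alpha> k) powr p)" for k
    proof -
      define J where "J = {real_of_int k - 1 / 2..real_of_int k + 1 / 2}"
      have [measurable]: "J \<in> sets borel" by (simp add: J_def)
      define N where "N = (\<integral>\<^sup>+z. ennreal (norm (g k z) powr p) \<partial>lborel)"
      have XN: "X k = epow N (1 / p)"
        unfolding X_def N_def using p by (intro Lnorm_ennreal) simp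
      then have "N \<noteq> \<infinity>" using bounds(1)[of k] by (auto simp: epow_def)
      then obtain n where n: "N = ennreal n" "0 \<le> n" by (cases N) auto
      have xn: "enn2real (X k) = n powr (1 / p)" using n by (simp add: XN epow_ennreal)
      have "(\<integral>\<^sup>+x. (\<integral>\<^sup>+\<tau>. ennreal (modulation_norm b G (x, \<tau>) powr p) \<partial>lborel) * indicator J x \<partial>lborel) =
          (\<integral>\<^sup>+z. ennreal (modulation_norm b G z powr p) * indicator J (fst z) \<partial>lborel)"
        by (subst nn_integral_lborel_pair) (auto simp: nn_integral_multc)
      also have "\<dots> \<le> (\<integral>\<^sup>+z. ennreal (3 powr p) * ennreal (norm (g k z) powr p) \<partial>lborel)"
      proof (rule nn_integral_mono)
        fix z :: "real \<times> real"
        show "ennreal (modulation_norm b G z powr p) * indicator J (fst z) \<le> ennreal (3 powr p) * ennreal (norm (g k z) powr p)"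
        proof (cases "fst z \<in> J")
          case True
          then have "\<bar>fst z - real_of_int k\<bar> \<le> 1 / 2"
            unfolding J_def atLeastAtMost_iff by linarith
          from eta_ge[OF phi this] have e: "1 \<le> 3 * eta \<phi> (fst z - of_int k)" by simp
          have "norm (g k z) = bracket (snd z - fst z ^ 3) powr b * \<bar>eta \<phi> (fst z - of_int k)\<bar> * norm (G z)"
            using bracket_pos[of "fst z"] by (simp add: g_def norm_mult abs_mult)
          then have "3 * norm (g k z) = modulation_norm b G z * (3 * eta \<phi> (fst z - of_int k))"
            using e by (simp add: modulation_norm_def)
          then have "modulation_norm b G z \<le> 3 * norm (g k z)"
            using mult_left_mono[OF e modulation_norm_nonneg[of b G z]] by simp
          then have "modulation_norm b G z powr p \<le> (3 * norm (g k z)) powr p"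
            using p modulation_norm_nonneg by (intro powr_mono2) auto
          then show ?thesis using True by (simp add: powr_mult ennreal_mult[symmetric] ennreal_leI)
        qed simp
      qed
      also have "\<dots> = ennreal (3 powr p) * N"
        unfolding N_def
      proof (rule nn_integral_cmult)
        have "smooth_real \<phi>" using phi by (simp add: cutoff_def)
        note [measurable] = borel_measurable_continuous_onI[OF smooth_real_continuous[OF this]]
        have supp: "\<bar>real_of_int j\<bar> \<le> \<bar>x\<bar> + 5 / 4" if "\<phi> (x - of_int j) \<noteq> 0" for x and j :: int
        proof -
          have "\<not> 5 / 4 < \<bar>x - real_of_int j\<bar>" using cutoff_outside[OF phi, of "x - of_int j"] that by auto
          then show ?thesis by linarith
        qed
        \<comment> \<open>Measurability of \<open>eta\<close> rests on this: at each point the sum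
          over all integers is the eventual value of finite sums.\<close>
        have sums: "(\<lambda>n. \<Sum>j\<in>{- int n..int n}. \<phi> (x - of_int j)) \<longlonglongrightarrow> (\<Sum>\<^sub>\<infinity>j\<in>(UNIV :: int set). \<phi> (x - of_int j))" for x
        proof (rule tendsto_eventually)
          have eq: "(\<Sum>\<^sub>\<infinity>j\<in>(UNIV :: int set). \<phi> (x - of_int j)) = (\<Sum>j\<in>{- int n..int n}. \<phi> (x - of_int j))"
            if "{j::int. \<phi> (x - of_int j) \<noteq> 0} \<subseteq> {- int n..int n}" for n
          proof -
            have "(\<Sum>\<^sub>\<infinity>j\<in>(UNIV :: int set). \<phi> (x - of_int j)) = (\<Sum>\<^sub>\<infinity>j\<in>{- int n..int n}. \<phi> (x - of_int j))"
              by (rule infsum_cong_neutral) (use that in auto)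
            then show ?thesis by simp
          qed
          show "\<forall>\<^sub>F n in sequentially. (\<Sum>j\<in>{- int n..int n}. \<phi> (x - of_int j)) = (\<Sum>\<^sub>\<infinity>j\<in>(UNIV :: int set). \<phi> (x - of_int j))"
            using eventually_ge_at_top[of "nat \<lceil>\<bar>x\<bar> + 5 / 4\<rceil>"]
          proof eventually_elim
            case (elim n)
            have "{j::int. \<phi> (x - of_int j) \<noteq> 0} \<subseteq> {- int n..int n}"
            proof
              fix j :: int
              assume "j \<in> {j. \<phi> (x - of_int j) \<noteq> 0}"
              then have "\<bar>real_of_int j\<bar> \<le> \<bar>x\<bar> + 5 / 4" by (intro supp) simp
              moreover have "\<bar>x\<bar> + 5 / 4 \<le> real n" using elim by linarith
              ultimately have "\<bar>j\<bar> \<le> int n" by linarith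
              then show "j \<in> {- int n..int n}" by (simp add: abs_le_iff)
            qed
            from eq[OF this] show ?case by simp
          qed
        qed
        have [measurable]: "(\<lambda>x. \<Sum>\<^sub>\<infinity>j\<in>(UNIV :: int set). \<phi> (x - of_int j)) \<in> borel_measurable borel"
          by (rule borel_measurable_LIMSEQ_real[OF sums]) measurable
        have [measurable]: "eta \<phi> \<in> borel_measurable borel"
          unfolding eta_def[abs_def] by measurable
        show "(\<lambda>z. ennreal (norm (g k z) powr p)) \<in> borel_measurable lborel"
          unfolding g_def by measurable
      qed
      also have "\<dots> = ennreal ((3 * A * \<alpha> k) powr p)"
        using n p by (simp add: mult.assoc A\<alpha> xn powr_mult powr_powr ennreal_mult)
      finally show ?thesis unfolding G_def J_def .
    qed
  qed
qed

text \<open>Young's inequality bounds |G| by the p-th power of its modulation weighting plus the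
  bracket to the power - b r. The second term has the same finite integral over \<tau> for every x.
  The first has bounded integrals over unit strips in x, which the weight sums; no decay in x from
  strip to strip is available when q = \<infinity>.\<close>

lemma integrable_weight_mult:
  assumes r: "1 < r" and p: "1 < p" and rp: "1 / r + 1 / p = 1" and br: "1 < b * r"
    and G[measurable]: "G \<in> borel_measurable borel" and c: "0 \<le> c"
    and box: "\<And>k::int. (\<integral>\<^sup>+x. (\<integral>\<^sup>+\<tau>. ennreal (modulation_norm b G (x, \<tau>) powr p) \<partial>lborel) *
        indicator {real_of_int k - 1 / 2..real_of_int k + 1 / 2} x \<partial>lborel) \<le> ennreal c"
  shows "integrable lborel (\<lambda>z. of_real (1 / (1 + (fst z)\<^sup>2)) * G z)"
proof (rule integrableI_bounded)
  define w where "w = (\<lambda>x::real. 1 / (1 + x\<^sup>2))"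
  have [measurable]: "w \<in> borel_measurable borel" unfolding w_def by measurable
  have w0: "0 < w x" for x by (simp add: w_def add_pos_nonneg)
  have wint: "(\<integral>\<^sup>+x. ennreal (w x) \<partial>lborel) < \<infinity>"
    using inverse_square_integrable by (simp add: integrable_iff_bounded w_def)
  define F where "F = (\<lambda>x. \<integral>\<^sup>+\<tau>. ennreal (modulation_norm b G (x, \<tau>) powr p) \<partial>lborel)"
  have [measurable]: "F \<in> borel_measurable borel" unfolding F_def by measurable
  define V where "V = (\<integral>\<^sup>+x. ennreal (bracket x powr (- (b * r))) \<partial>lborel)"
  have V: "V < \<infinity>" unfolding V_def by (rule nn_integral_bracket_finite[OF br])
  \<comment> \<open>An average over y replaces a sum over intervals: \<open>w\<close> changes by a
    factor of at most 2 over the distance 1/2, and the unit interval around y is covered by two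
    consecutive intervals with integer centres. Together this gives the factor 4 in front of
    \<open>c\<close>.\<close>
  have wF: "(\<integral>\<^sup>+x. ennreal (w x) * F x \<partial>lborel) < \<infinity>"
  proof -
    have "(\<integral>\<^sup>+x. ennreal (w x) * F x \<partial>lborel) \<le>
        (\<integral>\<^sup>+x. \<integral>\<^sup>+y. ennreal (2 * w y) * (F x * indicator {y - 1 / 2..y + 1 / 2} x) \<partial>lborel \<partial>lborel)"
    proof (rule nn_integral_mono)
      fix x :: real
      have le: "w x \<le> 2 * w y" if "\<bar>y - x\<bar> \<le> 1 / 2" for y
      proof -
        have "(y - x)\<^sup>2 \<le> (1 / 2)\<^sup>2" using that abs_le_square_iff[of "y - x" "1 / 2"] by simp
        moreover have "y\<^sup>2 \<le> 2 * x\<^sup>2 + 2 * (y - x)\<^sup>2"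
          using zero_le_power2[of "y - 2 * x"] by (simp add: power2_eq_square algebra_simps)
        ultimately have "1 + y\<^sup>2 \<le> 2 * (1 + x\<^sup>2)" by (simp add: power_divide)
        then show ?thesis by (simp add: w_def divide_simps add_pos_nonneg)
      qed
      have "ennreal (w x) * F x = (\<integral>\<^sup>+y. ennreal (w x) * F x * indicator {x - 1 / 2..x + 1 / 2} y \<partial>lborel)"
        by (subst nn_integral_cmult) auto
      also have "\<dots> \<le> (\<integral>\<^sup>+y. ennreal (2 * w y) * (F x * indicator {y - 1 / 2..y + 1 / 2} x) \<partial>lborel)"
      proof (rule nn_integral_mono)
        fix y
        show "ennreal (w x) * F x * indicator {x - 1 / 2..x + 1 / 2} y \<le> ennreal (2 * w y) * (F x * indicator {y - 1 / 2..y + 1 / 2} x)"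
        proof (cases "y \<in> {x - 1 / 2..x + 1 / 2}")
          case True
          then have "\<bar>y - x\<bar> \<le> 1 / 2" "x \<in> {y - 1 / 2..y + 1 / 2}"
            unfolding atLeastAtMost_iff by linarith+
          then show ?thesis using True le[of y] by (simp add: mult_right_mono ennreal_leI)
        qed simp
      qed
      finally show "ennreal (w x) * F x \<le> (\<integral>\<^sup>+y. ennreal (2 * w y) * (F x * indicator {y - 1 / 2..y + 1 / 2} x) \<partial>lborel)" .
    qed
    also have "\<dots> = (\<integral>\<^sup>+y. \<integral>\<^sup>+x. ennreal (2 * w y) * (F x * indicator {y - 1 / 2..y + 1 / 2} x) \<partial>lborel \<partial>lborel)"
    proof (rule lborel_pair.Fubini')
      have "(\<lambda>z. indicator {z :: real \<times> real. \<bar>snd z - fst z\<bar> \<le> 1 / 2} z) \<in> borel_measurable (borel :: (real \<times> real) measure)"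
        by (intro borel_measurable_indicator borel_closed closed_Collect_le continuous_intros)
      moreover have "indicator {y - 1 / 2..y + 1 / 2} x = (indicator {z :: real \<times> real. \<bar>snd z - fst z\<bar> \<le> 1 / 2} (y, x) :: ennreal)" for x y
      proof -
        have "x \<in> {y - 1 / 2..y + 1 / 2} \<longleftrightarrow> \<bar>x - y\<bar> \<le> 1 / 2"
          unfolding atLeastAtMost_iff by linarith
        then show ?thesis by (simp add: indicator_def)
      qed
      ultimately show "(\<lambda>(y, x). ennreal (2 * w y) * (F x * indicator {y - 1 / 2..y + 1 / 2} x)) \<in> borel_measurable (lborel \<Otimes>\<^sub>M lborel)"
        by (simp add: lborel_prod case_prod_beta')
    qed
    also have "\<dots> \<le> (\<integral>\<^sup>+y. ennreal (w y) * ennreal (4 * c) \<partial>lborel)"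
    proof (rule nn_integral_mono)
      fix y :: real
      define J where "J = (\<lambda>k::int. {real_of_int k - 1 / 2..real_of_int k + 1 / 2})"
      define k where "k = \<lfloor>y\<rfloor>"
      have "(\<integral>\<^sup>+x. F x * indicator {y - 1 / 2..y + 1 / 2} x \<partial>lborel) \<le> (\<integral>\<^sup>+x. F x * indicator (J k) x + F x * indicator (J (k + 1)) x \<partial>lborel)"
      proof (rule nn_integral_mono)
        fix x
        have "x \<in> {y - 1 / 2..y + 1 / 2} \<Longrightarrow> x \<in> J k \<or> x \<in> J (k + 1)"
          unfolding J_def k_def by auto linarith+
        then show "F x * indicator {y - 1 / 2..y + 1 / 2} x \<le> F x * indicator (J k) x + F x * indicator (J (k + 1)) x"
          by (auto simp: indicator_def)
      qed
      also have "\<dots> = (\<integral>\<^sup>+x. F x * indicator (J k) x \<partial>lborel) + (\<integral>\<^sup>+x. F x * indicator (J (k + 1)) x \<partial>lborel)"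
        by (rule nn_integral_add) (auto simp: J_def)
      also have "\<dots> \<le> ennreal c + ennreal c"
        unfolding J_def F_def by (intro add_mono box)
      finally have "(\<integral>\<^sup>+x. F x * indicator {y - 1 / 2..y + 1 / 2} x \<partial>lborel) \<le> ennreal (2 * c)"
        using c by (simp add: ennreal_plus[symmetric] del: ennreal_plus)
      then have "ennreal (2 * w y) * (\<integral>\<^sup>+x. F x * indicator {y - 1 / 2..y + 1 / 2} x \<partial>lborel) \<le> ennreal (2 * w y) * ennreal (2 * c)"
        by (rule mult_left_mono) simp
      also have "\<dots> = ennreal (w y) * ennreal (4 * c)"
        using c w0[of y] by (simp add: ennreal_mult[symmetric])
      finally show "(\<integral>\<^sup>+x. ennreal (2 * w y) * (F x * indicator {y - 1 / 2..y + 1 / 2} x) \<partial>lborel) \<le> ennreal (w y) * ennreal (4 * c)"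
        by (subst nn_integral_cmult) auto
    qed
    also have "\<dots> = (\<integral>\<^sup>+y. ennreal (w y) \<partial>lborel) * ennreal (4 * c)"
      by (rule nn_integral_multc) measurable
    also have "\<dots> < \<infinity>" using wint by (simp add: ennreal_mult_less_top)
    finally show ?thesis .
  qed
  show "(\<lambda>z. of_real (1 / (1 + (fst z)\<^sup>2)) * G z) \<in> borel_measurable lborel" by measurable
  have "(\<integral>\<^sup>+z. ennreal (norm (of_real (1 / (1 + (fst z)\<^sup>2)) * G z)) \<partial>lborel) = (\<integral>\<^sup>+z. ennreal (w (fst z)) * ennreal (norm (G z)) \<partial>lborel)"
  proof (rule nn_integral_cong)
    fix z :: "real \<times> real"
    have "norm (complex_of_real (1 / (1 + (fst z)\<^sup>2)) * G z) = w (fst z) * norm (G z)"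
      using w0[of "fst z"] unfolding norm_mult norm_of_real w_def by simp
    then show "ennreal (norm (of_real (1 / (1 + (fst z)\<^sup>2)) * G z)) = ennreal (w (fst z)) * ennreal (norm (G z))"
      using w0[of "fst z"] by (simp add: ennreal_mult)
  qed
  also have "\<dots> = (\<integral>\<^sup>+x. ennreal (w x) * (\<integral>\<^sup>+\<tau>. ennreal (norm (G (x, \<tau>))) \<partial>lborel) \<partial>lborel)"
    by (subst nn_integral_lborel_pair) (auto simp: nn_integral_cmult)
  also have "\<dots> \<le> (\<integral>\<^sup>+x. ennreal (w x) * F x + ennreal (w x) * V \<partial>lborel)"
  proof (rule nn_integral_mono)
    fix x :: real
    have "(\<integral>\<^sup>+\<tau>. ennreal (norm (G (x, \<tau>))) \<partial>lborel) \<le>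
        (\<integral>\<^sup>+\<tau>. ennreal (modulation_norm b G (x, \<tau>) powr p) + ennreal (bracket (\<tau> - x ^ 3) powr (- (b * r))) \<partial>lborel)"
    proof (rule nn_integral_mono)
      fix \<tau>
      have "norm (G (x, \<tau>)) = modulation_norm b G (x, \<tau>) * bracket (\<tau> - x ^ 3) powr (- b)"
        using bracket_pos[of "\<tau> - x ^ 3"] by (simp add: modulation_norm_def powr_minus)
      also have "\<dots> \<le> modulation_norm b G (x, \<tau>) powr p / p + (bracket (\<tau> - x ^ 3) powr (- b)) powr r / r"
        using rp by (intro Youngs_inequality p r modulation_norm_nonneg) auto
      also have "\<dots> \<le> modulation_norm b G (x, \<tau>) powr p / 1 + (bracket (\<tau> - x ^ 3) powr (- b)) powr r / 1"
        using p r by (intro add_mono divide_left_mono) auto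
      also have "\<dots> = modulation_norm b G (x, \<tau>) powr p + bracket (\<tau> - x ^ 3) powr (- (b * r))"
        by (simp add: powr_powr)
      finally show "ennreal (norm (G (x, \<tau>))) \<le> ennreal (modulation_norm b G (x, \<tau>) powr p) + ennreal (bracket (\<tau> - x ^ 3) powr (- (b * r)))"
        by (simp add: ennreal_plus[symmetric] ennreal_leI del: ennreal_plus)
    qed
    also have "\<dots> = F x + (\<integral>\<^sup>+\<tau>. ennreal (bracket (\<tau> - x ^ 3) powr (- (b * r))) \<partial>lborel)"
      unfolding F_def by (rule nn_integral_add) measurable
    also have "(\<integral>\<^sup>+\<tau>. ennreal (bracket (\<tau> - x ^ 3) powr (- (b * r))) \<partial>lborel) = V"
      unfolding V_def by (rule nn_integral_lborel_shift[of "\<lambda>\<tau>. ennreal (bracket \<tau> powr (- (b * r)))"]) measurable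
    finally show "ennreal (w x) * (\<integral>\<^sup>+\<tau>. ennreal (norm (G (x, \<tau>))) \<partial>lborel) \<le> ennreal (w x) * F x + ennreal (w x) * V"
      unfolding distrib_left[symmetric] by (rule mult_left_mono) simp
  qed
  also have "\<dots> = (\<integral>\<^sup>+x. ennreal (w x) * F x \<partial>lborel) + (\<integral>\<^sup>+x. ennreal (w x) \<partial>lborel) * V"
    by (subst nn_integral_add) (auto simp: nn_integral_multc)
  also have "\<dots> < \<infinity>" using wF wint V by (simp add: ennreal_mult_less_top)
  finally show "(\<integral>\<^sup>+z. ennreal (norm (of_real (1 / (1 + (fst z)\<^sup>2)) * G z)) \<partial>lborel) < \<infinity>" .
qed

text \<open>The norm is evaluated on a chosen density; uniqueness allows an explicit one to be used
  instead.\<close>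

lemma Lhat_norm_le:
  assumes phi: "cutoff \<phi>" and r: "1 < r" and p: "1 < p" and rp: "1 / r + 1 / p = 1"
    and H: "is_density (distr_fourier T) H" and Y: "0 \<le> Y"
    and le: "(\<integral>\<^sup>+z. ennreal (norm (H z) powr p) \<partial>lborel) \<le> ennreal (Y powr p)"
  shows "Lhat_norm (ennreal r) T \<le> ennreal Y"
proof -
  define N where "N = (\<integral>\<^sup>+z. ennreal (norm (H z) powr p) \<partial>lborel)"
  have "Lhat_norm (ennreal r) T = Lnorm lborel (ennreal p) (\<lambda>z. ennreal (norm (density_of (distr_fourier T) z)))"
    using H by (auto simp: Lhat_norm_def conj_exp_ennreal[OF r rp])
  also have "\<dots> = epow (\<integral>\<^sup>+z. ennreal (norm (density_of (distr_fourier T) z) powr p) \<partial>lborel) (1 / p)"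
    using p by (intro Lnorm_ennreal) simp
  also have "(\<integral>\<^sup>+z. ennreal (norm (density_of (distr_fourier T) z) powr p) \<partial>lborel) = N"
    unfolding N_def
  proof (rule nn_integral_cong_AE)
    show "AE z in lborel. ennreal (norm (density_of (distr_fourier T) z) powr p) = ennreal (norm (H z) powr p)"
      using density_of_eq[OF phi H] by eventually_elim simp
  qed
  also have "epow N (1 / p) \<le> ennreal Y"
  proof -
    obtain n where n: "N = ennreal n" "0 \<le> n" using le unfolding N_def[symmetric] by (cases N) (auto simp: top_unique)
    then have "n \<le> Y powr p" using le by (simp add: N_def[symmetric] ennreal_le_iff)
    then have "n powr (1 / p) \<le> (Y powr p) powr (1 / p)" using n p by (intro powr_mono2) auto
    then show ?thesis using n p Y by (simp add: epow_ennreal powr_powr ennreal_leI)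
  qed
  finally show ?thesis .
qed

text \<open>Young's convolution inequality in the second variable, for each fixed first variable.
  Writing |\<Phi>| as the product of its powers 1/p and 1/r, Hoelder's inequality contributes S to
  the power p/r, and Fubini one more factor S.\<close>

lemma nn_integral_convolution_powr_le:
  fixes \<Phi> :: "real \<Rightarrow> complex" and h :: "real \<times> real \<Rightarrow> complex"
  assumes r: "1 < r" and p: "1 < p" and rp: "1 / r + 1 / p = 1"
    and \<Phi>[measurable]: "\<Phi> \<in> borel_measurable borel" and h[measurable]: "h \<in> borel_measurable borel"
    and S: "0 < S" "(\<integral>\<^sup>+x. ennreal (norm (\<Phi> x)) \<partial>lborel) \<le> ennreal S"
  shows "(\<integral>\<^sup>+z. ennreal (norm (LINT \<tau>|lborel. \<Phi> (\<tau> - snd z) * h (fst z, \<tau>)) powr p) \<partial>lborel) \<le>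
    ennreal (S powr p) * (\<integral>\<^sup>+z. ennreal (norm (h z) powr p) \<partial>lborel)"
proof -
  have shift: "(\<integral>\<^sup>+\<tau>. ennreal (norm (\<Phi> (\<tau> - t))) \<partial>lborel) \<le> ennreal S" for t
    using nn_integral_lborel_shift[of "\<lambda>\<tau>. ennreal (norm (\<Phi> \<tau>))" t] S(2) by simp
  have shift': "(\<integral>\<^sup>+t. ennreal (norm (\<Phi> (\<tau> - t))) \<partial>lborel) \<le> ennreal S" for \<tau>
    using nn_integral_real_affine[of "\<lambda>t. ennreal (norm (\<Phi> t))" "-1" \<tau>] S(2) by simp
  have pw: "ennreal (norm (LINT \<tau>|lborel. \<Phi> (\<tau> - t) * h (x, \<tau>)) powr p) \<le>
      ennreal (S powr (p / r)) * (\<integral>\<^sup>+\<tau>. ennreal (norm (\<Phi> (\<tau> - t))) * ennreal (norm (h (x, \<tau>)) powr p) \<partial>lborel)" for x t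
  proof -
    define f where "f = (\<lambda>\<tau>. norm (\<Phi> (\<tau> - t)) powr (1 / p) * norm (h (x, \<tau>)))"
    define g where "g = (\<lambda>\<tau>. norm (\<Phi> (\<tau> - t)) powr (1 / r))"
    have fg: "f \<tau> * g \<tau> = norm (\<Phi> (\<tau> - t) * h (x, \<tau>))" for \<tau>
    proof -
      have "norm (\<Phi> (\<tau> - t)) powr (1 / p) * norm (\<Phi> (\<tau> - t)) powr (1 / r) = norm (\<Phi> (\<tau> - t))"
        using rp by (simp add: powr_add[symmetric] add.commute)
      then show ?thesis by (simp add: f_def g_def norm_mult mult_ac)
    qed
    have le: "ennreal (norm (LINT \<tau>|lborel. \<Phi> (\<tau> - t) * h (x, \<tau>))) \<le> (\<integral>\<^sup>+\<tau>. ennreal (f \<tau> * g \<tau>) \<partial>lborel)"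
    proof (cases "integrable lborel (\<lambda>\<tau>. \<Phi> (\<tau> - t) * h (x, \<tau>))")
      case True
      then show ?thesis unfolding fg by (rule integral_norm_bound_ennreal)
    qed (simp add: not_integrable_integral_eq)
    have "ennreal (norm (LINT \<tau>|lborel. \<Phi> (\<tau> - t) * h (x, \<tau>)) powr p) \<le>
      ennreal (S powr (p / r)) * (\<integral>\<^sup>+\<tau>. ennreal (f \<tau> powr p) \<partial>lborel)"
    proof (rule hoelder_bound[OF r p rp _ _ _ _ S(1) _ _ le])
      show "f \<in> borel_measurable lborel" "g \<in> borel_measurable lborel"
        unfolding f_def g_def by measurable
      show "(\<integral>\<^sup>+\<tau>. ennreal (g \<tau> powr r) \<partial>lborel) \<le> ennreal S"
        using shift[of t] r by (simp add: g_def powr_powr)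
    qed (simp_all add: f_def g_def)
    also have "(\<integral>\<^sup>+\<tau>. ennreal (f \<tau> powr p) \<partial>lborel) =
        (\<integral>\<^sup>+\<tau>. ennreal (norm (\<Phi> (\<tau> - t))) * ennreal (norm (h (x, \<tau>)) powr p) \<partial>lborel)"
      using p by (intro nn_integral_cong) (simp add: f_def powr_mult powr_powr ennreal_mult)
    finally show ?thesis .
  qed
  have "(\<lambda>z. LINT \<tau>|lborel. \<Phi> (\<tau> - snd z) * h (fst z, \<tau>)) \<in> borel_measurable borel"
    using borel_measurable_partial_kernel[of h "\<lambda>z. \<Phi> (snd z - fst z)"] by simp
  then have "(\<integral>\<^sup>+z. ennreal (norm (LINT \<tau>|lborel. \<Phi> (\<tau> - snd z) * h (fst z, \<tau>)) powr p) \<partial>lborel) =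
      (\<integral>\<^sup>+x. \<integral>\<^sup>+t. ennreal (norm (LINT \<tau>|lborel. \<Phi> (\<tau> - t) * h (x, \<tau>)) powr p) \<partial>lborel \<partial>lborel)"
    by (subst nn_integral_lborel_pair) auto
  also have "\<dots> \<le> (\<integral>\<^sup>+x. ennreal (S powr (p / r)) * (ennreal S * (\<integral>\<^sup>+\<tau>. ennreal (norm (h (x, \<tau>)) powr p) \<partial>lborel)) \<partial>lborel)"
  proof (rule nn_integral_mono)
    fix x :: real
    have "(\<integral>\<^sup>+t. ennreal (norm (LINT \<tau>|lborel. \<Phi> (\<tau> - t) * h (x, \<tau>)) powr p) \<partial>lborel) \<le>
        (\<integral>\<^sup>+t. ennreal (S powr (p / r)) * (\<integral>\<^sup>+\<tau>. ennreal (norm (\<Phi> (\<tau> - t))) * ennreal (norm (h (x, \<tau>)) powr p) \<partial>lborel) \<partial>lborel)"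
      by (rule nn_integral_mono) (rule pw)
    also have "\<dots> = ennreal (S powr (p / r)) * (\<integral>\<^sup>+t. \<integral>\<^sup>+\<tau>. ennreal (norm (\<Phi> (\<tau> - t))) * ennreal (norm (h (x, \<tau>)) powr p) \<partial>lborel \<partial>lborel)"
      by (rule nn_integral_cmult) measurable
    also have "(\<integral>\<^sup>+t. \<integral>\<^sup>+\<tau>. ennreal (norm (\<Phi> (\<tau> - t))) * ennreal (norm (h (x, \<tau>)) powr p) \<partial>lborel \<partial>lborel) =
        (\<integral>\<^sup>+\<tau>. \<integral>\<^sup>+t. ennreal (norm (\<Phi> (\<tau> - t))) * ennreal (norm (h (x, \<tau>)) powr p) \<partial>lborel \<partial>lborel)"
      by (rule lborel_pair.Fubini') measurable
    also have "\<dots> = (\<integral>\<^sup>+\<tau>. (\<integral>\<^sup>+t. ennreal (norm (\<Phi> (\<tau> - t))) \<partial>lborel) * ennreal (norm (h (x, \<tau>)) powr p) \<partial>lborel)"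
      by (rule nn_integral_cong, rule nn_integral_multc) measurable
    also have "\<dots> \<le> (\<integral>\<^sup>+\<tau>. ennreal S * ennreal (norm (h (x, \<tau>)) powr p) \<partial>lborel)"
      by (rule nn_integral_mono, rule mult_right_mono[OF shift']) simp
    also have "\<dots> = ennreal S * (\<integral>\<^sup>+\<tau>. ennreal (norm (h (x, \<tau>)) powr p) \<partial>lborel)"
      by (rule nn_integral_cmult) measurable
    finally show "(\<integral>\<^sup>+t. ennreal (norm (LINT \<tau>|lborel. \<Phi> (\<tau> - t) * h (x, \<tau>)) powr p) \<partial>lborel) \<le>
        ennreal (S powr (p / r)) * (ennreal S * (\<integral>\<^sup>+\<tau>. ennreal (norm (h (x, \<tau>)) powr p) \<partial>lborel))"
      by (simp add: mult_left_mono)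
  qed
  also have "\<dots> = ennreal (S powr (p / r)) * (ennreal S * (\<integral>\<^sup>+x. \<integral>\<^sup>+\<tau>. ennreal (norm (h (x, \<tau>)) powr p) \<partial>lborel \<partial>lborel))"
    by (simp add: nn_integral_cmult)
  also have "\<dots> = ennreal (S powr (p / r) * S) * (\<integral>\<^sup>+x. \<integral>\<^sup>+\<tau>. ennreal (norm (h (x, \<tau>)) powr p) \<partial>lborel \<partial>lborel)"
    using S(1) by (simp add: ennreal_mult mult.assoc)
  also have "S powr (p / r) * S = S powr p"
  proof -
    have "p / r + 1 = p * (1 / r + 1 / p)" using p by (simp add: field_simps)
    then have "p / r + 1 = p" using rp by simp
    then have "S powr p = S powr (p / r + 1)" by simp
    then show ?thesis using S(1) by (simp add: powr_add)
  qed
  also have "(\<integral>\<^sup>+x. \<integral>\<^sup>+\<tau>. ennreal (norm (h (x, \<tau>)) powr p) \<partial>lborel \<partial>lborel) = (\<integral>\<^sup>+z. ennreal (norm (h z) powr p) \<partial>lborel)"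
    by (rule nn_integral_lborel_pair[symmetric]) measurable
  finally show ?thesis .
qed

section \<open>The multipliers and the combined estimate\<close>

text \<open>Close to the origin both terms of \<open>chi\<close> equal 1 and cancel; far out both
  vanish.\<close>

lemma chi_bounds:
  assumes phi: "cutoff \<phi>"
  shows "\<bar>chi \<phi> N x\<bar> \<le> 1" and "0 < N \<Longrightarrow> chi \<phi> N x \<noteq> 0 \<Longrightarrow> N / 2 \<le> \<bar>x\<bar> \<and> \<bar>x\<bar> \<le> 5 / 4 * N"
proof -
  show "\<bar>chi \<phi> N x\<bar> \<le> 1"
    using cutoff_bounds(1,2)[OF phi, of "x / N"] cutoff_bounds(1,2)[OF phi, of "2 * (x / N)"]
    unfolding chi_def by linarith
  assume N: "0 < N" and nz: "chi \<phi> N x \<noteq> 0"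
  have "N / 2 \<le> \<bar>x\<bar>"
  proof (rule ccontr)
    assume "\<not> N / 2 \<le> \<bar>x\<bar>"
    then have "\<bar>2 * (x / N)\<bar> \<le> 1" "\<bar>x / N\<bar> \<le> 1" using N by (auto simp: abs_mult field_simps)
    then show False using nz cutoff_bounds(3)[OF phi] by (simp add: chi_def)
  qed
  moreover have "\<bar>x\<bar> \<le> 5 / 4 * N"
  proof (rule ccontr)
    assume "\<not> \<bar>x\<bar> \<le> 5 / 4 * N"
    then have "5 / 4 < \<bar>2 * (x / N)\<bar>" "5 / 4 < \<bar>x / N\<bar>" using N by (auto simp: abs_mult field_simps)
    then show False using nz cutoff_outside[OF phi] by (simp add: chi_def)
  qed
  ultimately show "N / 2 \<le> \<bar>x\<bar> \<and> \<bar>x\<bar> \<le> 5 / 4 * N" by simp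
qed

lemma borel_measurable_chi:
  assumes "cutoff \<phi>"
  shows "chi \<phi> N \<in> borel_measurable borel"
proof -
  have "smooth_real \<phi>" using assms by (simp add: cutoff_def)
  note [measurable] = borel_measurable_continuous_onI[OF smooth_real_continuous[OF this]]
  show ?thesis unfolding chi_def[abs_def] by measurable
qed

text \<open>One estimate for both signs. In \<open>C\<close>, the power of \<open>2 * W * W\<close>
  comes from the kernel integral, 9 from the factors 3 for u and v, and 6 and 5 from absorbing the
  additive constants: 5/2 N3 + 3 \<le> 6 N3 and 5/2 N1 + 2 \<le> 5 N1. The time cutoff adds only the
  bound \<open>S\<close> on the integral of \<open>cutoff_hat\<close>.\<close>

lemma bilin_bounds:
  fixes s :: int
  assumes phi: "cutoff \<phi>" and r: "1 < r" and p: "1 < p" and rp: "1 / r + 1 / p = 1" and br: "1 < b * r"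
    and q: "ennreal (2 * p) \<le> q"
    and W: "0 < W" "(\<integral>\<^sup>+x. ennreal (bracket x powr (- (b * r))) \<partial>lborel) \<le> ennreal W"
    and S: "0 < S" "(\<integral>\<^sup>+x. ennreal (norm (cutoff_hat \<phi> x)) \<partial>lborel) \<le> ennreal S"
    and u: "u \<in> Xhat \<phi> 0 b (ennreal r) q" and v: "v \<in> Xhat \<phi> 0 b (ennreal r) q"
    and N: "1 \<le> N3" "10 * N3 \<le> N1"
    and mu: "0 < \<mu>1" "0 < \<mu>2" "N1 * N3 \<le> 3 * \<mu>1 * \<mu>2" and s: "s = 1 \<or> s = - 1"
    and D: "D \<in> sets borel" "\<And>x y. (x, y) \<in> D \<Longrightarrow> \<mu>1 \<le> \<bar>x + y\<bar> \<and> \<mu>2 \<le> \<bar>x - y\<bar> \<and> \<bar>x\<bar> \<le> 5 / 4 * N1"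
      "\<And>x y. (x, y) \<in> D \<Longrightarrow> \<bar>x + of_int s * y\<bar> \<le> 5 / 4 * N3"
    and m: "m \<in> borel_measurable borel" "\<And>q. norm (m q) \<le> indicator D q"
  defines "C \<equiv> (2 * W * W) powr (1 / r) * 9 * 6 powr (1 / p) * 5 powr (1 / p - enn2real (2 / q))"
    and "T \<equiv> N1 powr (- 1 / r) * N1 powr (1 / p - enn2real (2 / q)) * N3 powr (1 / p - 1 / r)"
  shows "Lhat_norm (ennreal r) (bilin_mult (\<lambda>a b. m (a, b)) u v) \<le>
      ennreal (C * T) * Xhat_norm \<phi> 0 b (ennreal r) q u * Xhat_norm \<phi> 0 b (ennreal r) q v"
    and "Lhat_norm (ennreal r) (mult_time \<phi> (bilin_mult (\<lambda>a b. m (a, b)) u v)) \<le>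
      ennreal (S * C * T) * Xhat_norm \<phi> 0 b (ennreal r) q u * Xhat_norm \<phi> 0 b (ennreal r) q v"
proof -
  have q1: "1 \<le> q"
  proof -
    have "ennreal 1 \<le> ennreal (2 * p)" using p by (intro ennreal_leI) simp
    from order_trans[OF this q] show ?thesis by (simp only: ennreal_1)
  qed
  define G where "G = density_of (distr_fourier u)"
  define K where "K = density_of (distr_fourier v)"
  obtain A \<alpha> where G: "is_density (distr_fourier u) G"
    and A: "0 \<le> A" "Xhat_norm \<phi> 0 b (ennreal r) q u = ennreal A"
    and \<alpha>: "\<And>k. 0 \<le> \<alpha> k" "\<And>k. \<alpha> k \<le> 1"
      "\<And>I. finite I \<Longrightarrow> q \<noteq> \<infinity> \<Longrightarrow> (\<Sum>k\<in>I. \<alpha> k powr enn2real q) \<le> 1"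
      "\<And>k::int. (\<integral>\<^sup>+x. (\<integral>\<^sup>+\<tau>. ennreal (modulation_norm b G (x, \<tau>) powr p) \<partial>lborel) *
        indicator {real_of_int k - 1 / 2..real_of_int k + 1 / 2} x \<partial>lborel) \<le> ennreal ((3 * A * \<alpha> k) powr p)"
    by (rule Xhat_data[OF phi r p rp q1 u, folded G_def]) (rule that)
  obtain B \<beta> where K: "is_density (distr_fourier v) K"
    and B: "0 \<le> B" "Xhat_norm \<phi> 0 b (ennreal r) q v = ennreal B"
    and \<beta>: "\<And>k. 0 \<le> \<beta> k" "\<And>k. \<beta> k \<le> 1"
      "\<And>I. finite I \<Longrightarrow> q \<noteq> \<infinity> \<Longrightarrow> (\<Sum>k\<in>I. \<beta> k powr enn2real q) \<le> 1"
      "\<And>k::int. (\<integral>\<^sup>+x. (\<integral>\<^sup>+\<tau>. ennreal (modulation_norm b K (x, \<tau>) powr p) \<partial>lborel) *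
        indicator {real_of_int k - 1 / 2..real_of_int k + 1 / 2} x \<partial>lborel) \<le> ennreal ((3 * B * \<beta> k) powr p)"
    by (rule Xhat_data[OF phi r p rp q1 v, folded K_def]) (rule that)
  have Gm[measurable]: "G \<in> borel_measurable borel" and Km[measurable]: "K \<in> borel_measurable borel"
    using G K by (simp_all add: is_density_def)
  have Gint: "integrable lborel (\<lambda>z. of_real (1 / (1 + (fst z)\<^sup>2)) * G z)"
  proof (rule integrable_weight_mult[OF r p rp br Gm, of "(3 * A) powr p"])
    fix k
    have "(3 * A * \<alpha> k) powr p \<le> (3 * A) powr p"
      using A(1) \<alpha>(1,2)[of k] p by (intro powr_mono2 mult_left_le) auto
    then show "(\<integral>\<^sup>+x. (\<integral>\<^sup>+\<tau>. ennreal (modulation_norm b G (x, \<tau>) powr p) \<partial>lborel) *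
        indicator {real_of_int k - 1 / 2..real_of_int k + 1 / 2} x \<partial>lborel) \<le> ennreal ((3 * A) powr p)"
      using \<alpha>(4)[of k] ennreal_leI order_trans by blast
  qed simp
  have Kint: "integrable lborel (\<lambda>z. of_real (1 / (1 + (fst z)\<^sup>2)) * K z)"
  proof (rule integrable_weight_mult[OF r p rp br Km, of "(3 * B) powr p"])
    fix k
    have "(3 * B * \<beta> k) powr p \<le> (3 * B) powr p"
      using B(1) \<beta>(1,2)[of k] p by (intro powr_mono2 mult_left_le) auto
    then show "(\<integral>\<^sup>+x. (\<integral>\<^sup>+\<tau>. ennreal (modulation_norm b K (x, \<tau>) powr p) \<partial>lborel) *
        indicator {real_of_int k - 1 / 2..real_of_int k + 1 / 2} x \<partial>lborel) \<le> ennreal ((3 * B) powr p)"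
      using \<beta>(4)[of k] ennreal_leI order_trans by blast
  qed simp
  have m1: "norm (m z) \<le> 1" for z
    by (rule order_trans[OF m(2)]) (simp add: indicator_def)
  \<comment> \<open>The second frequency is at most 5/4 (N1 + N3) \<le> 11/8 N1 in size.\<close>
  have supp: "\<bar>x\<bar> \<le> 2 * N1 \<and> \<bar>y\<bar> \<le> 2 * N1" if "m (x, y) \<noteq> 0" for x y
  proof -
    have xy: "(x, y) \<in> D" using m(2)[of "(x, y)"] that by (cases "(x, y) \<in> D") auto
    have "\<bar>of_int s * y\<bar> = \<bar>y\<bar>" using s by (auto simp: abs_mult)
    then show ?thesis using D(2)[OF xy] D(3)[OF xy] N by linarith
  qed
  define h where "h = mconv m G K"
  have hm: "h \<in> borel_measurable borel"
    using borel_measurable_integrable[OF bilin_integrand_eq(1)[OF phi G K Gint Kint m(1) m1 supp]] by (simp add: h_def)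
  define Y where "Y = C * T * (A * B)"
  have C: "0 \<le> C" and T: "0 \<le> T" using W by (auto simp: C_def T_def)
  have Y: "0 \<le> Y" using C T A(1) B(1) by (simp add: Y_def)
  define e where "e = 1 / p - enn2real (2 / q)"
  have ep: "e * p = 1 - p * enn2real (2 / q)" using p by (simp add: e_def field_simps)
  \<comment> \<open>This is where q \<ge> 2 r' makes the power of the number of intervals monotone
    in its base.\<close>
  have e0: "0 \<le> 1 - p * enn2real (2 / q)"
  proof (cases "q = \<infinity>")
    case False
    then obtain Q where Q: "q = ennreal Q" "0 \<le> Q" by (cases q) auto
    have Qp: "2 * p \<le> Q" using q p Q by (simp add: ennreal_le_iff)
    have "p * enn2real (2 / q) = 2 * p / Q"
      using Q Qp p by (simp add: divide_ennreal flip: ennreal_numeral)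
    then show ?thesis using Qp p by simp
  qed simp
  have main: "(\<integral>\<^sup>+\<zeta>. ennreal (norm (h \<zeta>) powr p) \<partial>lborel) \<le> ennreal (Y powr p)"
  proof -
    have "(\<integral>\<^sup>+\<zeta>. ennreal (norm (h \<zeta>) powr p) \<partial>lborel) \<le>
      ennreal ((2 * W * W / (3 * \<mu>1 * \<mu>2)) powr (p / r)) *
      (\<integral>\<^sup>+x. \<integral>\<^sup>+y. indicator D (x, y) * ((\<integral>\<^sup>+\<tau>. ennreal (modulation_norm b G (x, \<tau>) powr p) \<partial>lborel) *
        (\<integral>\<^sup>+\<tau>. ennreal (modulation_norm b K (y, \<tau>) powr p) \<partial>lborel)) \<partial>lborel \<partial>lborel)"
      unfolding h_def by (rule nn_integral_mconv_powr_le[OF r p rp br W mu(1,2) D(1,2) m Gm Km])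
    also have "\<dots> \<le> ennreal ((2 * W * W / (3 * \<mu>1 * \<mu>2)) powr (p / r)) *
      ennreal (((3 * A) * (3 * B)) powr p * ((2 * (5 / 4 * N3) + 3) * (2 * (5 / 4 * N1) + 2) powr (1 - p * enn2real (2 / q))))"
    proof (rule mult_left_mono)
      show "(\<integral>\<^sup>+x. \<integral>\<^sup>+y. indicator D (x, y) * ((\<integral>\<^sup>+\<tau>. ennreal (modulation_norm b G (x, \<tau>) powr p) \<partial>lborel) *
        (\<integral>\<^sup>+\<tau>. ennreal (modulation_norm b K (y, \<tau>) powr p) \<partial>lborel)) \<partial>lborel \<partial>lborel) \<le>
        ennreal (((3 * A) * (3 * B)) powr p * ((2 * (5 / 4 * N3) + 3) * (2 * (5 / 4 * N1) + 2) powr (1 - p * enn2real (2 / q))))"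
      proof (rule nn_integral_unit_boxes_le[OF p q _ _ _ \<alpha>(1,2,3,4) _ \<beta>(1,2,3,4) s])
        show "\<bar>x\<bar> \<le> 5 / 4 * N1 \<and> \<bar>x + of_int s * y\<bar> \<le> 5 / 4 * N3" if "(x, y) \<in> D" for x y
          using D(2,3)[OF that] by simp
      qed (use A(1) B(1) N in auto)
    qed simp
    also have "\<dots> = ennreal ((2 * W * W / (3 * \<mu>1 * \<mu>2)) powr (p / r) *
      (((3 * A) * (3 * B)) powr p * ((2 * (5 / 4 * N3) + 3) * (2 * (5 / 4 * N1) + 2) powr (1 - p * enn2real (2 / q)))))"
      using N by (subst ennreal_mult[symmetric]) auto
    also have "\<dots> \<le> ennreal ((2 * W * W / (N1 * N3)) powr (p / r) *
      (((3 * A) * (3 * B)) powr p * ((6 * N3) * (5 * N1) powr (1 - p * enn2real (2 / q)))))"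
    proof (intro ennreal_leI mult_mono)
      have "2 * W * W / (3 * \<mu>1 * \<mu>2) \<le> 2 * W * W / (N1 * N3)"
        using mu N W(1) by (intro divide_left_mono mu(3)) (auto intro!: mult_pos_pos)
      then show "(2 * W * W / (3 * \<mu>1 * \<mu>2)) powr (p / r) \<le> (2 * W * W / (N1 * N3)) powr (p / r)"
        using p r mu W(1) by (intro powr_mono2) auto
      show "(2 * (5 / 4 * N1) + 2) powr (1 - p * enn2real (2 / q)) \<le> (5 * N1) powr (1 - p * enn2real (2 / q))"
        using e0 N by (intro powr_mono2) auto
    qed (use N in auto)
    also have "(2 * W * W / (N1 * N3)) powr (p / r) *
      (((3 * A) * (3 * B)) powr p * ((6 * N3) * (5 * N1) powr (1 - p * enn2real (2 / q)))) = Y powr p"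
    proof -
      have N': "0 < N1" "0 < N3" using N by auto
      have x: "0 < 2 * W * W" using W by simp
      have p0: "p \<noteq> 0" using p by simp
      \<comment> \<open>The number of offsets supplies N3 and the kernel integral N3 to the power
        -p/r; together they form the p-th power of the claimed power of N3.\<close>
      have n3: "N3 powr ((1 / p - 1 / r) * p) = N3 * N3 powr (- (p / r))"
      proof -
        have "(1 / p - 1 / r) * p = 1 + - (p / r)" using p0 by (simp add: field_simps)
        then show ?thesis using N' by (simp only: powr_add) simp
      qed
      have "Y powr p = (2 * W * W) powr (1 / r * p) * 9 powr p * 6 powr (1 / p * p) * 5 powr (e * p) *
         (N1 powr (- 1 / r * p) * N1 powr (e * p) * N3 powr ((1 / p - 1 / r) * p)) * (A powr p * B powr p)"
        unfolding Y_def C_def T_def e_def[symmetric] using W N' A(1) B(1)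
        by (simp only: powr_mult powr_powr mult_nonneg_nonneg powr_ge_zero less_imp_le zero_le_numeral)
      also have "\<dots> = (2 * W * W) powr (p / r) * 9 powr p * 6 * 5 powr (e * p) *
         (N1 powr (- (p / r)) * N1 powr (e * p) * (N3 * N3 powr (- (p / r)))) * (A powr p * B powr p)"
        unfolding n3 using p0 by simp
      also have "\<dots> = ((2 * W * W) powr (p / r) * N1 powr (- (p / r)) * N3 powr (- (p / r))) *
         ((9 powr p * (A powr p * B powr p)) * ((6 * N3) * (5 powr (e * p) * N1 powr (e * p))))"
        by (simp only: mult_ac)
      also have "(2 * W * W) powr (p / r) * N1 powr (- (p / r)) * N3 powr (- (p / r)) = (2 * W * W / (N1 * N3)) powr (p / r)"
        using N' x by (simp add: powr_divide powr_mult powr_minus field_simps)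
      also have "9 powr p * (A powr p * B powr p) = ((3 * A) * (3 * B)) powr p"
      proof -
        have "(3 * A) * (3 * B) = 9 * (A * B)" by simp
        then show ?thesis using A(1) B(1) by (simp only: powr_mult zero_le_numeral mult_nonneg_nonneg)
      qed
      also have "5 powr (e * p) * N1 powr (e * p) = (5 * N1) powr (1 - p * enn2real (2 / q))"
        unfolding ep using N' by (simp add: powr_mult)
      finally show ?thesis ..
    qed
    finally show ?thesis .
  qed
  have fin: "ennreal (c * C * T) * ennreal A * ennreal B = ennreal (c * Y)" if "0 \<le> c" for c
    using that C T A(1) B(1) by (simp add: ennreal_mult[symmetric] Y_def mult_ac)
  have "Lhat_norm (ennreal r) (bilin_mult (\<lambda>a b. m (a, b)) u v) \<le> ennreal Y"
  proof (rule Lhat_norm_le[OF phi r p rp is_density_bilin[OF phi G K Gint Kint m(1) m1 supp] Y])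
    have "(\<integral>\<^sup>+z. ennreal (norm (of_real (1 / (2 * pi)) * mconv m G K z) powr p) \<partial>lborel) \<le> (\<integral>\<^sup>+z. ennreal (norm (h z) powr p) \<partial>lborel)"
    proof (intro nn_integral_mono ennreal_leI powr_mono2)
      fix z
      have "1 / (2 * pi) * norm (h z) \<le> 1 * norm (h z)"
        using pi_gt3 by (intro mult_right_mono) auto
      then show "norm (of_real (1 / (2 * pi)) * mconv m G K z) \<le> norm (h z)"
        unfolding norm_mult norm_of_real h_def by simp
    qed (use p in auto)
    then show "(\<integral>\<^sup>+z. ennreal (norm (of_real (1 / (2 * pi)) * mconv m G K z) powr p) \<partial>lborel) \<le> ennreal (Y powr p)"
      using main by (rule order_trans)
  qed
  then show "Lhat_norm (ennreal r) (bilin_mult (\<lambda>a b. m (a, b)) u v) \<le>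
      ennreal (C * T) * Xhat_norm \<phi> 0 b (ennreal r) q u * Xhat_norm \<phi> 0 b (ennreal r) q v"
    using fin[of 1] by (simp add: A(2) B(2))
  have ch: "cutoff_hat \<phi> \<in> borel_measurable borel"
    using borel_measurable_integrable[OF cutoff_hat_integrable[OF phi]] by simp
  have SY: "0 \<le> S * Y" using S(1) Y by simp
  have "Lhat_norm (ennreal r) (mult_time \<phi> (bilin_mult (\<lambda>a b. m (a, b)) u v)) \<le> ennreal (S * Y)"
  proof (rule Lhat_norm_le[OF phi r p rp is_density_mult_time_bilin[OF phi G K Gint Kint m(1) m1 supp] SY])
    have "(\<integral>\<^sup>+z. ennreal (norm (of_real (1 / (4 * pi\<^sup>2)) * (LINT \<tau>|lborel. cutoff_hat \<phi> (\<tau> - snd z) * mconv m G K (fst z, \<tau>))) powr p) \<partial>lborel)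
      \<le> (\<integral>\<^sup>+z. ennreal (norm (LINT \<tau>|lborel. cutoff_hat \<phi> (\<tau> - snd z) * h (fst z, \<tau>)) powr p) \<partial>lborel)"
    proof (intro nn_integral_mono ennreal_leI powr_mono2)
      fix z
      define X where "X = (LINT \<tau>|lborel. cutoff_hat \<phi> (\<tau> - snd z) * h (fst z, \<tau>))"
      have "1 \<le> pi\<^sup>2" using pi_gt3 by (intro one_le_power) auto
      then have "1 / (4 * pi\<^sup>2) \<le> 1" by simp
      then have "1 / (4 * pi\<^sup>2) * norm X \<le> 1 * norm X"
        by (intro mult_right_mono) auto
      then have "norm (of_real (1 / (4 * pi\<^sup>2)) * X) \<le> norm X"
        unfolding norm_mult norm_of_real by simp
      then show "norm (of_real (1 / (4 * pi\<^sup>2)) * (LINT \<tau>|lborel. cutoff_hat \<phi> (\<tau> - snd z) * mconv m G K (fst z, \<tau>))) \<le>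
          norm (LINT \<tau>|lborel. cutoff_hat \<phi> (\<tau> - snd z) * h (fst z, \<tau>))"
        unfolding X_def h_def .
    qed (use p in auto)
    also have "\<dots> \<le> ennreal (S powr p) * (\<integral>\<^sup>+z. ennreal (norm (h z) powr p) \<partial>lborel)"
      by (rule nn_integral_convolution_powr_le[OF r p rp ch hm S])
    also have "\<dots> \<le> ennreal (S powr p) * ennreal (Y powr p)"
      by (intro mult_left_mono main) simp
    also have "\<dots> = ennreal ((S * Y) powr p)"
      using S(1) Y by (simp add: powr_mult ennreal_mult)
    finally show "(\<integral>\<^sup>+z. ennreal (norm (of_real (1 / (4 * pi\<^sup>2)) * (LINT \<tau>|lborel. cutoff_hat \<phi> (\<tau> - snd z) * mconv m G K (fst z, \<tau>))) powr p) \<partial>lborel)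
      \<le> ennreal ((S * Y) powr p)" .
  qed
  then show "Lhat_norm (ennreal r) (mult_time \<phi> (bilin_mult (\<lambda>a b. m (a, b)) u v)) \<le>
      ennreal (S * C * T) * Xhat_norm \<phi> 0 b (ennreal r) q u * Xhat_norm \<phi> 0 b (ennreal r) q v"
    using fin[of S] S(1) by (simp add: A(2) B(2))
qed

lemma chi_multiplier_bound:
  assumes phi: "cutoff \<phi>" and N: "0 < N1" "0 < N3"
    and D: "\<And>z. N3 / 2 \<le> \<bar>l z\<bar> \<Longrightarrow> \<bar>l z\<bar> \<le> 5 / 4 * N3 \<Longrightarrow> N1 / 2 \<le> \<bar>fst z\<bar> \<Longrightarrow> \<bar>fst z\<bar> \<le> 5 / 4 * N1 \<Longrightarrow> z \<in> D"
  shows "norm (complex_of_real (chi \<phi> N3 (l z) * chi \<phi> N1 (fst z) * chi \<phi> N2 (snd z))) \<le> indicator D z"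
proof (cases "chi \<phi> N3 (l z) = 0 \<or> chi \<phi> N1 (fst z) = 0")
  case False
  then have "z \<in> D" using chi_bounds(2)[OF phi] N by (intro D) blast+
  moreover have "\<bar>chi \<phi> N3 (l z)\<bar> * \<bar>chi \<phi> N1 (fst z)\<bar> * \<bar>chi \<phi> N2 (snd z)\<bar> \<le> 1"
    by (intro mult_le_one chi_bounds(1)[OF phi] mult_nonneg_nonneg) auto
  ultimately show ?thesis by (simp add: norm_mult)
qed auto

theorem lemma3p4:
  shows "\<exists>c>0. \<forall>(\<phi> :: real \<Rightarrow> real) (r :: real) (r' :: real) (q :: ennreal) (b :: real) (a :: real) (A :: real).
    cutoff \<phi> \<and> 1 < r \<and> 1 / r + 1 / r' = 1 \<and> ennreal (2 * r') \<le> q \<and> b > 1 / r \<and> 0 < a \<and> 0 < A \<longrightarrow>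
    (\<exists>C>0. \<forall>N1 N2 N3 :: real.
      dyadic N1 \<and> dyadic N2 \<and> dyadic N3 \<and> 1 \<le> N3 \<and> N3 \<le> c * N1 \<and> a \<le> N1 / N2 \<and> N1 / N2 \<le> A \<longrightarrow>
      (\<forall>u \<in> Xhat \<phi> 0 b (ennreal r) q. \<forall>v \<in> Xhat \<phi> 0 b (ennreal r) q.
        Lhat_norm (ennreal r)
          (bilin_mult (\<lambda>\<xi>1 \<xi>2. of_real (chi \<phi> N3 (\<xi>1 - \<xi>2) * chi \<phi> N1 \<xi>1 * chi \<phi> N2 \<xi>2)) u v)
        + Lhat_norm (ennreal r) (mult_time \<phi>
          (bilin_mult (\<lambda>\<xi>1 \<xi>2. of_real (chi \<phi> N3 (\<xi>1 + \<xi>2) * chi \<phi> N1 \<xi>1 * chi \<phi> N2 \<xi>2)) u v))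
        \<le> ennreal (C * N1 powr (- 1 / r) * N1 powr (1 / r' - enn2real (2 / q))
                      * N3 powr (1 / r' - 1 / r))
          * Xhat_norm \<phi> 0 b (ennreal r) q u * Xhat_norm \<phi> 0 b (ennreal r) q v))"
proof -
  have "\<exists>C>0. \<forall>N1 N2 N3 :: real.
      dyadic N1 \<and> dyadic N2 \<and> dyadic N3 \<and> 1 \<le> N3 \<and> N3 \<le> 1 / 10 * N1 \<and> a \<le> N1 / N2 \<and> N1 / N2 \<le> A \<longrightarrow>
      (\<forall>u \<in> Xhat \<phi> 0 b (ennreal r) q. \<forall>v \<in> Xhat \<phi> 0 b (ennreal r) q.
        Lhat_norm (ennreal r)
          (bilin_mult (\<lambda>\<xi>1 \<xi>2. of_real (chi \<phi> N3 (\<xi>1 - \<xi>2) * chi \<phi> N1 \<xi>1 * chi \<phi> N2 \<xi>2)) u v)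
        + Lhat_norm (ennreal r) (mult_time \<phi>
          (bilin_mult (\<lambda>\<xi>1 \<xi>2. of_real (chi \<phi> N3 (\<xi>1 + \<xi>2) * chi \<phi> N1 \<xi>1 * chi \<phi> N2 \<xi>2)) u v))
        \<le> ennreal (C * N1 powr (- 1 / r) * N1 powr (1 / p - enn2real (2 / q))
                      * N3 powr (1 / p - 1 / r))
          * Xhat_norm \<phi> 0 b (ennreal r) q u * Xhat_norm \<phi> 0 b (ennreal r) q v)"
    if phi: "cutoff \<phi>" and r: "1 < r" and rp: "1 / r + 1 / p = 1" and q: "ennreal (2 * p) \<le> q" and b: "1 / r < b"
    for \<phi> r p q b a A
  proof -
    have r1: "0 < 1 / r" "1 / r < 1" using r by simp_all
    have "0 < 1 / p" "1 / p < 1" using r1 rp by linarith+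
    then have p: "1 < p" by (simp add: divide_less_eq_1)
    have br: "1 < b * r" using b r by (simp add: field_simps)
    \<comment> \<open>Adding 1 makes the constant strictly positive, as \<open>hoelder_bound\<close>
      requires; \<open>S\<close> is treated alike.\<close>
    define W where "W = enn2real (\<integral>\<^sup>+x. ennreal (bracket x powr (- (b * r))) \<partial>lborel) + 1"
    have W: "0 < W" "(\<integral>\<^sup>+x. ennreal (bracket x powr (- (b * r))) \<partial>lborel) \<le> ennreal W"
    proof -
      obtain w where w: "(\<integral>\<^sup>+x. ennreal (bracket x powr (- (b * r))) \<partial>lborel) = ennreal w" "0 \<le> w"
        using nn_integral_bracket_finite[OF br] by (cases "\<integral>\<^sup>+x. ennreal (bracket x powr (- (b * r))) \<partial>lborel") auto
      show "0 < W" by (simp add: W_def add_nonneg_pos)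
      show "(\<integral>\<^sup>+x. ennreal (bracket x powr (- (b * r))) \<partial>lborel) \<le> ennreal W"
        unfolding W_def w(1) using w(2) by (intro ennreal_leI) simp
    qed
    define S where "S = enn2real (\<integral>\<^sup>+x. ennreal (norm (cutoff_hat \<phi> x)) \<partial>lborel) + 1"
    have S: "0 < S" "(\<integral>\<^sup>+x. ennreal (norm (cutoff_hat \<phi> x)) \<partial>lborel) \<le> ennreal S"
    proof -
      have "(\<integral>\<^sup>+x. ennreal (norm (cutoff_hat \<phi> x)) \<partial>lborel) < \<infinity>"
        using cutoff_hat_integrable[OF phi] by (simp add: integrable_iff_bounded)
      then obtain w where w: "(\<integral>\<^sup>+x. ennreal (norm (cutoff_hat \<phi> x)) \<partial>lborel) = ennreal w" "0 \<le> w"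
        by (cases "\<integral>\<^sup>+x. ennreal (norm (cutoff_hat \<phi> x)) \<partial>lborel") auto
      show "0 < S" by (simp add: S_def add_nonneg_pos)
      show "(\<integral>\<^sup>+x. ennreal (norm (cutoff_hat \<phi> x)) \<partial>lborel) \<le> ennreal S"
        unfolding S_def w(1) using w(2) by (intro ennreal_leI) simp
    qed
    define C where "C = (2 * W * W) powr (1 / r) * 9 * 6 powr (1 / p) * 5 powr (1 / p - enn2real (2 / q))"
    have C: "0 < C" using W(1) by (simp add: C_def)
    show ?thesis
    proof (intro exI[of _ "(1 + S) * C"] conjI allI impI ballI)
      show "0 < (1 + S) * C" using S(1) C by (intro mult_pos_pos) auto
      fix N1 N2 N3 :: real and u v
      assume N: "dyadic N1 \<and> dyadic N2 \<and> dyadic N3 \<and> 1 \<le> N3 \<and> N3 \<le> 1 / 10 * N1 \<and> a \<le> N1 / N2 \<and> N1 / N2 \<le> A"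
        and u: "u \<in> Xhat \<phi> 0 b (ennreal r) q" and v: "v \<in> Xhat \<phi> 0 b (ennreal r) q"
      have N': "1 \<le> N3" "10 * N3 \<le> N1" using N by auto
      define T where "T = N1 powr (- 1 / r) * N1 powr (1 / p - enn2real (2 / q)) * N3 powr (1 / p - 1 / r)"
      note [measurable] = borel_measurable_chi[OF phi]
      note bounds = bilin_bounds[OF phi r p rp br q W S u v N', folded C_def T_def]
      \<comment> \<open>If one of x + y and x - y is at most 5/4 N3 \<le> N1 / 8 in size while |x|
        \<ge> N1 / 2, the other is at least N1 - N1 / 8 = 7/8 N1, since the two add up to 2 x. The
        product 3 * 7/8 * 1/2 = 21/16 leaves room for \<open>N1 * N3\<close>.\<close>
      have mu: "N1 * N3 \<le> 3 * (7 / 8 * N1) * (N3 / 2)" "N1 * N3 \<le> 3 * (N3 / 2) * (7 / 8 * N1)"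
        "0 < 7 / 8 * N1" "0 < N3 / 2"
        using N' by auto
      have minus: "Lhat_norm (ennreal r)
          (bilin_mult (\<lambda>\<xi>1 \<xi>2. of_real (chi \<phi> N3 (\<xi>1 - \<xi>2) * chi \<phi> N1 \<xi>1 * chi \<phi> N2 \<xi>2)) u v) \<le>
          ennreal (C * T) * Xhat_norm \<phi> 0 b (ennreal r) q u * Xhat_norm \<phi> 0 b (ennreal r) q v"
      proof -
        define D where "D = {z :: real \<times> real. N3 / 2 \<le> \<bar>fst z - snd z\<bar> \<and> \<bar>fst z - snd z\<bar> \<le> 5 / 4 * N3 \<and>
          N1 / 2 \<le> \<bar>fst z\<bar> \<and> \<bar>fst z\<bar> \<le> 5 / 4 * N1}"
        have "D \<in> sets borel"
          unfolding D_def by (intro borel_closed closed_Collect_conj closed_Collect_le continuous_intros)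
        moreover have "7 / 8 * N1 \<le> \<bar>x + y\<bar> \<and> N3 / 2 \<le> \<bar>x - y\<bar> \<and> \<bar>x\<bar> \<le> 5 / 4 * N1"
          "\<bar>x + of_int (- 1) * y\<bar> \<le> 5 / 4 * N3" if "(x, y) \<in> D" for x y
        proof -
          have d: "N3 / 2 \<le> \<bar>x - y\<bar>" "\<bar>x - y\<bar> \<le> 5 / 4 * N3" "N1 / 2 \<le> \<bar>x\<bar>" "\<bar>x\<bar> \<le> 5 / 4 * N1"
            using that by (simp_all add: D_def)
          then show "7 / 8 * N1 \<le> \<bar>x + y\<bar> \<and> N3 / 2 \<le> \<bar>x - y\<bar> \<and> \<bar>x\<bar> \<le> 5 / 4 * N1"
            using N' by linarith
          show "\<bar>x + of_int (- 1) * y\<bar> \<le> 5 / 4 * N3" using d by simp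
        qed
        moreover have "norm (complex_of_real (chi \<phi> N3 (fst z - snd z) * chi \<phi> N1 (fst z) * chi \<phi> N2 (snd z))) \<le> indicator D z" for z
          using N' by (intro chi_multiplier_bound[OF phi]) (auto simp: D_def)
        moreover have "(\<lambda>z. complex_of_real (chi \<phi> N3 (fst z - snd z) * chi \<phi> N1 (fst z) * chi \<phi> N2 (snd z))) \<in> borel_measurable borel"
          by measurable
        ultimately show ?thesis
          using bounds(1)[OF mu(3,4,1) disjI2[OF refl], of D "\<lambda>z. complex_of_real (chi \<phi> N3 (fst z - snd z) * chi \<phi> N1 (fst z) * chi \<phi> N2 (snd z))"]
          by simp
      qed
      \<comment> \<open>Compared with \<open>minus\<close>, the two factors of the phase derivative
        exchange sizes: \<xi> = x + y is now of size N3 and 2 x - \<xi> = x - y of size N1.\<close>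
      have plus: "Lhat_norm (ennreal r) (mult_time \<phi>
          (bilin_mult (\<lambda>\<xi>1 \<xi>2. of_real (chi \<phi> N3 (\<xi>1 + \<xi>2) * chi \<phi> N1 \<xi>1 * chi \<phi> N2 \<xi>2)) u v)) \<le>
          ennreal (S * C * T) * Xhat_norm \<phi> 0 b (ennreal r) q u * Xhat_norm \<phi> 0 b (ennreal r) q v"
      proof -
        define D where "D = {z :: real \<times> real. N3 / 2 \<le> \<bar>fst z + snd z\<bar> \<and> \<bar>fst z + snd z\<bar> \<le> 5 / 4 * N3 \<and>
          N1 / 2 \<le> \<bar>fst z\<bar> \<and> \<bar>fst z\<bar> \<le> 5 / 4 * N1}"
        have "D \<in> sets borel"
          unfolding D_def by (intro borel_closed closed_Collect_conj closed_Collect_le continuous_intros)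
        moreover have "N3 / 2 \<le> \<bar>x + y\<bar> \<and> 7 / 8 * N1 \<le> \<bar>x - y\<bar> \<and> \<bar>x\<bar> \<le> 5 / 4 * N1"
          "\<bar>x + of_int 1 * y\<bar> \<le> 5 / 4 * N3" if "(x, y) \<in> D" for x y
        proof -
          have d: "N3 / 2 \<le> \<bar>x + y\<bar>" "\<bar>x + y\<bar> \<le> 5 / 4 * N3" "N1 / 2 \<le> \<bar>x\<bar>" "\<bar>x\<bar> \<le> 5 / 4 * N1"
            using that by (simp_all add: D_def)
          then show "N3 / 2 \<le> \<bar>x + y\<bar> \<and> 7 / 8 * N1 \<le> \<bar>x - y\<bar> \<and> \<bar>x\<bar> \<le> 5 / 4 * N1"
            using N' by linarith
          show "\<bar>x + of_int 1 * y\<bar> \<le> 5 / 4 * N3" using d by simp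
        qed
        moreover have "norm (complex_of_real (chi \<phi> N3 (fst z + snd z) * chi \<phi> N1 (fst z) * chi \<phi> N2 (snd z))) \<le> indicator D z" for z
          using N' by (intro chi_multiplier_bound[OF phi]) (auto simp: D_def)
        moreover have "(\<lambda>z. complex_of_real (chi \<phi> N3 (fst z + snd z) * chi \<phi> N1 (fst z) * chi \<phi> N2 (snd z))) \<in> borel_measurable borel"
          by measurable
        ultimately show ?thesis
          using bounds(2)[OF mu(4,3,2) disjI1[OF refl], of D "\<lambda>z. complex_of_real (chi \<phi> N3 (fst z + snd z) * chi \<phi> N1 (fst z) * chi \<phi> N2 (snd z))"]
          by simp
      qed
      have T: "0 \<le> T" by (simp add: T_def)
      have "ennreal (C * T) * X * Y + ennreal (S * C * T) * X * Y = ennreal ((1 + S) * C * T) * X * Y" for X Y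
      proof -
        have "ennreal (C * T) + ennreal (S * C * T) = ennreal ((1 + S) * C * T)"
          using C S(1) T by (subst ennreal_plus[symmetric]) (auto simp: algebra_simps)
        then show ?thesis by (simp only: distrib_right[symmetric])
      qed
      with add_mono[OF minus plus]
      show "Lhat_norm (ennreal r)
          (bilin_mult (\<lambda>\<xi>1 \<xi>2. of_real (chi \<phi> N3 (\<xi>1 - \<xi>2) * chi \<phi> N1 \<xi>1 * chi \<phi> N2 \<xi>2)) u v)
        + Lhat_norm (ennreal r) (mult_time \<phi>
          (bilin_mult (\<lambda>\<xi>1 \<xi>2. of_real (chi \<phi> N3 (\<xi>1 + \<xi>2) * chi \<phi> N1 \<xi>1 * chi \<phi> N2 \<xi>2)) u v))
        \<le> ennreal ((1 + S) * C * N1 powr (- 1 / r) * N1 powr (1 / p - enn2real (2 / q)) * N3 powr (1 / p - 1 / r))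
          * Xhat_norm \<phi> 0 b (ennreal r) q u * Xhat_norm \<phi> 0 b (ennreal r) q v"
        by (simp only: T_def mult.assoc)
    qed
  qed
  then show ?thesis by (intro exI[of _ "1 / 10"]) auto
qed

end
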